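(* Let $\omega>0$, $l\in\mathbb Z_{\ge0}$, and for $\mu>0$ set $(B,A)=(\omega l,2\omega\mu)$. Let $Q=\hat W_-^{-1}W_+M_N=\begin{pmatrix}-a&b\\-c&a\end{pmatrix}$ be the transition matrix. Then for every $\mu>0$ one has $b=b(B,A)\in i\mathbb R$, and $c=c(B,A)\in i\mathbb R$ whenever $(B,A)$ is a constriction. Moreover, for $l\in\mathbb N$ the set of $\mu>0$ for which $c(B,A)\in i\mathbb R$ is discrete.
   Context: System (L): $u'=z^{-2}\big(-(lz+\mu(1+z^2))u+\frac{z}{2i\omega}v\big)$, $v'=\frac{1}{2i\omega z}u$, with $l=B/\omega$, $\mu=A/(2\omega)$. $F(z)=\operatorname{diag}(z^{-l}e^{\mu(1/z-z)},1)$; $S_\pm$ sectors with vertex $0$ containing the closed upper/lower half-plane minus $0$, closures avoiding $i\mathbb R_\mp$, $S_-=\overline{S_+}$; $H_\pm$ the unique invertible matrix functions holomorphic on $S_\pm$, $C^\infty$ on $\overline{S_\pm}\setminus\{\infty\}$, $H_\pm(0)=\mathrm{Id}$, transforming (L) into $\tilde u'=-z^{-2}(lz+\mu(1+z^2))\tilde u$, $\tilde v'=0$; $W_+=H_+F$. $\Sigma_1$ is the component of $S_+\cap S_-$ containing $\mathbb R_+$; $M_N=\operatorname{diag}(e^{-2\pi il},1)$ (equal to $\mathrm{Id}$ for $l\in\mathbb Z$); $\mathbb I:(u,v)(z)\mapsto -iz^{-l}e^{\mu(1/z-z)}(-v(z^{-1}),u(z^{-1}))$; $\hat W_-=\mathbb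 I(W_+M_N)$ columnwise; $Q$ is the constant matrix with $W_+M_N=\hat W_-Q$ on $\Sigma_1$ (known to have the displayed form). Constriction: for $\frac{d\phi}{dt}=-\sin\phi+B+A\cos\omega t$ with rotation number $\rho$, the phase-lock areas $L_r=\{\rho=r\}$ (nonempty interior) are chains of bounded domains going to infinity vertically, consecutive domains separated by single points; such points off $\{A=0\}$ are constrictions. *)

theory Defs
  imports "HOL-Complex_Analysis.Complex_Analysis"
begin

definition is_josephson_solution :: "real \<Rightarrow> real \<Rightarrow> real \<Rightarrow> (real \<Rightarrow> real) \<Rightarrow> bool" where
  "is_josephson_solution om B A phi \<longleftrightarrow>
     (\<forall>t. (phi has_real_derivative (- sin (phi t) + B + A * cos (om * t))) (at t))"

definition rotation_number :: "real \<Rightarrow> real \<Rightarrow> real \<Rightarrow> real" where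
  "rotation_number om B A = (THE r. \<forall>phi. is_josephson_solution om B A phi \<longrightarrow>
       ((\<lambda>t. phi t / (om * t)) \<longlongrightarrow> r) at_top)"

definition level_set_rot :: "real \<Rightarrow> real \<Rightarrow> (real \<times> real) set" where
  "level_set_rot om r = {(B, A). rotation_number om B A = r}"

definition phase_lock_area :: "real \<Rightarrow> real \<Rightarrow> bool" where
  "phase_lock_area om r \<longleftrightarrow> interior (level_set_rot om r) \<noteq> {}"

definition constriction :: "real \<Rightarrow> real \<Rightarrow> real \<Rightarrow> bool" where
  "constriction om B A \<longleftrightarrow> A \<noteq> 0 \<and>
     (\<exists>r. phase_lock_area om r \<and> (B, A) \<in> level_set_rot om r \<and>
        (\<exists>C1 C2. C1 \<in> components (interior (level_set_rot om r)) \<and>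
                 C2 \<in> components (interior (level_set_rot om r)) \<and> C1 \<noteq> C2 \<and>
                 (B, A) \<in> closure C1 \<and> (B, A) \<in> closure C2))"

definition mat2 :: "complex \<Rightarrow> complex \<Rightarrow> complex \<Rightarrow> complex \<Rightarrow> complex^2^2" where
  "mat2 a b c d = (\<chi> i j. if i = 1 then (if j = 1 then a else b) else (if j = 1 then c else d))"

definition mderiv :: "(complex \<Rightarrow> complex^2^2) \<Rightarrow> complex \<Rightarrow> complex^2^2" where
  "mderiv H z = (\<chi> i j. deriv (\<lambda>w. H w $ i $ j) z)"

text \<open>Coefficient matrix of (L) with l = B/omega, mu = A/(2 omega):
  u' = z^-2 (-(l z + mu (1+z^2)) u + z/(2 i omega) v),  v' = 1/(2 i omega z) u.\<close>
definition Kmat :: "real \<Rightarrow> nat \<Rightarrow> real \<Rightarrow> complex \<Rightarrow> complex^2^2" where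
  "Kmat om l mu z = mat2 (- (of_nat l * z + of_real mu * (1 + z^2)) / z^2)
                         (1 / (2 * \<i> * of_real om * z))
                         (1 / (2 * \<i> * of_real om * z)) 0"

text \<open>Coefficient matrix of the normal form u' = -z^-2 (l z + mu(1+z^2)) u, v' = 0.\<close>
definition Dmat :: "real \<Rightarrow> nat \<Rightarrow> real \<Rightarrow> complex \<Rightarrow> complex^2^2" where
  "Dmat om l mu z = mat2 (- (of_nat l * z + of_real mu * (1 + z^2)) / z^2) 0 0 0"

text \<open>The scalar factor z^{-l} e^{mu(1/z - z)} (l a nonnegative integer, no branch needed).\<close>
definition expfac :: "nat \<Rightarrow> real \<Rightarrow> complex \<Rightarrow> complex" where
  "expfac l mu z = inverse (z ^ l) * exp (of_real mu * (1 / z - z))"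

definition Fmat :: "nat \<Rightarrow> real \<Rightarrow> complex \<Rightarrow> complex^2^2" where
  "Fmat l mu z = mat2 (expfac l mu z) 0 0 1"

definition MN :: "nat \<Rightarrow> complex^2^2" where
  "MN l = mat2 (exp (- 2 * of_real pi * \<i> * of_nat l)) 0 0 1"

definition sector :: "real \<Rightarrow> real \<Rightarrow> complex set" where
  "sector t1 t2 = {z. z \<noteq> 0 \<and> (\<exists>t. t1 < t \<and> t < t2 \<and> z = of_real (cmod z) * cis t)}"

text \<open>Admissible S_+: a sector with vertex 0 containing the closed upper half-plane minus 0,
  whose closure avoids the negative imaginary half-axis.\<close>
definition admissible_Splus :: "complex set \<Rightarrow> bool" where
  "admissible_Splus S \<longleftrightarrow> (\<exists>t1 t2. - pi/2 < t1 \<and> t1 < 0 \<and> pi < t2 \<and> t2 < 3*pi/2 \<and>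
                              S = sector t1 t2)"

definition Sminus :: "complex set \<Rightarrow> complex set" where
  "Sminus S = cnj ` S"

text \<open>Sigma_1: the component of S_+ \<inter> S_- containing the positive real half-axis.\<close>
definition Sigma1 :: "complex set \<Rightarrow> complex set" where
  "Sigma1 S = connected_component_set (S \<inter> Sminus S) 1"

text \<open>H is the normalising matrix function on the sector S: holomorphic and invertible on S,
  C-infinity up to the boundary (all complex derivatives extend continuously to the closure
  of S in C), H(0) = Id (as a limit within S), and Y = H Y~ transforms the normal form into (L),
  i.e. H' = K H - H D.\<close>
definition is_normaliser :: "real \<Rightarrow> nat \<Rightarrow> real \<Rightarrow> complex set \<Rightarrow> (complex \<Rightarrow> complex^2^2) \<Rightarrow> bool" where
  "is_normaliser om l mu S H \<longleftrightarrow>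
     (\<forall>i j. (\<lambda>z. H z $ i $ j) holomorphic_on S) \<and>
     (\<forall>z\<in>S. det (H z) \<noteq> 0) \<and>
     (\<forall>k i j. \<exists>g. continuous_on (closure S) g \<and>
                  (\<forall>z\<in>S. g z = (deriv ^^ k) (\<lambda>w. H w $ i $ j) z)) \<and>
     (\<forall>i j. ((\<lambda>z. H z $ i $ j) \<longlongrightarrow> mat 1 $ i $ j) (at 0 within S)) \<and>
     (\<forall>z\<in>S. mderiv H z = Kmat om l mu z ** H z - H z ** Dmat om l mu z)"

definition WplusMN :: "nat \<Rightarrow> real \<Rightarrow> (complex \<Rightarrow> complex^2^2) \<Rightarrow> complex \<Rightarrow> complex^2^2" where
  "WplusMN l mu H z = H z ** Fmat l mu z ** MN l"

text \<open>hat W_- = I(W_+ M_N) columnwise, where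
  I : (u,v)(z) \<mapsto> -i z^{-l} e^{mu(1/z-z)} (-v(1/z), u(1/z)).\<close>
definition What :: "nat \<Rightarrow> real \<Rightarrow> (complex \<Rightarrow> complex^2^2) \<Rightarrow> complex \<Rightarrow> complex^2^2" where
  "What l mu H z = (\<chi> i j.
      if i = 1 then - \<i> * expfac l mu z * (- (WplusMN l mu H (1 / z) $ 2 $ j))
      else - \<i> * expfac l mu z * (WplusMN l mu H (1 / z) $ 1 $ j))"

end

theory Submission
  imports Defs
begin

text \<open>
  Write \<open>f1\<close>, \<open>f2\<close> for the columns of \<open>W\<^sub>+\<close> and \<open>(u1, v1)\<close>, \<open>(u2, v2)\<close> for their values at
  \<open>z = 1\<close>. Evaluating the transition relation there gives \<open>b = \<i> (u2\<^sup>2 + v2\<^sup>2)\<close> and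
  \<open>c = \<i> (u1\<^sup>2 + v1\<^sup>2)\<close>, and \<open>u1 v2 - u2 v1 = 1\<close>. The equation (L) is invariant under
  \<open>(u, v)(z) \<mapsto> (cnj u, - cnj v)(cnj z)\<close>. An energy estimate shows that a solution vanishing at
  \<open>0\<close> along the positive axis is zero; hence \<open>u2 = \<i> p\<close>, \<open>v2 = t\<close> with \<open>p\<close>, \<open>t\<close> real, and \<open>b\<close> is
  imaginary. Likewise \<open>f1\<close> is symmetric along the negative axis.

  On the unit circle (L) is the linearisation of the Josephson equation. At a constriction the
  Poincare map is a translation: otherwise the level set of the rotation number is, near the point,
  either a neighbourhood or the region on one side of a graph, whose interior is connected. So the
  monodromy is scalar, the continuations of \<open>f1\<close> through the two half-planes agree at \<open>1\<close>, and \<open>u1\<close>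
  is real and \<open>v1\<close> imaginary. (Rotation numbers with open level set are integers because a Moebius
  map with a periodic point that is not fixed has finite order, contradicting monotonicity in \<open>B\<close>.)

  In general \<open>Re c\<close> is a multiple of \<open>\<tau> \<alpha>\<close>, where \<open>\<tau>\<close> is half a Stokes multiplier and
  \<open>\<alpha> = Re a\<close>. If \<open>\<tau> = 0\<close>, the solution \<open>f1\<close> divided by its exponential factor is holomorphic at
  \<open>0\<close>, and its Taylor coefficients solve a three-term recurrence; this forces \<open>mu\<close> to be a zero of
  an entire function that does not vanish far out on the imaginary axis. The function \<open>\<alpha>\<close> extends
  holomorphically to \<open>Re mu > 0\<close> by Montel's theorem, and is nonzero at a parameter for which (L) has
  an entire solution with coefficients of alternating sign: there \<open>\<alpha> = 0\<close> would make \<open>f1\<close> a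
  multiple of the image of that solution under the involution \<open>z \<mapsto> 1 / z\<close>, which is unbounded.
\<close>

section \<open>Ordinary differential equations\<close>


text \<open>No hypothesis relates \<open>S\<close> and \<open>H\<close> for different
  \<open>mu\<close>, so nothing analytic in \<open>mu\<close> can be read off the normalisers, and
  \<open>\<tau>\<close> is not shown to be analytic at all. Discreteness only needs the zero set of
  Re c to lie in a union of two discrete sets, so each factor gets its own holomorphic function: for
  \<open>\<alpha>\<close> a limit of solutions of regular initial value problems, for the zeros of
  \<open>\<tau>\<close> an entire function that must vanish there. At the irregular singular point a
  column is pinned down by its limit only along suitable rays. Column 2 is used on the positive
  axis, column 1 divided by \<open>expfac\<close> on the negative one: there the equal off-diagonal
  entries are imaginary and cancel in the energy, while the real parts of the diagonal entries are
  bounded above. On the opposite axis one of them tends to plus infinity, which is why reality of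
  column 1 at \<open>1\<close> is an extra condition and not automatic. The point \<open>1\<close>
  is singled out because inversion fixes it and \<open>expfac\<close> equals 1 there.\<close>

text \<open>Oriented integral from 0: for either sign of \<open>t\<close> one of the two intervals
  is empty or a point, so Picard iteration runs in both time directions at once.\<close>

definition primitive :: "(real \<Rightarrow> 'a::banach) \<Rightarrow> real \<Rightarrow> 'a" where
  "primitive g t = integral {0..t} g - integral {t..0} g"

lemma primitive_0 [simp]: "primitive g 0 = 0"
  by (simp add: primitive_def)

lemma primitive_has_vector_derivative:
  fixes g :: "real \<Rightarrow> 'a::banach"
  assumes g: "continuous_on UNIV g"
  shows "(primitive g has_vector_derivative g t) (at t)"
proof -
  define N where "N = \<bar>t\<bar> + 1"
  have cont: "continuous_on {a..b} g" for a b
    using g continuous_on_subset by blast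
  have int: "g integrable_on {a..b}" for a b
    using cont integrable_continuous_interval by blast
  have eq: "primitive g s = integral {-N..s} g - integral {-N..0} g" if "s \<in> {-N<..<N}" for s
  proof (cases "s \<ge> 0")
    case True
    have "integral {-N..0} g + integral {0..s} g = integral {-N..s} g"
      by (rule Henstock_Kurzweil_Integration.integral_combine) (use True N_def int in auto)
    moreover have "integral {s..0} g = 0"
      using True by (cases "s = 0") auto
    ultimately show ?thesis by (simp add: primitive_def algebra_simps)
  next
    case False
    have "integral {-N..s} g + integral {s..0} g = integral {-N..0} g"
      by (rule Henstock_Kurzweil_Integration.integral_combine) (use False that int in auto)
    moreover have "integral {0..s} g = 0"
      using False by auto
    ultimately show ?thesis by (simp add: primitive_def algebra_simps)
  qed
  have tN: "t \<in> {-N<..<N}" by (auto simp: N_def)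
  have "((\<lambda>u. integral {-N..u} g) has_vector_derivative g t) (at t within {-N..N})"
    by (rule integral_has_vector_derivative[OF cont]) (use tN in auto)
  then have "((\<lambda>u. integral {-N..u} g) has_vector_derivative g t) (at t)"
    using tN by (subst (asm) at_within_interior) (auto simp: interior_atLeastAtMost_real)
  then have "((\<lambda>u. integral {-N..u} g - integral {-N..0} g) has_vector_derivative g t - 0) (at t)"
    by (intro has_vector_derivative_diff) auto
  then have "((\<lambda>u. integral {-N..u} g - integral {-N..0} g) has_vector_derivative g t) (at t)"
    by simp
  then show ?thesis
    by (rule has_vector_derivative_transform_within_open[where S = "{-N<..<N}"]) (use eq tN in auto)
qed

text \<open>One step of Picard iteration gains a power of the time and a factor 1/(n+1); repeating
  it produces the factorial in the convergence estimate.\<close>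

lemma norm_le_of_derivative_le_power:
  fixes d :: "real \<Rightarrow> 'a::real_normed_vector"
  assumes der: "\<And>s. (d has_vector_derivative d' s) (at s)" and "d 0 = 0"
    and bd: "\<And>s. \<bar>s\<bar> \<le> T \<Longrightarrow> norm (d' s) \<le> K * \<bar>s\<bar> ^ n" and t: "\<bar>t\<bar> \<le> T"
  shows "norm (d t) \<le> K * \<bar>t\<bar> ^ Suc n / real (Suc n)"
proof -
  have main: "norm (e x) \<le> K * x ^ Suc n / real (Suc n)"
    if der: "\<And>s. (e has_vector_derivative e' s) (at s)" and "e 0 = 0"
      and bd: "\<And>s. 0 \<le> s \<Longrightarrow> s \<le> T \<Longrightarrow> norm (e' s) \<le> K * s ^ n" and x: "0 < x" "x \<le> T"
    for e :: "real \<Rightarrow> 'a" and e' x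
  proof -
    have "norm (e x - e 0) \<le> K * x ^ Suc n / real (Suc n) - K * 0 ^ Suc n / real (Suc n)"
    proof (rule differentiable_bound_general[where \<phi>' = "\<lambda>s. K * s ^ n" and f' = e'])
      show "continuous_on {0..x} e"
        using der has_vector_derivative_continuous continuous_at_imp_continuous_on by blast
      show "((\<lambda>x. K * x ^ Suc n / real (Suc n)) has_vector_derivative K * s ^ n) (at s)" for s
        unfolding has_real_derivative_iff_has_vector_derivative[symmetric]
        by (rule derivative_eq_intros refl | simp add: field_simps del: of_nat_Suc)+
    qed (use x der bd in \<open>auto intro!: continuous_intros\<close>)
    then show ?thesis using \<open>e 0 = 0\<close> by simp
  qed
  consider "t = 0" | "t > 0" | "t < 0" by linarith
  then show ?thesis
  proof cases
    case 1 then show ?thesis using \<open>d 0 = 0\<close> by simp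
  next
    case 2
    have "norm (d t) \<le> K * t ^ Suc n / real (Suc n)"
    proof (rule main[of d d' t])
      show "norm (d' s) \<le> K * s ^ n" if "0 \<le> s" "s \<le> T" for s
        using bd[of s] that by simp
    qed (use 2 assms in auto)
    then show ?thesis using 2 by simp
  next
    case 3
    have this': "((\<lambda>s. d (- s)) has_vector_derivative - d' (- s)) (at s)" for s
      using vector_diff_chain_at[OF has_vector_derivative_minus[OF has_vector_derivative_id, of "at s"], of d "d' (-s)"] der[of "-s"]
      by (simp add: o_def)
    have "norm (d (- (- t))) \<le> K * (- t) ^ Suc n / real (Suc n)"
    proof (rule main[of "\<lambda>s. d (- s)" "\<lambda>s. - d' (- s)" "- t", OF this'])
      show "norm (- d' (- s)) \<le> K * s ^ n" if "0 \<le> s" "s \<le> T" for s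
        using bd[of "- s"] that by simp
    qed (use 3 assms in auto)
    then show ?thesis using 3 by simp
  qed
qed

text \<open>The Lipschitz bound is global, so on each [-T, T] the increments of the iterates are at
  most M T (L' T)^n / n! and the series converges on the whole line without a continuation
  argument.\<close>

lemma picard_lindeloef:
  fixes f :: "real \<Rightarrow> 'a::banach \<Rightarrow> 'a"
  assumes cont: "continuous_on UNIV (\<lambda>(t, x). f t x)"
    and Lip: "\<And>t x y. norm (f t x - f t y) \<le> L * norm (x - y)"
  obtains y where "y 0 = x0" "\<And>t. (y has_vector_derivative f t (y t)) (at t)"
proof -
  define it where "it = rec_nat (\<lambda>_. x0) (\<lambda>n u t. x0 + primitive (\<lambda>s. f s (u s)) t)"
  have it0: "it 0 t = x0" and itS: "it (Suc n) t = x0 + primitive (\<lambda>s. f s (it n s)) t" for n t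
    by (auto simp: it_def)
  have fcont: "continuous_on UNIV (\<lambda>s. f s (u s))" if u: "continuous_on UNIV u" for u
  proof -
    have "continuous_on UNIV (\<lambda>s. (s, u s))"
      by (intro continuous_intros u)
    from continuous_on_compose2[OF cont this] show ?thesis by simp
  qed
  have it_cont: "continuous_on UNIV (it n)"
    and it_der: "(it (Suc n) has_vector_derivative f t (it n t)) (at t)" for n t
  proof -
    have step: "(it (Suc n) has_vector_derivative f t (it n t)) (at t)"
      if "continuous_on UNIV (it n)" for n t
    proof -
      have "((\<lambda>t. x0 + primitive (\<lambda>s. f s (it n s)) t) has_vector_derivative 0 + f t (it n t)) (at t)"
        by (intro has_vector_derivative_add primitive_has_vector_derivative fcont that) auto
      then show ?thesis by (simp add: itS[abs_def])
    qed
    show "continuous_on UNIV (it n)"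
    proof (induction n)
      case 0 then show ?case by (simp add: it0[abs_def])
    next
      case (Suc n)
      show ?case
        by (intro continuous_at_imp_continuous_on ballI has_vector_derivative_continuous[OF step[OF Suc]])
    qed
    then show "(it (Suc n) has_vector_derivative f t (it n t)) (at t)" by (rule step)
  qed
  have it_at0: "it n 0 = x0" for n by (cases n) (auto simp: it0 itS)
  define L' where "L' = max L 0"
  have L': "L' \<ge> 0" "norm (f t x - f t y) \<le> L' * norm (x - y)" for t x y
    using Lip[of t x y] mult_right_mono[of L L' "norm (x - y)"] by (auto simp: L'_def)
  have bound: "\<exists>M. \<forall>n t. \<bar>t\<bar> \<le> T \<longrightarrow> norm (it (Suc n) t - it n t) \<le> M * T * (L' * T) ^ n / fact n" if "T > 0" for T
  proof -
    have "compact ((\<lambda>s. f s x0) ` {-T..T})"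
      using fcont[of "\<lambda>_. x0"] by (intro compact_continuous_image) (auto intro: continuous_on_subset)
    then have "bounded ((\<lambda>s. f s x0) ` {-T..T})" by (rule compact_imp_bounded)
    then obtain M where "\<forall>x \<in> (\<lambda>s. f s x0) ` {-T..T}. norm x \<le> M"
      unfolding bounded_iff ..
    then have M: "\<And>s. s \<in> {-T..T} \<Longrightarrow> norm (f s x0) \<le> M" by blast
    have M0: "M \<ge> 0" using order_trans[OF norm_ge_zero M[of 0]] that by simp
    have "norm (it (Suc n) t - it n t) \<le> M * \<bar>t\<bar> * (L' * \<bar>t\<bar>) ^ n / fact n" if "\<bar>t\<bar> \<le> T" for n t
      using that
    proof (induction n arbitrary: t)
      case 0
      have "norm (it (Suc 0) t - x0) \<le> M * \<bar>t\<bar> ^ Suc 0 / real (Suc 0)"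
      proof (rule norm_le_of_derivative_le_power[where d' = "\<lambda>s. f s x0" and T = T])
        show "((\<lambda>t. it (Suc 0) t - x0) has_vector_derivative f s x0) (at s)" for s
          using has_vector_derivative_diff[OF it_der[of 0 s] has_vector_derivative_const[of x0]]
          by (simp add: it0)
      qed (use 0 M it_at0 in \<open>auto simp: abs_le_iff\<close>)
      then show ?case by (simp add: it0)
    next
      case (Suc n)
      define K where "K = M * L' ^ Suc n / fact n"
      have K0: "K \<ge> 0" using M0 L' by (simp add: K_def)
      have "norm (it (Suc (Suc n)) t - it (Suc n) t) \<le> K * \<bar>t\<bar> ^ Suc (Suc n) / real (Suc (Suc n))"
      proof (rule norm_le_of_derivative_le_power[where d' = "\<lambda>s. f s (it (Suc n) s) - f s (it n s)" and T = T])
        show "((\<lambda>t. it (Suc (Suc n)) t - it (Suc n) t) has_vector_derivative f s (it (Suc n) s) - f s (it n s)) (at s)" for s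
          by (intro has_vector_derivative_diff it_der)
        show "norm (f s (it (Suc n) s) - f s (it n s)) \<le> K * \<bar>s\<bar> ^ Suc n" if "\<bar>s\<bar> \<le> T" for s
        proof -
          have "norm (f s (it (Suc n) s) - f s (it n s)) \<le> L' * norm (it (Suc n) s - it n s)" by (rule L')
          also have "\<dots> \<le> L' * (M * \<bar>s\<bar> * (L' * \<bar>s\<bar>) ^ n / fact n)"
            using L' Suc.IH[OF that] by (intro mult_left_mono)
          also have "\<dots> = K * \<bar>s\<bar> ^ Suc n" by (simp add: K_def power_mult_distrib field_simps)
          finally show ?thesis .
        qed
      qed (use Suc it_at0 in auto)
      also have "\<dots> \<le> K * \<bar>t\<bar> ^ Suc (Suc n) / real (Suc n)"
        using K0 by (intro divide_left_mono) auto
      also have "\<dots> = M * \<bar>t\<bar> * (L' * \<bar>t\<bar>) ^ Suc n / fact (Suc n)"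
        by (simp add: K_def power_mult_distrib field_simps)
      finally show ?case .
    qed
    moreover have "M * \<bar>t\<bar> * (L' * \<bar>t\<bar>) ^ n / fact n \<le> M * T * (L' * T) ^ n / fact n" if "\<bar>t\<bar> \<le> T" for n t
      using that M0 L' by (intro divide_right_mono mult_mono power_mono) auto
    ultimately have "\<forall>n t. \<bar>t\<bar> \<le> T \<longrightarrow> norm (it (Suc n) t - it n t) \<le> M * T * (L' * T) ^ n / fact n"
      using order_trans by blast
    then show ?thesis ..
  qed
  define y where "y t = x0 + (\<Sum>n. it (Suc n) t - it n t)" for t
  have part: "it n t = x0 + (\<Sum>k<n. it (Suc k) t - it k t)" for n t
    by (induction n) (auto simp: it0)
  have ulim: "uniform_limit {-T..T} it y sequentially" if T: "T > 0" for T
  proof -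
    obtain M where M: "\<And>n t. \<bar>t\<bar> \<le> T \<Longrightarrow> norm (it (Suc n) t - it n t) \<le> M * T * (L' * T) ^ n / fact n"
      using bound[OF T] by blast
    have "uniform_limit {-T..T} (\<lambda>n t. \<Sum>k<n. it (Suc k) t - it k t) (\<lambda>t. \<Sum>n. it (Suc n) t - it n t) sequentially"
    proof (rule Weierstrass_m_test)
      show "norm (it (Suc n) t - it n t) \<le> M * T * ((L' * T) ^ n / fact n)" if "t \<in> {-T..T}" for n t
        using M[of t n] that by (auto simp: abs_le_iff)
      show "summable (\<lambda>n. M * T * ((L' * T) ^ n / fact n))"
        using summable_exp[of "L' * T"] by (intro summable_mult) (simp add: field_simps)
    qed
    moreover have "dist (it n t) (y t) = dist (\<Sum>k<n. it (Suc k) t - it k t) (\<Sum>n. it (Suc n) t - it n t)" for n t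
      by (subst part) (simp add: y_def dist_norm)
    ultimately show ?thesis
      unfolding uniform_limit_iff by simp
  qed
  have y0: "y 0 = x0" by (simp add: y_def it_at0)
  have "(y has_vector_derivative f t (y t)) (at t)" for t
  proof -
    define T where "T = \<bar>t\<bar> + 1"
    have T: "T > 0" "t \<in> {-T<..<T}" by (auto simp: T_def)
    have lim: "(\<lambda>n. it n x) \<longlonglongrightarrow> y x" if "x \<in> {-T<..<T}" for x
      using tendsto_uniform_limitI[OF ulim[OF T(1)], of x] that by auto
    have "\<exists>g. \<forall>x\<in>{-T<..<T}. (\<lambda>n. it (Suc n) x) \<longlonglongrightarrow> g x \<and> (g has_derivative (\<lambda>h. h *\<^sub>R f x (y x))) (at x within {-T<..<T})"
    proof (rule has_derivative_sequence)
      show "(it (Suc n) has_derivative (\<lambda>h. h *\<^sub>R f x (it n x))) (at x within {-T<..<T})" for n x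
        using it_der[of n x] unfolding has_vector_derivative_def by (rule has_derivative_at_withinI)
      show "\<forall>\<^sub>F n in sequentially. \<forall>x\<in>{-T<..<T}. \<forall>h. norm (h *\<^sub>R f x (it n x) - h *\<^sub>R f x (y x)) \<le> e * norm h" if "e > 0" for e
      proof -
        have "\<forall>\<^sub>F n in sequentially. \<forall>x\<in>{-T..T}. dist (it n x) (y x) < e / (L' + 1)"
          using ulim[OF T(1)] that L' unfolding uniform_limit_iff by (simp add: add_nonneg_pos)
        then show ?thesis
        proof eventually_elim
          case (elim n)
          show ?case
          proof (intro ballI allI)
            fix x h assume x: "x \<in> {-T<..<T}"
            have "norm (f x (it n x) - f x (y x)) \<le> L' * norm (it n x - y x)" by (rule L')
            also have "\<dots> \<le> (L' + 1) * (e / (L' + 1))"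
              using elim x L' that by (intro mult_mono) (auto simp: dist_norm less_imp_le)
            also have "\<dots> = e" using L' by simp
            finally show "norm (h *\<^sub>R f x (it n x) - h *\<^sub>R f x (y x)) \<le> e * norm h"
              by (simp add: scaleR_right_diff_distrib[symmetric] mult.commute[of e] mult_left_mono)
          qed
        qed
      qed
      show "(\<lambda>n. it (Suc n) 0) \<longlonglongrightarrow> x0" by (simp add: it_at0)
    qed (use T in auto)
    then obtain g where g: "\<And>x. x \<in> {-T<..<T} \<Longrightarrow> (\<lambda>n. it (Suc n) x) \<longlonglongrightarrow> g x"
      "\<And>x. x \<in> {-T<..<T} \<Longrightarrow> (g has_derivative (\<lambda>h. h *\<^sub>R f x (y x))) (at x within {-T<..<T})"
      by blast
    have gy: "g x = y x" if "x \<in> {-T<..<T}" for x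
      using LIMSEQ_unique[OF g(1)[OF that] LIMSEQ_Suc[OF lim[OF that]]] .
    have "(g has_vector_derivative f t (y t)) (at t)"
      using g(2)[OF T(2)] T(2) by (simp add: has_vector_derivative_def at_within_open[OF T(2)])
    then show ?thesis
      by (rule has_vector_derivative_transform_within_open[where S = "{-T<..<T}"]) (use gy T(2) in auto)
  qed
  with y0 that show ?thesis by blast
qed

text \<open>The square of the norm stays differentiable at zeros of \<open>y\<close>. Absorbing
  \<open>2 * norm (y t) * \<eta>\<close> into two squares is the source of the \<open>+ 1\<close> in
  the exponent.\<close>

lemma gronwall_sq:
  fixes y :: "real \<Rightarrow> 'a::real_inner"
  assumes "a \<le> b"
    and der: "\<And>t. t \<in> {a..b} \<Longrightarrow> (y has_vector_derivative y' t) (at t within {a..b})"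
    and bd: "\<And>t. t \<in> {a..b} \<Longrightarrow> norm (y' t) \<le> L * norm (y t) + \<eta>"
    and "\<eta> \<ge> 0"
  shows "(norm (y b))\<^sup>2 \<le> ((norm (y a))\<^sup>2 + \<eta>\<^sup>2 * (b - a)) * exp ((2 * \<bar>L\<bar> + 1) * (b - a))"
proof -
  define C where "C = 2 * \<bar>L\<bar> + 1"
  have C: "C \<ge> 0" by (simp add: C_def)
  define g where "g t = exp (- C * (t - a)) * (y t \<bullet> y t) - \<eta>\<^sup>2 * (t - a)" for t
  have "g b \<le> g a"
  proof (rule DERIV_nonpos_imp_decreasing_open[of a b g] , goal_cases)
    case 1 show ?case by fact
  next
    case (2 t)
    have dery: "(y has_vector_derivative y' t) (at t)"
      using der[of t] 2 by (simp add: at_within_Icc_at)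
    have deri: "((\<lambda>t. y t \<bullet> y t) has_real_derivative 2 * (y t \<bullet> y' t)) (at t)"
      using has_derivative_inner[of y "\<lambda>h. h *\<^sub>R y' t" t UNIV y "\<lambda>h. h *\<^sub>R y' t"] dery
      by (simp add: has_vector_derivative_def has_field_derivative_def inner_commute mult_commute_abs algebra_simps)
    have "y t \<bullet> y' t \<le> norm (y t) * norm (y' t)" by (rule norm_cauchy_schwarz)
    also have "\<dots> \<le> norm (y t) * (\<bar>L\<bar> * norm (y t) + \<eta>)"
    proof (rule mult_left_mono)
      have "norm (y' t) \<le> L * norm (y t) + \<eta>" using bd[of t] 2 by auto
      also have "\<dots> \<le> \<bar>L\<bar> * norm (y t) + \<eta>" by (simp add: mult_right_mono)
      finally show "norm (y' t) \<le> \<bar>L\<bar> * norm (y t) + \<eta>" .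
    qed simp
    finally have "2 * (y t \<bullet> y' t) \<le> 2 * \<bar>L\<bar> * (norm (y t))\<^sup>2 + 2 * norm (y t) * \<eta>"
      by (simp add: power2_eq_square algebra_simps)
    also have "2 * norm (y t) * \<eta> \<le> (norm (y t))\<^sup>2 + \<eta>\<^sup>2" by (rule sum_squares_bound)
    finally have le: "2 * (y t \<bullet> y' t) - C * (y t \<bullet> y t) \<le> \<eta>\<^sup>2"
      by (simp add: C_def power2_norm_eq_inner algebra_simps)
    have "(g has_real_derivative exp (- C * (t - a)) * (2 * (y t \<bullet> y' t)) + (- C * exp (- C * (t - a))) * (y t \<bullet> y t) - \<eta>\<^sup>2) (at t)"
      unfolding g_def by (rule derivative_eq_intros deri refl | simp)+
    moreover have "exp (- C * (t - a)) * (2 * (y t \<bullet> y' t)) + (- C * exp (- C * (t - a))) * (y t \<bullet> y t) - \<eta>\<^sup>2 \<le> 0"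
    proof -
      have "exp (- C * (t - a)) * (2 * (y t \<bullet> y' t) - C * (y t \<bullet> y t)) \<le> exp (- C * (t - a)) * \<eta>\<^sup>2"
        using le by (intro mult_left_mono) auto
      also have "\<dots> \<le> 1 * \<eta>\<^sup>2" using C 2 by (intro mult_right_mono) auto
      finally show ?thesis by (simp add: algebra_simps)
    qed
    ultimately show ?case by blast
  next
    case 3
    have "continuous_on {a..b} y"
      unfolding continuous_on_eq_continuous_within using der has_vector_derivative_continuous by blast
    then show ?case unfolding g_def by (intro continuous_intros)
  qed
  then have "exp (- C * (b - a)) * (norm (y b))\<^sup>2 \<le> (norm (y a))\<^sup>2 + \<eta>\<^sup>2 * (b - a)"
    by (simp add: g_def power2_norm_eq_inner)
  then have "exp (C * (b - a)) * (exp (- C * (b - a)) * (norm (y b))\<^sup>2) \<le> exp (C * (b - a)) * ((norm (y a))\<^sup>2 + \<eta>\<^sup>2 * (b - a))"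
    by (rule mult_left_mono) simp
  moreover have "exp (C * (b - a)) * (exp (- C * (b - a)) * (norm (y b))\<^sup>2) = (norm (y b))\<^sup>2"
    unfolding mult.assoc[symmetric] exp_add[symmetric] by simp
  ultimately have "(norm (y b))\<^sup>2 \<le> exp (C * (b - a)) * ((norm (y a))\<^sup>2 + \<eta>\<^sup>2 * (b - a))"
    by linarith
  then show ?thesis
    unfolding C_def by (simp only: mult.commute)
qed


section \<open>Planar linear systems with complex coefficients\<close>

text \<open>One shape for every linear equation below: (L) on rays and arcs, its reduced form, and
  the linearised Josephson equation. Derivatives are taken within \<open>I\<close>, one-sided at end
  points, so solutions restrict to subintervals and may live on half a period.\<close>

definition lin2_sol ::
  "(real \<Rightarrow> complex) \<Rightarrow> (real \<Rightarrow> complex) \<Rightarrow> (real \<Rightarrow> complex) \<Rightarrow> (real \<Rightarrow> complex) \<Rightarrow>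
   (real \<Rightarrow> complex) \<Rightarrow> (real \<Rightarrow> complex) \<Rightarrow> real set \<Rightarrow> (real \<Rightarrow> complex) \<Rightarrow> (real \<Rightarrow> complex) \<Rightarrow> bool" where
  "lin2_sol a b c d g h I u v \<longleftrightarrow>
     (\<forall>t\<in>I. (u has_vector_derivative a t * u t + b t * v t + g t) (at t within I) \<and>
             (v has_vector_derivative c t * u t + d t * v t + h t) (at t within I))"

lemma lin2_sol_subset: "lin2_sol a b c d g h I u v \<Longrightarrow> J \<subseteq> I \<Longrightarrow> lin2_sol a b c d g h J u v"
  unfolding lin2_sol_def using has_vector_derivative_within_subset by blast

lemma lin2_sol_continuous:
  assumes "lin2_sol a b c d g h I u v"
  shows "continuous_on I u" "continuous_on I v"
  using assms has_vector_derivative_continuous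
  unfolding lin2_sol_def continuous_on_eq_continuous_within by blast+

lemma bounded_on_interval:
  fixes f :: "real \<Rightarrow> complex"
  assumes "continuous_on {p..q} f"
  obtains K where "K \<ge> 0" "\<And>t. t \<in> {p..q} \<Longrightarrow> cmod (f t) \<le> K"
proof -
  have "bounded (f ` {p..q})"
    by (intro compact_imp_bounded compact_continuous_image assms) simp
  then obtain K where "\<forall>x \<in> f ` {p..q}. norm x \<le> K" unfolding bounded_iff ..
  then have "\<And>t. t \<in> {p..q} \<Longrightarrow> cmod (f t) \<le> \<bar>K\<bar>"
    by (meson abs_ge_self image_eqI order_trans)
  then show ?thesis using that[of "\<bar>K\<bar>"] by simp
qed

lemma lin2_norm_bound:
  fixes A B C D u v :: complex
  assumes "cmod A \<le> K" "cmod B \<le> K" "cmod C \<le> K" "cmod D \<le> K"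
  shows "norm (A * u + B * v, C * u + D * v) \<le> 4 * K * norm (u, v)"
proof -
  have K: "K \<ge> 0" using assms(1) norm_ge_zero order_trans by blast
  have uv: "cmod u \<le> norm (u, v)" "cmod v \<le> norm (u, v)"
    using norm_fst_le[of u v] norm_snd_le[of v u] by auto
  have 1: "cmod (x * w) \<le> K * norm (u, v)" if "cmod x \<le> K" "cmod w \<le> norm (u, v)" for x w
    using that K by (auto simp: norm_mult intro!: mult_mono)
  have "norm (A * u + B * v, C * u + D * v) \<le> cmod (A * u + B * v) + cmod (C * u + D * v)"
    by (rule norm_Pair_le)
  also have "\<dots> \<le> (cmod (A * u) + cmod (B * v)) + (cmod (C * u) + cmod (D * v))"
    by (intro add_mono norm_triangle_ineq)
  also have "\<dots> \<le> (K * norm (u, v) + K * norm (u, v)) + (K * norm (u, v) + K * norm (u, v))"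
    by (intro add_mono 1 assms uv)
  finally show ?thesis by simp
qed

lemma lin2_sol_exists:
  assumes "p \<le> q"
    and cont: "continuous_on {p..q} a" "continuous_on {p..q} b" "continuous_on {p..q} c"
      "continuous_on {p..q} d" "continuous_on {p..q} g" "continuous_on {p..q} h"
  obtains u v where "u p = u0" "v p = v0" "lin2_sol a b c d g h {p..q} u v"
proof -
  \<comment> \<open>Clamping the shifted time to [p, q] makes the coefficients globally continuous
    and bounded, so the global existence theorem applies with starting time 0.\<close>
  define s where "s t = max p (min q (t + p))" for t
  have s: "s t \<in> {p..q}" for t using \<open>p \<le> q\<close> by (auto simp: s_def)
  have s_cont: "continuous_on A s" for A unfolding s_def by (intro continuous_intros)
  have cs: "continuous_on UNIV (\<lambda>(t, x::complex \<times> complex). f (s t))" if "continuous_on {p..q} f" for f :: "real \<Rightarrow> complex"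
    unfolding case_prod_unfold
    by (rule continuous_on_compose2[OF that]) (use s s_cont in \<open>auto intro!: continuous_intros continuous_on_compose2[OF s_cont]\<close>)
  obtain Ka Kb Kc Kd where Ks: "\<And>t. t \<in> {p..q} \<Longrightarrow> cmod (a t) \<le> Ka" "\<And>t. t \<in> {p..q} \<Longrightarrow> cmod (b t) \<le> Kb"
    "\<And>t. t \<in> {p..q} \<Longrightarrow> cmod (c t) \<le> Kc" "\<And>t. t \<in> {p..q} \<Longrightarrow> cmod (d t) \<le> Kd"
    using bounded_on_interval cont by metis
  define K where "K = max (max Ka Kb) (max Kc Kd)"
  define f where "f t x = (a (s t) * fst x + b (s t) * snd x + g (s t), c (s t) * fst x + d (s t) * snd x + h (s t))" for t x
  have f_cont: "continuous_on UNIV (\<lambda>(t, x). f t x)"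
    using cs[OF cont(1)] cs[OF cont(2)] cs[OF cont(3)] cs[OF cont(4)] cs[OF cont(5)] cs[OF cont(6)]
    unfolding f_def case_prod_unfold by (intro continuous_intros)
  have f_lip: "norm (f t x - f t y) \<le> 4 * K * norm (x - y)" for t x y
  proof -
    have "f t x - f t y = (a (s t) * fst (x - y) + b (s t) * snd (x - y), c (s t) * fst (x - y) + d (s t) * snd (x - y))"
      by (auto simp: f_def algebra_simps)
    also have "norm \<dots> \<le> 4 * K * norm (fst (x - y), snd (x - y))"
      by (intro lin2_norm_bound) (use Ks s in \<open>auto simp: K_def le_max_iff_disj\<close>)
    finally show ?thesis by (simp only: prod.collapse)
  qed
  obtain y where y: "y 0 = (u0, v0)" "\<And>t. (y has_vector_derivative f t (y t)) (at t)"
    using picard_lindeloef[OF f_cont f_lip, where ?x0.0 = "(u0, v0)"] by metis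
  define u where "u t = fst (y (t - p))" for t
  define v where "v t = snd (y (t - p))" for t
  have "lin2_sol a b c d g h {p..q} u v"
    unfolding lin2_sol_def
  proof (intro ballI conjI)
    fix t assume t: "t \<in> {p..q}"
    then have st: "s (t - p) = t" by (auto simp: s_def)
    have "((\<lambda>t. y (t - p)) has_vector_derivative f (t - p) (y (t - p))) (at t)"
    proof -
      have "((\<lambda>t. t - p) has_vector_derivative 1) (at t)"
        by (rule derivative_eq_intros refl | simp)+
      from vector_diff_chain_at[OF this y(2)] show ?thesis by (simp add: o_def)
    qed
    then have D: "((\<lambda>t. y (t - p)) has_vector_derivative f (t - p) (y (t - p))) (at t within {p..q})"
      by (rule has_vector_derivative_at_within)
    show "(u has_vector_derivative a t * u t + b t * v t + g t) (at t within {p..q})"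
      using bounded_linear.has_vector_derivative[OF bounded_linear_fst D]
      by (simp add: u_def[abs_def] v_def f_def st)
    show "(v has_vector_derivative c t * u t + d t * v t + h t) (at t within {p..q})"
      using bounded_linear.has_vector_derivative[OF bounded_linear_snd D]
      by (simp add: u_def v_def[abs_def] f_def st)
  qed
  moreover have "u p = u0" "v p = v0" by (auto simp: u_def v_def y)
  ultimately show ?thesis using that by blast
qed

lemma lin2_sol_gronwall:
  assumes sol: "lin2_sol a b c d g h {p..q} u v" and "p \<le> q"
    and K: "\<And>t. t \<in> {p..q} \<Longrightarrow> cmod (a t) \<le> K" "\<And>t. t \<in> {p..q} \<Longrightarrow> cmod (b t) \<le> K"
      "\<And>t. t \<in> {p..q} \<Longrightarrow> cmod (c t) \<le> K" "\<And>t. t \<in> {p..q} \<Longrightarrow> cmod (d t) \<le> K"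
    and \<eta>: "\<And>t. t \<in> {p..q} \<Longrightarrow> cmod (g t) \<le> \<eta>" "\<And>t. t \<in> {p..q} \<Longrightarrow> cmod (h t) \<le> \<eta>"
  shows "(cmod (u q))\<^sup>2 + (cmod (v q))\<^sup>2
         \<le> ((cmod (u p))\<^sup>2 + (cmod (v p))\<^sup>2 + 4 * \<eta>\<^sup>2 * (q - p)) * exp ((8 * K + 1) * (q - p))"
proof -
  have "p \<in> {p..q}" using \<open>p \<le> q\<close> by simp
  then have K0: "K \<ge> 0" and \<eta>0: "\<eta> \<ge> 0"
    using K(1) \<eta>(1) norm_ge_zero order_trans by blast+
  have "(norm (u q, v q))\<^sup>2 \<le> ((norm (u p, v p))\<^sup>2 + (2 * \<eta>)\<^sup>2 * (q - p)) * exp ((2 * \<bar>4 * K\<bar> + 1) * (q - p))"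
  proof (rule gronwall_sq[where y = "\<lambda>t. (u t, v t)" and
        y' = "\<lambda>t. (a t * u t + b t * v t + g t, c t * u t + d t * v t + h t)"])
    show "((\<lambda>t. (u t, v t)) has_vector_derivative (a t * u t + b t * v t + g t, c t * u t + d t * v t + h t)) (at t within {p..q})"
      if "t \<in> {p..q}" for t
      using sol that unfolding lin2_sol_def by (intro has_vector_derivative_Pair) auto
    show "norm (a t * u t + b t * v t + g t, c t * u t + d t * v t + h t) \<le> 4 * K * norm (u t, v t) + 2 * \<eta>"
      if "t \<in> {p..q}" for t
    proof -
      have "norm ((a t * u t + b t * v t, c t * u t + d t * v t) + (g t, h t))
          \<le> norm (a t * u t + b t * v t, c t * u t + d t * v t) + norm (g t, h t)"
        by (rule norm_triangle_ineq)
      also have "\<dots> \<le> 4 * K * norm (u t, v t) + (\<eta> + \<eta>)"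
        using K \<eta> that by (intro add_mono lin2_norm_bound order_trans[OF norm_Pair_le]) auto
      finally show ?thesis by simp
    qed
  qed (use \<open>p \<le> q\<close> \<eta>0 in auto)
  then show ?thesis using K0 by (simp add: norm_Pair power_mult_distrib)
qed

lemma lin2_sol_diff:
  assumes "lin2_sol a b c d g h I u v" "lin2_sol a b c d g' h' I u' v'"
  shows "lin2_sol a b c d (\<lambda>t. g t - g' t) (\<lambda>t. h t - h' t) I (\<lambda>t. u t - u' t) (\<lambda>t. v t - v' t)"
  unfolding lin2_sol_def
proof (intro ballI conjI)
  fix t assume t: "t \<in> I"
  have "((\<lambda>t. u t - u' t) has_vector_derivative (a t * u t + b t * v t + g t) - (a t * u' t + b t * v' t + g' t)) (at t within I)"
    using assms t unfolding lin2_sol_def by (intro has_vector_derivative_diff) auto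
  then show "((\<lambda>t. u t - u' t) has_vector_derivative a t * (u t - u' t) + b t * (v t - v' t) + (g t - g' t)) (at t within I)"
    by (rule back_subst) (simp add: algebra_simps)
  have "((\<lambda>t. v t - v' t) has_vector_derivative (c t * u t + d t * v t + h t) - (c t * u' t + d t * v' t + h' t)) (at t within I)"
    using assms t unfolding lin2_sol_def by (intro has_vector_derivative_diff) auto
  then show "((\<lambda>t. v t - v' t) has_vector_derivative c t * (u t - u' t) + d t * (v t - v' t) + (h t - h' t)) (at t within I)"
    by (rule back_subst) (simp add: algebra_simps)
qed

lemma lin2_sol_combine:
  assumes "lin2_sol a b c d (\<lambda>_. 0) (\<lambda>_. 0) I u v" "lin2_sol a b c d (\<lambda>_. 0) (\<lambda>_. 0) I u' v'"
  shows "lin2_sol a b c d (\<lambda>_. 0) (\<lambda>_. 0) I (\<lambda>t. x * u t + y * u' t) (\<lambda>t. x * v t + y * v' t)"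
  unfolding lin2_sol_def
proof (intro ballI conjI)
  fix t assume t: "t \<in> I"
  have "((\<lambda>t. x * u t + y * u' t) has_vector_derivative x * (a t * u t + b t * v t + 0) + y * (a t * u' t + b t * v' t + 0)) (at t within I)"
    using assms t unfolding lin2_sol_def by (intro has_vector_derivative_add has_vector_derivative_mult_right) auto
  then show "((\<lambda>t. x * u t + y * u' t) has_vector_derivative a t * (x * u t + y * u' t) + b t * (x * v t + y * v' t) + 0) (at t within I)"
    by (rule back_subst) (simp add: algebra_simps)
  have "((\<lambda>t. x * v t + y * v' t) has_vector_derivative x * (c t * u t + d t * v t + 0) + y * (c t * u' t + d t * v' t + 0)) (at t within I)"
    using assms t unfolding lin2_sol_def by (intro has_vector_derivative_add has_vector_derivative_mult_right) auto
  then show "((\<lambda>t. x * v t + y * v' t) has_vector_derivative c t * (x * u t + y * u' t) + d t * (x * v t + y * v' t) + 0) (at t within I)"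
    by (rule back_subst) (simp add: algebra_simps)
qed

lemma lin2_sol_zero:
  assumes sol: "lin2_sol a b c d (\<lambda>_. 0) (\<lambda>_. 0) {p..q} u v"
    and cont: "continuous_on {p..q} a" "continuous_on {p..q} b" "continuous_on {p..q} c" "continuous_on {p..q} d"
    and "u p = 0" "v p = 0" "t \<in> {p..q}"
  shows "u t = 0" "v t = 0"
proof -
  obtain Ka Kb Kc Kd where Ks: "\<And>t. t \<in> {p..q} \<Longrightarrow> cmod (a t) \<le> Ka" "\<And>t. t \<in> {p..q} \<Longrightarrow> cmod (b t) \<le> Kb"
    "\<And>t. t \<in> {p..q} \<Longrightarrow> cmod (c t) \<le> Kc" "\<And>t. t \<in> {p..q} \<Longrightarrow> cmod (d t) \<le> Kd"
    using bounded_on_interval cont by metis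
  define K where "K = max (max Ka Kb) (max Kc Kd)"
  have "lin2_sol a b c d (\<lambda>_. 0) (\<lambda>_. 0) {p..t} u v"
    using lin2_sol_subset[OF sol] assms by auto
  then have "(cmod (u t))\<^sup>2 + (cmod (v t))\<^sup>2
         \<le> ((cmod (u p))\<^sup>2 + (cmod (v p))\<^sup>2 + 4 * 0\<^sup>2 * (t - p)) * exp ((8 * K + 1) * (t - p))"
    by (rule lin2_sol_gronwall) (use assms Ks in \<open>auto simp: K_def le_max_iff_disj\<close>)
  then have "(cmod (u t))\<^sup>2 + (cmod (v t))\<^sup>2 \<le> 0" using assms by simp
  then show "u t = 0" "v t = 0"
    using zero_le_power2[of "cmod (u t)"] zero_le_power2[of "cmod (v t)"]
    by (smt (verit) norm_eq_zero power_eq_0_iff)+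
qed

lemma lin2_sol_unique:
  assumes "lin2_sol a b c d g h {p..q} u v" "lin2_sol a b c d g h {p..q} u' v'"
    and "continuous_on {p..q} a" "continuous_on {p..q} b" "continuous_on {p..q} c" "continuous_on {p..q} d"
    and "u p = u' p" "v p = v' p" "t \<in> {p..q}"
  shows "u t = u' t" "v t = v' t"
proof -
  have "lin2_sol a b c d (\<lambda>_. 0) (\<lambda>_. 0) {p..q} (\<lambda>t. u t - u' t) (\<lambda>t. v t - v' t)"
    using lin2_sol_diff[OF assms(1,2)] by simp
  from lin2_sol_zero[OF this assms(3-6)] show "u t = u' t" "v t = v' t"
    using assms(7-9) by auto
qed

text \<open>The difference quotient of the solution satisfies the variational equation up to an
  inhomogeneity of the size of the increment.\<close>

lemma lin2_sol_holomorphic: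
  assumes pq: "p \<le> q"
    and cont: "continuous_on {p..q} a" "continuous_on {p..q} a'" "continuous_on {p..q} b"
      "continuous_on {p..q} c" "continuous_on {p..q} d" "continuous_on {p..q} d'"
  obtains U V where "U holomorphic_on UNIV" "V holomorphic_on UNIV"
    "\<And>\<mu>::complex. \<exists>u v. lin2_sol (\<lambda>t. a t + \<mu> * a' t) b c (\<lambda>t. d t + \<mu> * d' t) (\<lambda>_. 0) (\<lambda>_. 0) {p..q} u v \<and>
            u p = u0 \<and> v p = v0 \<and> u q = U \<mu> \<and> v q = V \<mu>"
proof -
  have "\<exists>u v. lin2_sol (\<lambda>t. a t + \<mu> * a' t) b c (\<lambda>t. d t + \<mu> * d' t) (\<lambda>_. 0) (\<lambda>_. 0) {p..q} u v \<and> u p = u0 \<and> v p = v0" for \<mu>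
    by (rule lin2_sol_exists[OF pq, of "\<lambda>t. a t + \<mu> * a' t" b c "\<lambda>t. d t + \<mu> * d' t" "\<lambda>_. 0" "\<lambda>_. 0" u0 v0])
      (auto intro!: continuous_intros cont)
  then obtain u v where uv: "\<And>\<mu>. lin2_sol (\<lambda>t. a t + \<mu> * a' t) b c (\<lambda>t. d t + \<mu> * d' t) (\<lambda>_. 0) (\<lambda>_. 0) {p..q} (u \<mu>) (v \<mu>)"
    "\<And>\<mu>. u \<mu> p = u0" "\<And>\<mu>. v \<mu> p = v0"
    by metis
  obtain Ka Kb Kc Kd where Ks: "\<And>t. t \<in> {p..q} \<Longrightarrow> cmod (a t) \<le> Ka"
    "\<And>t. t \<in> {p..q} \<Longrightarrow> cmod (b t) \<le> Kb"
    "\<And>t. t \<in> {p..q} \<Longrightarrow> cmod (c t) \<le> Kc" "\<And>t. t \<in> {p..q} \<Longrightarrow> cmod (d t) \<le> Kd"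
    using bounded_on_interval cont by metis
  obtain Ka' Kd' where Ks': "\<And>t. t \<in> {p..q} \<Longrightarrow> cmod (a' t) \<le> Ka'" "\<And>t. t \<in> {p..q} \<Longrightarrow> cmod (d' t) \<le> Kd'"
    using bounded_on_interval cont by metis
  define K where "K = max (max (max Ka Kb) (max Kc Kd)) (max (max Ka' Kd') 0)"
  have K0: "K \<ge> 0" by (simp add: K_def)
  have K: "cmod (a t) \<le> K" "cmod (a' t) \<le> K" "cmod (b t) \<le> K" "cmod (c t) \<le> K" "cmod (d t) \<le> K" "cmod (d' t) \<le> K"
    if "t \<in> {p..q}" for t
    using Ks[OF that] Ks'[OF that] by (auto simp: K_def le_max_iff_disj)
  have der: "\<exists>Z Z'. ((\<lambda>\<mu>. u \<mu> q) has_field_derivative Z) (at \<mu>) \<and> ((\<lambda>\<mu>. v \<mu> q) has_field_derivative Z') (at \<mu>)" for \<mu>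
  proof -
    have contuv: "continuous_on {p..q} (u \<mu>)" "continuous_on {p..q} (v \<mu>)"
      using lin2_sol_continuous[OF uv(1)] by auto
    obtain M1 M2 where M12: "\<And>t. t \<in> {p..q} \<Longrightarrow> cmod (u \<mu> t) \<le> M1" "\<And>t. t \<in> {p..q} \<Longrightarrow> cmod (v \<mu> t) \<le> M2"
      using bounded_on_interval contuv by metis
    define M where "M = max (max M1 M2) 0"
    have M: "cmod (u \<mu> t) \<le> M" "cmod (v \<mu> t) \<le> M" if "t \<in> {p..q}" for t
      using M12[OF that] by (auto simp: M_def)
    have M0: "M \<ge> 0" by (simp add: M_def)
    \<comment> \<open>The expected derivatives in \<open>\<mu>\<close>: solutions of the variational
      equation with zero initial data. Below, \<open>w\<close> bounds the increment of the solution
      by \<open>C * cmod h\<close>, and \<open>e\<close> the error of the difference quotient by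
      \<open>C' * cmod h\<close>.\<close>
    obtain z z' where z: "z p = 0" "z' p = 0"
      "lin2_sol (\<lambda>t. a t + \<mu> * a' t) b c (\<lambda>t. d t + \<mu> * d' t) (\<lambda>t. a' t * u \<mu> t) (\<lambda>t. d' t * v \<mu> t) {p..q} z z'"
      by (rule lin2_sol_exists[OF pq, of "\<lambda>t. a t + \<mu> * a' t" b c "\<lambda>t. d t + \<mu> * d' t" "\<lambda>t. a' t * u \<mu> t" "\<lambda>t. d' t * v \<mu> t" 0 0])
        (auto intro!: continuous_intros cont contuv)
    define K2 where "K2 = K + (cmod \<mu> + 1) * K"
    have K2: "K \<le> K2" using K0 by (simp add: K2_def)
    have coef: "cmod (x + \<nu> * y) \<le> K2" if "cmod x \<le> K" "cmod y \<le> K" "cmod \<nu> \<le> cmod \<mu> + 1" for x y \<nu>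
    proof -
      have "cmod (x + \<nu> * y) \<le> cmod x + cmod \<nu> * cmod y" by (metis norm_mult norm_triangle_ineq)
      also have "\<dots> \<le> K2" unfolding K2_def using that K0 by (intro add_mono mult_mono) auto
      finally show ?thesis .
    qed
    define E where "E = exp ((8 * K2 + 1) * (q - p))"
    define C where "C = sqrt (4 * (K * M)\<^sup>2 * (q - p) * E)"
    define C' where "C' = sqrt (4 * (K * C)\<^sup>2 * (q - p) * E)"
    have E0: "E > 0" by (simp add: E_def)
    have C0: "C \<ge> 0" using pq E0 by (simp add: C_def)
    have C20: "C' \<ge> 0" using pq E0 by (simp add: C'_def)
    have root: "cmod x \<le> c * k \<and> cmod y \<le> c * k"
      if "(cmod x)\<^sup>2 + (cmod y)\<^sup>2 \<le> k\<^sup>2 * c\<^sup>2" "k \<ge> 0" "c \<ge> 0" for x y k c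
    proof -
      have "(cmod x)\<^sup>2 \<le> (c * k)\<^sup>2" "(cmod y)\<^sup>2 \<le> (c * k)\<^sup>2"
        using that(1) zero_le_power2[of "cmod x"] zero_le_power2[of "cmod y"]
        unfolding power_mult_distrib[of c k] mult.commute[of "c\<^sup>2"] by linarith+
      then show ?thesis using that by (auto intro: power2_le_imp_le)
    qed
    have C2: "C\<^sup>2 = 4 * (K * M)\<^sup>2 * (q - p) * E" "C'\<^sup>2 = 4 * (K * C)\<^sup>2 * (q - p) * E"
      using pq E0 by (auto simp: C_def C'_def)
    have mono: "exp ((8 * K2 + 1) * (t - p)) \<le> E" if "t \<in> {p..q}" for t
      using that K2 K0 unfolding E_def by (auto intro!: mult_left_mono)
    have w: "cmod (u (\<mu> + h) t - u \<mu> t) \<le> C * cmod h \<and> cmod (v (\<mu> + h) t - v \<mu> t) \<le> C * cmod h"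
      if h: "cmod h \<le> 1" and t: "t \<in> {p..q}" for h t
    proof -
      have mu: "cmod (\<mu> + h) \<le> cmod \<mu> + 1" using norm_triangle_ineq[of \<mu> h] h by simp
      have "lin2_sol (\<lambda>t. a t + (\<mu> + h) * a' t) b c (\<lambda>t. d t + (\<mu> + h) * d' t) (\<lambda>t. - (h * a' t * u \<mu> t)) (\<lambda>t. - (h * d' t * v \<mu> t)) {p..q} (u \<mu>) (v \<mu>)"
        using uv(1)[of \<mu>] unfolding lin2_sol_def by (simp add: algebra_simps)
      from lin2_sol_diff[OF uv(1)[of "\<mu> + h"] this]
      have "lin2_sol (\<lambda>t. a t + (\<mu> + h) * a' t) b c (\<lambda>t. d t + (\<mu> + h) * d' t) (\<lambda>t. h * a' t * u \<mu> t) (\<lambda>t. h * d' t * v \<mu> t) {p..q}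
         (\<lambda>t. u (\<mu> + h) t - u \<mu> t) (\<lambda>t. v (\<mu> + h) t - v \<mu> t)" by simp
      then have "lin2_sol (\<lambda>t. a t + (\<mu> + h) * a' t) b c (\<lambda>t. d t + (\<mu> + h) * d' t) (\<lambda>t. h * a' t * u \<mu> t) (\<lambda>t. h * d' t * v \<mu> t) {p..t}
         (\<lambda>t. u (\<mu> + h) t - u \<mu> t) (\<lambda>t. v (\<mu> + h) t - v \<mu> t)"
        by (rule lin2_sol_subset) (use t in auto)
      then have "(cmod (u (\<mu> + h) t - u \<mu> t))\<^sup>2 + (cmod (v (\<mu> + h) t - v \<mu> t))\<^sup>2
        \<le> ((cmod (u (\<mu> + h) p - u \<mu> p))\<^sup>2 + (cmod (v (\<mu> + h) p - v \<mu> p))\<^sup>2 + 4 * (cmod h * K * M)\<^sup>2 * (t - p)) * exp ((8 * K2 + 1) * (t - p))"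
      proof (rule lin2_sol_gronwall)
        show "p \<le> t" using t by simp
        fix r assume "r \<in> {p..t}"
        then have r: "r \<in> {p..q}" using t by auto
        show "cmod (a r + (\<mu> + h) * a' r) \<le> K2" "cmod (d r + (\<mu> + h) * d' r) \<le> K2"
          using K[OF r] mu by (auto intro!: coef)
        show "cmod (b r) \<le> K2" "cmod (c r) \<le> K2" using K[OF r] K2 by auto
        show "cmod (h * a' r * u \<mu> r) \<le> cmod h * K * M" "cmod (h * d' r * v \<mu> r) \<le> cmod h * K * M"
          using K[OF r] M[OF r] K0 M0 by (auto simp: norm_mult intro!: mult_mono)
      qed
      also have "\<dots> = 4 * (cmod h * K * M)\<^sup>2 * (t - p) * exp ((8 * K2 + 1) * (t - p))" by (simp add: uv)
      also have "\<dots> \<le> 4 * (cmod h * K * M)\<^sup>2 * (q - p) * E"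
        using t mono[OF t] pq by (intro mult_mono) auto
      also have "\<dots> = (cmod h)\<^sup>2 * C\<^sup>2" by (simp add: C2 power_mult_distrib)
      finally show ?thesis by (intro root) (use C0 in auto)
    qed
    have e: "cmod ((u (\<mu> + h) q - u \<mu> q) / h - z q) \<le> C' * cmod h \<and> cmod ((v (\<mu> + h) q - v \<mu> q) / h - z' q) \<le> C' * cmod h"
      if h: "cmod h \<le> 1" "h \<noteq> 0" for h
    proof -
      have "lin2_sol (\<lambda>t. a t + \<mu> * a' t) b c (\<lambda>t. d t + \<mu> * d' t) (\<lambda>t. h * a' t * u (\<mu> + h) t) (\<lambda>t. h * d' t * v (\<mu> + h) t) {p..q} (u (\<mu> + h)) (v (\<mu> + h))"
        using uv(1)[of "\<mu> + h"] unfolding lin2_sol_def by (simp add: algebra_simps)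
      from lin2_sol_diff[OF this uv(1)[of \<mu>]]
      have 1: "lin2_sol (\<lambda>t. a t + \<mu> * a' t) b c (\<lambda>t. d t + \<mu> * d' t) (\<lambda>t. h * a' t * u (\<mu> + h) t) (\<lambda>t. h * d' t * v (\<mu> + h) t) {p..q}
         (\<lambda>t. u (\<mu> + h) t - u \<mu> t) (\<lambda>t. v (\<mu> + h) t - v \<mu> t)" by simp
      have "lin2_sol (\<lambda>t. a t + \<mu> * a' t) b c (\<lambda>t. d t + \<mu> * d' t) (\<lambda>t. a' t * u (\<mu> + h) t) (\<lambda>t. d' t * v (\<mu> + h) t) {p..q}
         (\<lambda>t. (u (\<mu> + h) t - u \<mu> t) / h) (\<lambda>t. (v (\<mu> + h) t - v \<mu> t) / h)"
        unfolding lin2_sol_def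
      proof (intro ballI conjI)
        fix t assume t: "t \<in> {p..q}"
        note D = 1[unfolded lin2_sol_def, rule_format, OF t]
        show "((\<lambda>t. (u (\<mu> + h) t - u \<mu> t) / h) has_vector_derivative
           (a t + \<mu> * a' t) * ((u (\<mu> + h) t - u \<mu> t) / h) + b t * ((v (\<mu> + h) t - v \<mu> t) / h) + a' t * u (\<mu> + h) t) (at t within {p..q})"
          using has_vector_derivative_divide[OF conjunct1[OF D], of h]
          by (rule back_subst) (simp add: add_divide_distrib h(2))
        show "((\<lambda>t. (v (\<mu> + h) t - v \<mu> t) / h) has_vector_derivative
           c t * ((u (\<mu> + h) t - u \<mu> t) / h) + (d t + \<mu> * d' t) * ((v (\<mu> + h) t - v \<mu> t) / h) + d' t * v (\<mu> + h) t) (at t within {p..q})"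
          using has_vector_derivative_divide[OF conjunct2[OF D], of h]
          by (rule back_subst) (simp add: add_divide_distrib h(2))
      qed
      from lin2_sol_diff[OF this z(3)]
      have "lin2_sol (\<lambda>t. a t + \<mu> * a' t) b c (\<lambda>t. d t + \<mu> * d' t) (\<lambda>t. a' t * (u (\<mu> + h) t - u \<mu> t)) (\<lambda>t. d' t * (v (\<mu> + h) t - v \<mu> t)) {p..q}
         (\<lambda>t. (u (\<mu> + h) t - u \<mu> t) / h - z t) (\<lambda>t. (v (\<mu> + h) t - v \<mu> t) / h - z' t)"
        by (simp add: right_diff_distrib)
      then have "(cmod ((u (\<mu> + h) q - u \<mu> q) / h - z q))\<^sup>2 + (cmod ((v (\<mu> + h) q - v \<mu> q) / h - z' q))\<^sup>2
        \<le> ((cmod ((u (\<mu> + h) p - u \<mu> p) / h - z p))\<^sup>2 + (cmod ((v (\<mu> + h) p - v \<mu> p) / h - z' p))\<^sup>2 + 4 * (K * (C * cmod h))\<^sup>2 * (q - p)) * exp ((8 * K2 + 1) * (q - p))"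
      proof (rule lin2_sol_gronwall)
        fix r assume r: "r \<in> {p..q}"
        show "cmod (a r + \<mu> * a' r) \<le> K2" "cmod (d r + \<mu> * d' r) \<le> K2"
          using K[OF r] by (auto intro!: coef)
        show "cmod (b r) \<le> K2" "cmod (c r) \<le> K2" using K[OF r] K2 by auto
        show "cmod (a' r * (u (\<mu> + h) r - u \<mu> r)) \<le> K * (C * cmod h)" "cmod (d' r * (v (\<mu> + h) r - v \<mu> r)) \<le> K * (C * cmod h)"
          unfolding norm_mult using K[OF r] w[OF h(1) r] K0 by (auto intro!: mult_mono)
      qed (rule pq)
      also have "\<dots> = (cmod h)\<^sup>2 * C'\<^sup>2" by (simp add: uv z C2 E_def power_mult_distrib)
      finally show ?thesis by (intro root) (use C20 in auto)
    qed
    have lim: "((\<lambda>h. Q h) \<longlongrightarrow> Z) (at 0)"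
      if "\<And>h. cmod h \<le> 1 \<Longrightarrow> h \<noteq> 0 \<Longrightarrow> cmod (Q h - Z) \<le> C' * cmod h" for Q Z
    proof (rule LIM_zero_cancel, rule Lim_null_comparison)
      have "\<forall>\<^sub>F h::complex in at 0. dist h 0 < 1" by (rule eventually_at_ball'[of 1, simplified, THEN eventually_mono]) auto
      then have "\<forall>\<^sub>F h::complex in at 0. cmod h < 1" by simp
      then show "\<forall>\<^sub>F h in at 0. cmod (Q h - Z) \<le> C' * cmod h"
        using that by (auto simp: eventually_at_filter elim!: eventually_mono)
      show "((\<lambda>h::complex. C' * cmod h) \<longlongrightarrow> 0) (at 0)"
        by (rule tendsto_eq_intros refl | simp)+
    qed
    have "((\<lambda>\<mu>. u \<mu> q) has_field_derivative z q) (at \<mu>)" "((\<lambda>\<mu>. v \<mu> q) has_field_derivative z' q) (at \<mu>)"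
      unfolding DERIV_def by (rule lim, use e in blast)+
    then show ?thesis by blast
  qed
  have "(\<lambda>\<mu>. u \<mu> q) holomorphic_on UNIV" "(\<lambda>\<mu>. v \<mu> q) holomorphic_on UNIV"
    using der by (auto simp: holomorphic_on_open)
  then show ?thesis
    by (rule that) (use uv in blast)
qed


section \<open>Rotation numbers of circle lifts\<close>


locale circle_lift =
  fixes F :: "real \<Rightarrow> real"
  assumes mono: "x \<le> y \<Longrightarrow> F x \<le> F y"
    and shift: "F (x + 2 * pi) = F x + 2 * pi"
    and cont: "continuous_on UNIV F"
begin

lemma pow_mono: "x \<le> y \<Longrightarrow> (F ^^ n) x \<le> (F ^^ n) y"
  by (induction n) (auto intro: mono)

lemma shift_nat: "F (x + 2 * pi * real k) = F x + 2 * pi * real k"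
proof (induction k)
  case (Suc k)
  have "F (x + 2 * pi * real (Suc k)) = F ((x + 2 * pi * real k) + 2 * pi)"
    by (simp add: algebra_simps)
  then show ?case unfolding shift Suc by (simp add: algebra_simps)
qed simp

lemma shift_int: "F (x + 2 * pi * of_int k) = F x + 2 * pi * of_int k"
proof (cases "k \<ge> 0")
  case True
  then show ?thesis using shift_nat[of x "nat k"] by simp
next
  case False
  then show ?thesis using shift_nat[of "x + 2 * pi * of_int k" "nat (- k)"] by simp
qed

lemma pow_shift_int: "(F ^^ n) (x + 2 * pi * of_int k) = (F ^^ n) x + 2 * pi * of_int k"
  by (induction n) (auto simp: shift_int)

lemma pow_cont: "continuous_on UNIV (F ^^ n)"
proof (induction n)
  case (Suc n)
  show ?case
    using continuous_on_compose2[OF cont Suc] by (simp add: o_def)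
qed (simp add: continuous_on_id)

lemma pow_near:
  assumes "\<bar>x - y\<bar> \<le> 2 * pi"
  shows "\<bar>((F ^^ n) x - x) - ((F ^^ n) y - y)\<bar> \<le> 4 * pi"
proof -
  have 1: "(F ^^ n) x \<le> (F ^^ n) y + 2 * pi" "(F ^^ n) y - 2 * pi \<le> (F ^^ n) x"
    using pow_mono[of x "y + 2 * pi" n] pow_mono[of "y - 2 * pi" x n]
      pow_shift_int[of n y 1] pow_shift_int[of n y "-1"] assms by auto
  then show ?thesis using assms by linarith
qed

text \<open>The displacement is periodic, so one point may be moved to within a period of the other
  before monotonicity is applied; the bound does not depend on \<open>n\<close>.\<close>

lemma displacement_near: "\<bar>((F ^^ n) x - x) - ((F ^^ n) y - y)\<bar> \<le> 4 * pi"
proof -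
  define k where "k = \<lfloor>(x - y) / (2 * pi)\<rfloor>"
  have "of_int k \<le> (x - y) / (2 * pi)" "(x - y) / (2 * pi) < of_int k + 1"
    by (auto simp: k_def)
  then have "of_int k * (2 * pi) \<le> x - y" "x - y < (of_int k + 1) * (2 * pi)"
    by (simp_all add: pos_le_divide_eq pos_divide_less_eq)
  then have "\<bar>x - (y + 2 * pi * of_int k)\<bar> \<le> 2 * pi"
    by (simp add: algebra_simps)
  from pow_near[OF this, of n] show ?thesis
    by (simp add: pow_shift_int)
qed

lemma displacement_mult:
  "\<bar>((F ^^ (m * n)) x - x) - real m * ((F ^^ n) x - x)\<bar> \<le> 4 * pi * real m"
proof (induction m)
  case (Suc m)
  have "(F ^^ (Suc m * n)) x = (F ^^ n) ((F ^^ (m * n)) x)"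
    by (simp add: funpow_add)
  moreover have "\<bar>((F ^^ n) ((F ^^ (m * n)) x) - (F ^^ (m * n)) x) - ((F ^^ n) x - x)\<bar> \<le> 4 * pi"
    by (rule displacement_near)
  ultimately show ?case using Suc by (simp add: algebra_simps abs_le_iff)
qed simp

text \<open>Displacements are additive up to 4 pi per step, so the averages at \<open>m\<close> and
  at \<open>n\<close> are both close to the one at \<open>m * n\<close>. This makes them a Cauchy
  sequence, and the limit forgets the starting point.\<close>

lemma rotation_exists: "\<exists>R. \<forall>x. (\<lambda>n. (F ^^ n) x / real n) \<longlonglongrightarrow> R"
proof -
  define a where "a n = (F ^^ n) 0 / real n" for n
  have close: "\<bar>a (m * n) - a n\<bar> \<le> 4 * pi / real n" if "m > 0" "n > 0" for m n
  proof -
    have "\<bar>real (m * n) * (a (m * n) - a n)\<bar> \<le> 4 * pi * real m"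
      using displacement_mult[of m n 0] that by (simp add: a_def right_diff_distrib)
    then have "real (m * n) * \<bar>a (m * n) - a n\<bar> \<le> 4 * pi * real m"
      by (simp add: abs_mult)
    then have "real m * (real n * \<bar>a (m * n) - a n\<bar>) \<le> real m * (4 * pi)" by (simp add: mult_ac)
    then have "real n * \<bar>a (m * n) - a n\<bar> \<le> 4 * pi" using that by simp
    then show ?thesis using that by (simp add: field_simps)
  qed
  have "Cauchy a"
  proof (rule CauchyI)
    fix e :: real assume "e > 0"
    obtain N where N: "8 * pi / e < real N" "N > 0"
      using reals_Archimedean2[of "max 1 (8 * pi / e)"] by (metis max_less_iff_conj of_nat_0_less_iff zero_less_one order_less_trans)
    show "\<exists>M. \<forall>m\<ge>M. \<forall>n\<ge>M. norm (a m - a n) < e"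
    proof (intro exI allI impI)
      fix m n assume mn: "N \<le> m" "N \<le> n"
      have "\<bar>a (m * n) - a n\<bar> \<le> 4 * pi / real n" "\<bar>a (m * n) - a m\<bar> \<le> 4 * pi / real m"
        using close[of m n] close[of n m] mn N by (auto simp: mult.commute)
      moreover have "4 * pi / real n \<le> 4 * pi / real N" "4 * pi / real m \<le> 4 * pi / real N"
        using mn N by (auto intro!: divide_left_mono)
      moreover have "4 * pi / real N + 4 * pi / real N < e"
        using N \<open>e > 0\<close> by (simp add: field_simps)
      ultimately show "norm (a m - a n) < e" unfolding real_norm_def by linarith
    qed
  qed
  then obtain R where R: "a \<longlonglongrightarrow> R" using Cauchy_convergent convergent_def by blast
  have "(\<lambda>n. (F ^^ n) x / real n) \<longlonglongrightarrow> R" for x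
  proof -
    have "(\<lambda>n. (F ^^ n) x / real n - a n) \<longlonglongrightarrow> 0"
    proof (rule Lim_null_comparison)
      show "\<forall>\<^sub>F n in sequentially. norm ((F ^^ n) x / real n - a n) \<le> (4 * pi + \<bar>x\<bar>) / real n"
      proof (rule always_eventually, rule allI)
        fix n
        have "\<bar>(F ^^ n) x - (F ^^ n) 0\<bar> \<le> 4 * pi + \<bar>x\<bar>" using displacement_near[of n x 0] by linarith
        then show "norm ((F ^^ n) x / real n - a n) \<le> (4 * pi + \<bar>x\<bar>) / real n"
          by (simp add: a_def diff_divide_distrib[symmetric] divide_right_mono)
      qed
      show "(\<lambda>n. (4 * pi + \<bar>x\<bar>) / real n) \<longlonglongrightarrow> 0"
        by (rule lim_const_over_n)
    qed
    from tendsto_add[OF this R] show ?thesis by simp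
  qed
  then show ?thesis by blast
qed

definition rot :: real where
  "rot = (THE R. \<forall>x. (\<lambda>n. (F ^^ n) x / real n) \<longlonglongrightarrow> R) / (2 * pi)"

lemma rot_lim: "(\<lambda>n. (F ^^ n) x / real n) \<longlonglongrightarrow> 2 * pi * rot"
proof -
  obtain R where R: "\<forall>x. (\<lambda>n. (F ^^ n) x / real n) \<longlonglongrightarrow> R" using rotation_exists by blast
  have "(THE R. \<forall>x. (\<lambda>n. (F ^^ n) x / real n) \<longlonglongrightarrow> R) = R"
    by (rule the_equality) (use R LIMSEQ_unique in blast)+
  then show ?thesis using R by (simp add: rot_def)
qed

lemma rot_lim_subseq: "q > 0 \<Longrightarrow> (\<lambda>n. (F ^^ (n * q)) x / real n) \<longlonglongrightarrow> 2 * pi * rot * real q"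
proof -
  assume "q > 0"
  then have "strict_mono (\<lambda>n. n * q)" by (auto simp: strict_mono_def)
  from LIMSEQ_subseq_LIMSEQ[OF rot_lim[of x] this]
  have "(\<lambda>n. (F ^^ (n * q)) x / real (n * q)) \<longlonglongrightarrow> 2 * pi * rot" by (simp add: o_def)
  from tendsto_mult_right[OF this, of "real q"] show ?thesis using \<open>q > 0\<close> by simp
qed

lemma pow_pow_ge:
  assumes "\<And>n. (F ^^ q) (x + real n * c) \<ge> x + real n * c + c"
  shows "(F ^^ (n * q)) x \<ge> x + real n * c"
proof (induction n)
  case (Suc n)
  have "(F ^^ (Suc n * q)) x = (F ^^ q) ((F ^^ (n * q)) x)" by (simp add: funpow_add)
  also have "\<dots> \<ge> (F ^^ q) (x + real n * c)" by (rule pow_mono[OF Suc])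
  finally show ?case using assms[of n] by (simp add: algebra_simps)
qed simp

lemma pow_pow_le:
  assumes "\<And>n. (F ^^ q) (x + real n * c) \<le> x + real n * c + c"
  shows "(F ^^ (n * q)) x \<le> x + real n * c"
proof (induction n)
  case (Suc n)
  have "(F ^^ (Suc n * q)) x = (F ^^ q) ((F ^^ (n * q)) x)" by (simp add: funpow_add)
  also have "\<dots> \<le> (F ^^ q) (x + real n * c)" by (rule pow_mono[OF Suc])
  finally show ?case using assms[of n] by (simp add: algebra_simps)
qed simp

lemma lim_avg: "(\<lambda>n. (x + real n * c) / real n) \<longlonglongrightarrow> c"
proof -
  have "(\<lambda>n. x / real n + c) \<longlonglongrightarrow> 0 + c" by (intro tendsto_intros lim_const_over_n)
  moreover have "\<forall>\<^sub>F n in sequentially. x / real n + c = (x + real n * c) / real n"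
    using eventually_gt_at_top[of 0] by eventually_elim (simp add: add_divide_distrib)
  ultimately show ?thesis by (simp add: tendsto_cong)
qed

text \<open>The bound is asked only on the progression \<open>x + n * c\<close>. This covers both
  applications: a displacement bound valid everywhere, and a single point with
  \<open>c = 2 * pi * p\<close>, where the progression consists of translates by full turns.\<close>

lemma rot_ge_uniform:
  assumes "q > 0" "\<And>n::nat. (F ^^ q) (x + real n * c) \<ge> x + real n * c + c"
  shows "2 * pi * rot * real q \<ge> c"
proof (rule LIMSEQ_le[OF lim_avg rot_lim_subseq[OF assms(1), of x]])
  show "\<exists>N. \<forall>n\<ge>N. (x + real n * c) / real n \<le> (F ^^ (n * q)) x / real n"
    using pow_pow_ge[OF assms(2)] by (auto intro!: divide_right_mono)
qed

lemma rot_le_uniform: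
  assumes "q > 0" "\<And>n::nat. (F ^^ q) (x + real n * c) \<le> x + real n * c + c"
  shows "2 * pi * rot * real q \<le> c"
proof (rule LIMSEQ_le[OF rot_lim_subseq[OF assms(1), of x] lim_avg])
  show "\<exists>N. \<forall>n\<ge>N. (F ^^ (n * q)) x / real n \<le> (x + real n * c) / real n"
    using pow_pow_le[OF assms(2)] by (auto intro!: divide_right_mono)
qed

lemma rot_ge:
  assumes "q > 0" "(F ^^ q) x \<ge> x + 2 * pi * of_int p"
  shows "rot * real q \<ge> of_int p"
proof -
  have "2 * pi * rot * real q \<ge> 2 * pi * of_int p"
  proof (rule rot_ge_uniform[OF assms(1)])
    fix n :: nat
    show "(F ^^ q) (x + real n * (2 * pi * of_int p)) \<ge> x + real n * (2 * pi * of_int p) + 2 * pi * of_int p"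
      using assms(2) pow_shift_int[of q x "int n * p"] by (simp add: algebra_simps)
  qed
  then show ?thesis by (simp add: mult.assoc)
qed

lemma rot_le:
  assumes "q > 0" "(F ^^ q) x \<le> x + 2 * pi * of_int p"
  shows "rot * real q \<le> of_int p"
proof -
  have "2 * pi * rot * real q \<le> 2 * pi * of_int p"
  proof (rule rot_le_uniform[OF assms(1)])
    fix n :: nat
    show "(F ^^ q) (x + real n * (2 * pi * of_int p)) \<le> x + real n * (2 * pi * of_int p) + 2 * pi * of_int p"
      using assms(2) pow_shift_int[of q x "int n * p"] by (simp add: algebra_simps)
  qed
  then show ?thesis by (simp add: mult.assoc)
qed

lemma reduce_period:
  obtains x' k where "x = x' + 2 * pi * of_int k" "0 \<le> x'" "x' \<le> 2 * pi"
proof -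
  define k where "k = \<lfloor>x / (2 * pi)\<rfloor>"
  have "of_int k \<le> x / (2 * pi)" "x / (2 * pi) < of_int k + 1"
    by (auto simp: k_def)
  then have "0 \<le> x - 2 * pi * of_int k" "x - 2 * pi * of_int k \<le> 2 * pi"
    by (simp_all add: field_simps)
  then show ?thesis using that[of "x - 2 * pi * of_int k" k] by simp
qed

text \<open>The displacement of \<open>F ^^ q\<close> minus \<open>2 * pi * p\<close> is continuous
  and periodic. Without a zero it has one sign and, by compactness of a period, stays away from 0,
  which would move the rotation number.\<close>

lemma rot_rational_imp_periodic_point:
  assumes q: "q > 0" and r: "rot * real q = of_int p"
  shows "\<exists>x. (F ^^ q) x = x + 2 * pi * of_int p"
proof (rule ccontr)
  define G where "G x = (F ^^ q) x - x - 2 * pi * of_int p" for x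
  have G_cont: "continuous_on A G" for A
    unfolding G_def using continuous_on_subset[OF pow_cont] by (intro continuous_intros) auto
  have G_per: "G (x + 2 * pi * of_int k) = G x" for x k
    by (simp add: G_def pow_shift_int)
  assume "\<not> ?thesis"
  then have G0: "G x \<noteq> 0" for x by (auto simp: G_def algebra_simps)
  have conn: "connected (range G)"
    by (intro connected_continuous_image G_cont) auto
  have cpt: "compact {0..2*pi}" "{0..2*pi} \<noteq> {}" by auto
  show False
  proof (cases "\<exists>x. G x > 0")
    case True
    have pos: "G x > 0" for x
    proof (rule ccontr)
      assume "\<not> G x > 0"
      then have "G x \<le> 0" by simp
      moreover obtain z where "0 < G z" using True ..
      ultimately have "0 \<in> range G"
        using conn unfolding connected_iff_interval by (meson less_imp_le rangeI)
      then show False using G0 by auto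
    qed
    obtain m where m: "m \<in> {0..2*pi}" "\<forall>y\<in>{0..2*pi}. G m \<le> G y"
      using continuous_attains_inf[OF cpt G_cont] by blast
    have le: "G m \<le> G x" for x
      using reduce_period[of x] m G_per by (metis atLeastAtMost_iff)
    have "2 * pi * rot * real q \<ge> 2 * pi * of_int p + G m"
    proof (rule rot_ge_uniform[OF q, of 0])
      fix n :: nat
      show "(F ^^ q) (0 + real n * (2 * pi * of_int p + G m)) \<ge> 0 + real n * (2 * pi * of_int p + G m) + (2 * pi * of_int p + G m)"
        using le[of "real n * (2 * pi * of_int p + G m)"] by (simp add: G_def)
    qed
    moreover have "2 * pi * rot * real q = 2 * pi * of_int p" using r by (simp add: mult.assoc)
    ultimately show False using pos[of m] by simp
  next
    case False
    then have neg: "G x < 0" for x using G0 by (meson linorder_neqE_linordered_idom)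
    obtain m where m: "m \<in> {0..2*pi}" "\<forall>y\<in>{0..2*pi}. G y \<le> G m"
      using continuous_attains_sup[OF cpt G_cont] by blast
    have le: "G x \<le> G m" for x
      using reduce_period[of x] m G_per by (metis atLeastAtMost_iff)
    have "2 * pi * rot * real q \<le> 2 * pi * of_int p + G m"
    proof (rule rot_le_uniform[OF q, of 0])
      fix n :: nat
      show "(F ^^ q) (0 + real n * (2 * pi * of_int p + G m)) \<le> 0 + real n * (2 * pi * of_int p + G m) + (2 * pi * of_int p + G m)"
        using le[of "real n * (2 * pi * of_int p + G m)"] by (simp add: G_def)
    qed
    moreover have "2 * pi * rot * real q = 2 * pi * of_int p" using r by (simp add: mult.assoc)
    ultimately show False using neg[of m] by simp
  qed
qed

lemma rot_eq_int_iff: "rot = of_int p \<longleftrightarrow> (\<exists>x. F x = x + 2 * pi * of_int p)"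
proof
  assume "rot = of_int p"
  then show "\<exists>x. F x = x + 2 * pi * of_int p"
    using rot_rational_imp_periodic_point[of 1 p] by simp
next
  assume "\<exists>x. F x = x + 2 * pi * of_int p"
  then obtain x where "F x = x + 2 * pi * of_int p" ..
  then show "rot = of_int p"
    using rot_ge[of 1 x p] rot_le[of 1 x p] by simp
qed

lemma gap_below:
  assumes "circle_lift G" "\<And>x. F x < G x"
  obtains e where "e > 0" "\<And>x. F x + e \<le> G x"
proof -
  interpret G: circle_lift G by fact
  have cont': "continuous_on {0..2*pi} (\<lambda>x. G x - F x)"
    using continuous_on_subset[OF cont] continuous_on_subset[OF G.cont] by (intro continuous_intros) auto
  have "compact {0..2*pi}" "{0..2*pi} \<noteq> {}" by auto
  then obtain m where m: "\<forall>y\<in>{0..2*pi}. G m - F m \<le> G y - F y"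
    using continuous_attains_inf[OF _ _ cont'] by blast
  have "F x + (G m - F m) \<le> G x" for x
  proof -
    obtain x' k where "x = x' + 2 * pi * of_int k" "0 \<le> x'" "x' \<le> 2 * pi" by (rule reduce_period)
    then show ?thesis using m shift_int[of x' k] G.shift_int[of x' k] by force
  qed
  then show ?thesis using that[of "G m - F m"] assms(2)[of m] by simp
qed

text \<open>If the rotation number does not react to a perturbation in either direction it is
  rational: otherwise some orbit returns closer to its starting point than the size of the
  perturbation, which can then be used to push it past that point.\<close>

lemma locked_imp_rational:
  assumes lo: "circle_lift L" and hi: "circle_lift U"
    and lt: "\<And>x. L x < F x" "\<And>x. F x < U x"
    and eq: "circle_lift.rot L = rot" "circle_lift.rot U = rot"
  shows "\<exists>q p. q > 0 \<and> rot * real q = of_int p"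
proof -
  interpret L: circle_lift L by fact
  interpret U: circle_lift U by fact
  obtain e1 where e1: "e1 > 0" "\<And>x. L x + e1 \<le> F x"
    using L.gap_below[OF circle_lift_axioms lt(1)] by blast
  obtain e2 where e2: "e2 > 0" "\<And>x. F x + e2 \<le> U x"
    using gap_below[OF hi lt(2)] by blast
  define e where "e = min e1 e2"
  have e: "e > 0" "\<And>x. L x + e \<le> F x" "\<And>x. F x + e \<le> U x"
    using e1(1) e2(1) order_trans[OF add_left_mono e1(2), of e] order_trans[OF add_left_mono e2(2), of e]
    by (auto simp: e_def)
  \<comment> \<open>Positions on the circle in units of a full turn; compactness yields two times
    \<open>i < j\<close> whose positions differ by less than the gap \<open>e\<close>.\<close>
  define s where "s n = frac ((F ^^ n) 0 / (2 * pi))" for n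
  have "s n \<in> {0..1}" for n by (auto simp: s_def frac_lt_1 less_imp_le)
  then obtain l r where r: "strict_mono (r :: nat \<Rightarrow> nat)" and l: "(s \<circ> r) \<longlonglongrightarrow> l"
    using compact_Icc[of "0::real" 1] unfolding compact_def by (metis (no_types, lifting))
  have "Cauchy (s \<circ> r)" using l LIMSEQ_imp_Cauchy by blast
  then obtain N where N: "\<forall>m\<ge>N. \<forall>n\<ge>N. norm ((s \<circ> r) m - (s \<circ> r) n) < e / (2 * pi)"
    using e(1) CauchyD[of "s \<circ> r" "e / (2 * pi)"] by auto
  define i where "i = r N"
  define j where "j = r (Suc N)"
  have ij: "i < j" using r by (simp add: i_def j_def strict_mono_def)
  define q where "q = j - i"
  have q: "q > 0" using ij by (simp add: q_def)
  define y where "y = (F ^^ i) 0"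
  have yq: "(F ^^ q) y = (F ^^ j) 0"
  proof -
    have "j = q + i" using ij by (simp add: q_def)
    then show ?thesis by (metis comp_apply funpow_add y_def)
  qed
  define p where "p = \<lfloor>(F ^^ j) 0 / (2 * pi)\<rfloor> - \<lfloor>y / (2 * pi)\<rfloor>"
  have "\<bar>s j - s i\<bar> < e / (2 * pi)" using N by (simp add: i_def j_def)
  moreover have "s j - s i = ((F ^^ q) y - y - 2 * pi * of_int p) / (2 * pi)"
    by (simp add: s_def frac_def yq p_def y_def[symmetric] field_simps)
  ultimately have close: "\<bar>(F ^^ q) y - y - 2 * pi * of_int p\<bar> < e"
    by (simp add: abs_divide divide_less_cancel)
  obtain q' where q': "q = Suc q'" using q by (cases q) auto
  have Upow: "(U ^^ n) y \<ge> (F ^^ n) y" for n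
    by (induction n) (use e in \<open>auto intro: order_trans[OF mono] order_trans[OF less_imp_le[OF lt(2)]] U.mono\<close>)
  have Lpow: "(L ^^ n) y \<le> (F ^^ n) y" for n
    by (induction n) (use e in \<open>auto intro: order_trans[OF L.mono] less_imp_le[OF lt(1)]\<close>)
  \<comment> \<open>Only the last of the \<open>q\<close> steps uses the gap; monotonicity carries
    the comparison through the earlier ones.\<close>
  have Uq: "(U ^^ q) y \<ge> (F ^^ q) y + e"
    unfolding q' using e(3)[of "(U ^^ q') y"] mono[OF Upow[of q']] by simp
  have Lq: "(L ^^ q) y \<le> (F ^^ q) y - e"
    unfolding q' using e(2)[of "(L ^^ q') y"] mono[OF Lpow[of q']] by simp
  have "rot * real q = of_int p"
  proof (cases "(F ^^ q) y \<le> y + 2 * pi * of_int p")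
    case True
    then have "rot * real q \<le> of_int p" by (rule rot_le[OF q])
    moreover have "U.rot * real q \<ge> of_int p"
      by (rule U.rot_ge[OF q, of y]) (use Uq close in linarith)
    ultimately show ?thesis using eq by simp
  next
    case False
    then have "rot * real q \<ge> of_int p" by (intro rot_ge[OF q, of y]) simp
    moreover have "L.rot * real q \<le> of_int p"
      by (rule L.rot_le[OF q, of y]) (use Lq close in linarith)
    ultimately show ?thesis using eq by simp
  qed
  then show ?thesis using q by blast
qed

end


section \<open>The Josephson flow\<close>


lemma abs_sin_diff_le: "\<bar>sin x - sin y\<bar> \<le> \<bar>x - y\<bar>" for x y :: real
proof -
  have "\<bar>sin x - sin y\<bar> = 2 * \<bar>sin ((x - y) / 2)\<bar> * \<bar>cos ((x + y) / 2)\<bar>"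
    by (simp add: sin_diff_sin abs_mult)
  also have "\<dots> \<le> 2 * \<bar>(x - y) / 2\<bar> * 1"
    by (intro mult_mono abs_sin_x_le_abs_x) auto
  finally show ?thesis by simp
qed

lemma josephson_solution_exists:
  obtains phi where "is_josephson_solution om B A phi" "phi 0 = x"
proof -
  have 1: "continuous_on UNIV (\<lambda>(t, x). - sin x + B + A * cos (om * t) :: real)"
    unfolding case_prod_unfold by (intro continuous_intros)
  have 2: "norm ((- sin x + B + A * cos (om * t)) - (- sin y + B + A * cos (om * t))) \<le> 1 * norm (x - y)"
    for t x y :: real
    using abs_sin_diff_le[of y x] by simp
  obtain y where "y 0 = x" "\<And>t. (y has_vector_derivative (- sin (y t) + B + A * cos (om * t))) (at t)"
    using picard_lindeloef[OF 1 2, where ?x0.0 = x] by metis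
  then show ?thesis
    using that[of y] by (simp add: is_josephson_solution_def has_real_derivative_iff_has_vector_derivative)
qed

text \<open>After the last time with \<open>d\<close> nonnegative the lower bound for the derivative
  is \<open>d\<close> itself, so \<open>exp (- t) * d t\<close> cannot decrease and cannot become
  negative. The hypothesis is what the 1-Lipschitz sine gives for a difference of two
  solutions.\<close>

lemma nonneg_of_derivative_ge:
  fixes d d' :: "real \<Rightarrow> real"
  assumes der: "\<And>t. (d has_real_derivative d' t) (at t)" and "d a \<ge> 0"
    and ge: "\<And>t. t \<ge> a \<Longrightarrow> d' t \<ge> - \<bar>d t\<bar>" and "t \<ge> a"
  shows "d t \<ge> 0"
proof (rule ccontr)
  assume neg: "\<not> d t \<ge> 0"
  have cont: "continuous_on S d" for S
    using der DERIV_continuous_on has_field_derivative_at_within by blast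
  define S where "S = {s \<in> {a..t}. d s \<ge> 0}"
  have "S = {a..t} \<inter> d -` {0..}" by (auto simp: S_def)
  then have "closed S" using continuous_closed_preimage[OF cont, of "{a..t}" "{0..}"] by simp
  moreover have S: "S \<noteq> {}" "bdd_above S" using assms(2,4) by (auto simp: S_def intro!: bdd_aboveI[of _ t])
  ultimately have sup: "Sup S \<in> S" by (intro closed_contains_Sup)
  define s where "s = Sup S"
  have s: "s \<in> {a..t}" "d s \<ge> 0" using sup by (auto simp: S_def s_def)
  have after: "d r < 0" if "s < r" "r \<le> t" for r
  proof (rule ccontr)
    assume "\<not> d r < 0"
    then have "r \<in> S" using that s by (auto simp: S_def)
    then have "r \<le> s" unfolding s_def using S by (intro cSup_upper)
    then show False using that by simp
  qed
  have "exp (- s) * d s \<le> exp (- t) * d t"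
  proof (rule DERIV_nonneg_imp_increasing_open[where f = "\<lambda>t. exp (- t) * d t"])
    fix r assume r: "s < r" "r < t"
    have "((\<lambda>t. exp (- t) * d t) has_real_derivative exp (- r) * (d' r - d r)) (at r)"
      by (rule derivative_eq_intros der refl | simp add: algebra_simps)+
    moreover have "d' r - d r \<ge> 0" using ge[of r] after[of r] r s by auto
    ultimately show "\<exists>y. ((\<lambda>t. exp (- t) * d t) has_real_derivative y) (at r) \<and> 0 \<le> y"
      by (metis mult_nonneg_nonneg exp_ge_zero)
  qed (use s in \<open>auto intro!: continuous_intros cont\<close>)
  moreover have "exp (- s) * d s \<ge> 0" using s by simp
  moreover have "exp (- t) * d t < 0" using neg by (simp add: mult_pos_neg)
  ultimately show False by linarith
qed

lemma josephson_diff_derivative: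
  assumes "is_josephson_solution om B1 A1 p1" "is_josephson_solution om B2 A2 p2"
  shows "((\<lambda>t. p2 t - p1 t) has_real_derivative
     (sin (p1 t) - sin (p2 t) + (B2 - B1) + (A2 - A1) * cos (om * t))) (at t)"
proof -
  have "((\<lambda>t. p2 t - p1 t) has_real_derivative
     (- sin (p2 t) + B2 + A2 * cos (om * t)) - (- sin (p1 t) + B1 + A1 * cos (om * t))) (at t)"
    using assms unfolding is_josephson_solution_def by (intro DERIV_diff) auto
  then show ?thesis by (simp add: algebra_simps)
qed

lemma josephson_comparison:
  assumes "is_josephson_solution om B1 A p1" "is_josephson_solution om B2 A p2"
    and "B1 \<le> B2" "p1 0 \<le> p2 0" "t \<ge> 0"
  shows "p1 t \<le> p2 t"
proof -
  have "p2 t - p1 t \<ge> 0"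
  proof (rule nonneg_of_derivative_ge[OF josephson_diff_derivative[OF assms(1,2)], of 0 t])
    show "sin (p1 t) - sin (p2 t) + (B2 - B1) + (A - A) * cos (om * t) \<ge> - \<bar>p2 t - p1 t\<bar>" for t
      using abs_sin_diff_le[of "p1 t" "p2 t"] \<open>B1 \<le> B2\<close> by (simp add: abs_le_iff) linarith
  qed (use assms in auto)
  then show ?thesis by simp
qed

text \<open>By weak comparison \<open>p2 - p1\<close> is nonnegative and dominates the difference of
  the sines, so \<open>B2 - B1 > 0\<close> makes \<open>exp s * (p2 s - p1 s)\<close> strictly
  increasing.\<close>

lemma josephson_strict_comparison:
  assumes sol: "is_josephson_solution om B1 A p1" "is_josephson_solution om B2 A p2"
    and "B1 < B2" "p1 0 = p2 0" "t > 0"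
  shows "p1 t < p2 t"
proof -
  have le: "p1 s \<le> p2 s" if "s \<ge> 0" for s
    using josephson_comparison[OF sol] assms that by simp
  have der: "((\<lambda>s. exp s * (p2 s - p1 s)) has_real_derivative
     exp s * ((p2 s - p1 s) + (sin (p1 s) - sin (p2 s) + (B2 - B1) + (A - A) * cos (om * s)))) (at s)" for s
    by (rule derivative_eq_intros josephson_diff_derivative[OF sol] refl | simp add: algebra_simps)+
  have "exp 0 * (p2 0 - p1 0) < exp t * (p2 t - p1 t)"
  proof (rule DERIV_pos_imp_increasing_open[where f = "\<lambda>s. exp s * (p2 s - p1 s)"])
    fix s assume "0 < s" "s < t"
    then have "(p2 s - p1 s) + (sin (p1 s) - sin (p2 s) + (B2 - B1) + (A - A) * cos (om * s)) > 0"
      using le[of s] abs_sin_diff_le[of "p1 s" "p2 s"] \<open>B1 < B2\<close> by (simp add: abs_le_iff)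
    then show "\<exists>y. ((\<lambda>s. exp s * (p2 s - p1 s)) has_real_derivative y) (at s) \<and> y > 0"
      using der[of s] by (metis exp_gt_zero mult_pos_pos)
    next
      show "continuous_on {0..t} (\<lambda>s. exp s * (p2 s - p1 s))"
        by (rule DERIV_continuous_on[OF has_field_derivative_at_within[OF der]])
  qed (use \<open>t > 0\<close> in auto)
  then show ?thesis using assms(4) by (simp add: zero_less_mult_iff)
qed

lemma josephson_unique:
  assumes "is_josephson_solution om B A p1" "is_josephson_solution om B A p2" "p1 0 = p2 0" "t \<ge> 0"
  shows "p1 t = p2 t"
  using josephson_comparison[OF assms(1,2)] josephson_comparison[OF assms(2,1)] assms(3,4) by fastforce

lemma josephson_shift: "is_josephson_solution om B A p \<Longrightarrow> is_josephson_solution om B A (\<lambda>t. p t + 2 * pi)"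
  unfolding is_josephson_solution_def by (auto intro!: derivative_eq_intros)

lemma josephson_translate:
  assumes "is_josephson_solution om B A p" "om > 0"
  shows "is_josephson_solution om B A (\<lambda>t. p (t + real n * (2 * pi / om)))"
  unfolding is_josephson_solution_def
proof
  fix t
  have "om * (t + real n * (2 * pi / om)) = om * t + 2 * pi * real n"
    using \<open>om > 0\<close> by (simp add: distrib_left)
  then have "cos (om * (t + real n * (2 * pi / om))) = cos (om * t + 2 * pi * real n)"
    by simp
  also have "\<dots> = cos (om * t)"
    using cos.plus_of_nat[of "om * t" n] by (simp add: mult.commute)
  finally have eq: "cos (om * (t + real n * (2 * pi / om))) = cos (om * t)" .
  have "((\<lambda>t. p (t + real n * (2 * pi / om))) has_real_derivative
     - sin (p (t + real n * (2 * pi / om))) + B + A * cos (om * (t + real n * (2 * pi / om)))) (at t)"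
    using assms(1)[unfolded is_josephson_solution_def, rule_format, of "t + real n * (2 * pi / om)"]
    by (rule DERIV_shift[THEN iffD1])
  then show "((\<lambda>t. p (t + real n * (2 * pi / om))) has_real_derivative
     - sin (p (t + real n * (2 * pi / om))) + B + A * cos (om * t)) (at t)" by (simp only: eq)
qed

lemma josephson_dependence:
  assumes sol: "is_josephson_solution om B1 A1 p1" "is_josephson_solution om B2 A2 p2" and "t \<ge> 0"
  shows "(p2 t - p1 t)\<^sup>2 \<le> ((p2 0 - p1 0)\<^sup>2 + (\<bar>B2 - B1\<bar> + \<bar>A2 - A1\<bar>)\<^sup>2 * t) * exp (3 * t)"
proof -
  have "(norm (p2 t - p1 t))\<^sup>2 \<le> ((norm (p2 0 - p1 0))\<^sup>2 + (\<bar>B2 - B1\<bar> + \<bar>A2 - A1\<bar>)\<^sup>2 * (t - 0)) * exp ((2 * \<bar>1\<bar> + 1) * (t - 0))"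
  proof (rule gronwall_sq[where y = "\<lambda>t. p2 t - p1 t"])
    show "((\<lambda>t. p2 t - p1 t) has_vector_derivative
       (sin (p1 s) - sin (p2 s) + (B2 - B1) + (A2 - A1) * cos (om * s))) (at s within {0..t})" for s
      using josephson_diff_derivative[OF sol, of s] has_field_derivative_at_within
      unfolding has_real_derivative_iff_has_vector_derivative[symmetric] by blast
    show "norm (sin (p1 s) - sin (p2 s) + (B2 - B1) + (A2 - A1) * cos (om * s))
       \<le> 1 * norm (p2 s - p1 s) + (\<bar>B2 - B1\<bar> + \<bar>A2 - A1\<bar>)" for s
    proof -
      have "\<bar>(A2 - A1) * cos (om * s)\<bar> \<le> \<bar>A2 - A1\<bar> * 1"
        unfolding abs_mult by (intro mult_left_mono) auto
      moreover have "\<bar>a + b + c\<bar> \<le> \<bar>a\<bar> + \<bar>b\<bar> + \<bar>c\<bar>" for a b c :: real by linarith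
      ultimately show ?thesis
        using abs_sin_diff_le[of "p1 s" "p2 s"] unfolding real_norm_def abs_minus_commute[of "p1 s"]
        by (smt (verit) mult_cancel_left1 mult_1)
    qed
  qed (use \<open>t \<ge> 0\<close> in auto)
  then show ?thesis by simp
qed

section \<open>The Poincare map and the rotation number\<close>

text \<open>The choice is harmless: solutions with the same value at 0 agree for all
  \<open>t \<ge> 0\<close>, and the Poincare map only looks forward in time.\<close>

definition jsol :: "real \<Rightarrow> real \<Rightarrow> real \<Rightarrow> real \<Rightarrow> real \<Rightarrow> real" where
  "jsol om B A x = (SOME p. is_josephson_solution om B A p \<and> p 0 = x)"

lemma jsol: "is_josephson_solution om B A (jsol om B A x)" "jsol om B A x 0 = x"
proof -
  have "\<exists>p. is_josephson_solution om B A p \<and> p 0 = x"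
    using josephson_solution_exists by metis
  from someI_ex[OF this] show "is_josephson_solution om B A (jsol om B A x)" "jsol om B A x 0 = x"
    by (auto simp: jsol_def)
qed

lemma jsol_eq: "is_josephson_solution om B A p \<Longrightarrow> t \<ge> 0 \<Longrightarrow> jsol om B A (p 0) t = p t"
  by (rule josephson_unique) (auto simp: jsol)

definition poincare :: "real \<Rightarrow> real \<Rightarrow> real \<Rightarrow> real \<Rightarrow> real" where
  "poincare om B A x = jsol om B A x (2 * pi / om)"

lemma poincare_continuous:
  assumes om: "om > 0"
  shows "continuous_on UNIV (\<lambda>(B, A, x). poincare om B A x)"
proof (rule continuous_at_imp_continuous_on, rule ballI)
  fix z :: "real \<times> real \<times> real"
  obtain B A x where z: "z = (B, A, x)" by (cases z) auto
  define t where "t = 2 * pi / om"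
  have t: "t \<ge> 0" using om by (simp add: t_def)
  define P where "P w = poincare om (fst w) (fst (snd w)) (snd (snd w))" for w :: "real \<times> real \<times> real"
  define g where "g w = sqrt (((snd (snd w) - x)\<^sup>2 + (\<bar>fst w - B\<bar> + \<bar>fst (snd w) - A\<bar>)\<^sup>2 * t) * exp (3 * t))" for w :: "real \<times> real \<times> real"
  have bd: "norm (P w - P z) \<le> g w" for w
  proof -
    have "(P w - P z)\<^sup>2 \<le> ((snd (snd w) - x)\<^sup>2 + (\<bar>fst w - B\<bar> + \<bar>fst (snd w) - A\<bar>)\<^sup>2 * t) * exp (3 * t)"
      using josephson_dependence[OF jsol(1)[of om B A x] jsol(1)[of om "fst w" "fst (snd w)" "snd (snd w)"] t]
      by (simp add: P_def z poincare_def t_def jsol(2))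
    then show ?thesis unfolding g_def real_norm_def by (rule real_le_rsqrt[of "\<bar>_\<bar>", unfolded power2_abs])
  qed
  have "(g \<longlongrightarrow> g z) (at z)"
  proof -
    have "continuous_on UNIV g" unfolding g_def using t by (intro continuous_intros)
    then show ?thesis unfolding continuous_on_def by blast
  qed
  then have "(g \<longlongrightarrow> 0) (at z)" by (simp add: g_def z)
  then have "((\<lambda>w. P w - P z) \<longlongrightarrow> 0) (at z)"
    by (rule Lim_null_comparison[rotated]) (intro always_eventually allI bd)
  then have "(P \<longlongrightarrow> P z) (at z)" by (rule LIM_zero_cancel)
  then show "isCont (\<lambda>(B, A, x). poincare om B A x) z"
    by (simp add: isCont_def P_def[abs_def] case_prod_unfold)
qed

lemma poincare_continuous_compose:
  assumes "om > 0" "continuous_on S f" "continuous_on S g" "continuous_on S h"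
  shows "continuous_on S (\<lambda>s. poincare om (f s) (g s) (h s))"
proof -
  have "continuous_on S (\<lambda>s. (f s, g s, h s))" by (intro continuous_intros assms)
  from continuous_on_compose2[OF poincare_continuous[OF assms(1)] this] show ?thesis by simp
qed

lemma poincare_strict_mono_B: "om > 0 \<Longrightarrow> B1 < B2 \<Longrightarrow> poincare om B1 A x < poincare om B2 A x"
  unfolding poincare_def by (rule josephson_strict_comparison[OF jsol(1) jsol(1)]) (auto simp: jsol)

lemma circle_lift_poincare:
  assumes "om > 0" shows "circle_lift (poincare om B A)"
proof
  have T: "2 * pi / om \<ge> 0" using assms by simp
  show "poincare om B A x \<le> poincare om B A y" if "x \<le> y" for x y
    unfolding poincare_def by (rule josephson_comparison[OF jsol(1) jsol(1)]) (use that T in \<open>auto simp: jsol\<close>)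
  show "poincare om B A (x + 2 * pi) = poincare om B A x + 2 * pi" for x
    using jsol_eq[OF josephson_shift[OF jsol(1)[of om B A x]] T] by (simp add: poincare_def jsol)
  show "continuous_on UNIV (poincare om B A)"
    by (rule poincare_continuous_compose[OF assms]) (intro continuous_intros)+
qed

lemma jsol_pow:
  assumes "om > 0"
  shows "jsol om B A x (real n * (2 * pi / om)) = (poincare om B A ^^ n) x"
proof (induction n)
  case (Suc n)
  have T: "2 * pi / om \<ge> 0" using assms by simp
  have "jsol om B A (jsol om B A x (0 + real n * (2 * pi / om))) (2 * pi / om) = jsol om B A x (2 * pi / om + real n * (2 * pi / om))"
    by (rule jsol_eq[OF josephson_translate[OF jsol(1) assms, of B A x n] T])
  moreover have "2 * pi / om + real n * (2 * pi / om) = real (Suc n) * (2 * pi / om)"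
    by (simp only: of_nat_Suc distrib_right mult_1)
  ultimately show ?case using Suc by (simp add: poincare_def)
qed (simp add: jsol)

lemma jsol_le_linear:
  assumes sol: "is_josephson_solution om B A p" and "t \<ge> 0"
  shows "\<bar>p t - p 0\<bar> \<le> (1 + \<bar>B\<bar> + \<bar>A\<bar>) * t"
proof (cases "t = 0")
  case False
  then have "t > 0" using assms by simp
  have "norm (p t - p 0) \<le> (1 + \<bar>B\<bar> + \<bar>A\<bar>) * t - (1 + \<bar>B\<bar> + \<bar>A\<bar>) * 0"
  proof (rule differentiable_bound_general[where \<phi> = "\<lambda>t. (1 + \<bar>B\<bar> + \<bar>A\<bar>) * t"
        and \<phi>' = "\<lambda>_. 1 + \<bar>B\<bar> + \<bar>A\<bar>" and f' = "\<lambda>s. - sin (p s) + B + A * cos (om * s)"])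
    have der: "(p has_real_derivative (- sin (p s) + B + A * cos (om * s))) (at s)" for s
      using sol by (simp add: is_josephson_solution_def)
    show "(p has_vector_derivative (- sin (p s) + B + A * cos (om * s))) (at s)" for s
      using der has_real_derivative_iff_has_vector_derivative by blast
    show "continuous_on {0..t} p" by (meson DERIV_continuous_on der has_field_derivative_at_within)
    show "((\<lambda>t. (1 + \<bar>B\<bar> + \<bar>A\<bar>) * t) has_vector_derivative 1 + \<bar>B\<bar> + \<bar>A\<bar>) (at s)" for s
      unfolding has_real_derivative_iff_has_vector_derivative[symmetric]
      by (rule derivative_eq_intros refl | simp)+
    show "norm (- sin (p s) + B + A * cos (om * s)) \<le> 1 + \<bar>B\<bar> + \<bar>A\<bar>" for s
    proof -
      have "\<bar>A * cos (om * s)\<bar> \<le> \<bar>A\<bar> * 1" unfolding abs_mult by (intro mult_left_mono) auto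
      moreover have "\<bar>sin (p s)\<bar> \<le> 1" by simp
      ultimately show ?thesis unfolding real_norm_def by linarith
    qed
  qed (use \<open>t > 0\<close> in \<open>auto intro!: continuous_intros\<close>)
  then show ?thesis by simp
qed simp

text \<open>Since the last completed period a solution has moved by a bounded amount only, so its
  average is that of the iterates of the Poincare map at the number \<open>N t\<close> of completed
  periods. The factor \<open>om\<close> cancels against the period
  \<open>2 * pi / om\<close>.\<close>

lemma josephson_average:
  assumes om: "om > 0" and sol: "is_josephson_solution om B A p"
  shows "((\<lambda>t. p t / (om * t)) \<longlongrightarrow> circle_lift.rot (poincare om B A)) at_top"
proof -
  interpret P: circle_lift "poincare om B A" by (rule circle_lift_poincare[OF om])
  define T where "T = 2 * pi / om"
  have T: "T > 0" using om by (simp add: T_def)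
  define N where "N t = nat \<lfloor>t / T\<rfloor>" for t
  define a where "a n = (poincare om B A ^^ n) (p 0) / real n" for n
  define K where "K = (1 + \<bar>B\<bar> + \<bar>A\<bar>) * T"
  have K: "K \<ge> 0" using T by (simp add: K_def)
  have N_lim: "filterlim N at_top at_top"
    unfolding filterlim_at_top
  proof
    fix Z
    show "\<forall>\<^sub>F t in at_top. Z \<le> N t"
      using eventually_ge_at_top[of "real Z * T"]
    proof eventually_elim
      case (elim t)
      then have "real Z \<le> t / T" using T by (simp add: field_simps)
      then show ?case unfolding N_def by (rule le_nat_floor)
    qed
  qed
  have "a \<longlonglongrightarrow> 2 * pi * P.rot" unfolding a_def by (rule P.rot_lim)
  from filterlim_compose[OF this N_lim] have aN: "((\<lambda>t. a (N t)) \<longlongrightarrow> 2 * pi * P.rot) at_top" .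
  have close: "\<bar>p t - (poincare om B A ^^ N t) (p 0)\<bar> \<le> K" and NT: "real (N t) * T \<le> t" "t < real (N t) * T + T"
    if "t \<ge> 0" for t
  proof -
    have "of_int \<lfloor>t / T\<rfloor> = real (N t)" using that T by (simp add: N_def)
    then have "real (N t) \<le> t / T" "t / T < real (N t) + 1"
      using of_int_floor_le[of "t / T"] real_of_int_floor_add_one_gt[of "t / T"] by linarith+
    then show N: "real (N t) * T \<le> t" "t < real (N t) * T + T" using T by (simp_all add: field_simps)
    define s where "s = t - real (N t) * T"
    have s: "0 \<le> s" "s \<le> T" using N by (auto simp: s_def)
    have "\<bar>p (s + real (N t) * T) - p (0 + real (N t) * T)\<bar> \<le> (1 + \<bar>B\<bar> + \<bar>A\<bar>) * s"
      using jsol_le_linear[OF josephson_translate[OF sol om, of "N t"] s(1)] by (simp only: T_def)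
    also have "\<dots> \<le> K" unfolding K_def using s by (intro mult_left_mono) auto
    finally have "\<bar>p t - p (real (N t) * T)\<bar> \<le> K" by (simp add: s_def)
    moreover have "p (real (N t) * T) = (poincare om B A ^^ N t) (p 0)"
    proof -
      have "0 \<le> real (N t) * T" using T by simp
      from jsol_eq[OF sol this] jsol_pow[OF om, of B A "p 0" "N t"] show ?thesis
        unfolding T_def by simp
    qed
    ultimately show "\<bar>p t - (poincare om B A ^^ N t) (p 0)\<bar> \<le> K" by simp
  qed
  have ratio: "((\<lambda>t. real (N t) / t) \<longlongrightarrow> 1 / T) at_top"
  proof (rule tendsto_sandwich)
    show "\<forall>\<^sub>F t in at_top. 1 / T - 1 / t \<le> real (N t) / t"
      using eventually_gt_at_top[of 0]
    proof eventually_elim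
      case (elim t)
      then have "t / T - 1 \<le> real (N t)" using NT(2)[of t] T by (simp add: field_simps)
      then have "(t / T - 1) / t \<le> real (N t) / t" using elim by (intro divide_right_mono) auto
      then show ?case using elim T by (simp add: diff_divide_distrib)
    qed
    show "\<forall>\<^sub>F t in at_top. real (N t) / t \<le> 1 / T"
      using eventually_gt_at_top[of 0]
    proof eventually_elim
      case (elim t)
      then show ?case using NT(1)[of t] T by (simp add: field_simps)
    qed
    have "((\<lambda>t::real. 1 / T - 1 / t) \<longlongrightarrow> 1 / T - 0) at_top"
      by (intro tendsto_diff tendsto_const tendsto_divide_0[OF tendsto_const] filterlim_at_top_imp_at_infinity filterlim_ident)
    then show "((\<lambda>t::real. 1 / T - 1 / t) \<longlongrightarrow> 1 / T) at_top" by simp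
  qed auto
  have rem: "((\<lambda>t. (p t - (poincare om B A ^^ N t) (p 0)) / t) \<longlongrightarrow> 0) at_top"
  proof (rule Lim_null_comparison)
    show "\<forall>\<^sub>F t in at_top. norm ((p t - (poincare om B A ^^ N t) (p 0)) / t) \<le> K / t"
      using eventually_gt_at_top[of 0]
      by eventually_elim (use close in \<open>auto intro!: divide_right_mono\<close>)
    show "((\<lambda>t. K / t) \<longlongrightarrow> 0) at_top"
      by (intro tendsto_divide_0[OF tendsto_const] filterlim_at_top_imp_at_infinity filterlim_ident)
  qed
  have "((\<lambda>t. ((p t - (poincare om B A ^^ N t) (p 0)) / t + a (N t) * (real (N t) / t)) / om)
     \<longlongrightarrow> (0 + (2 * pi * P.rot) * (1 / T)) / om) at_top"
    by (intro tendsto_intros rem aN ratio) (use om in auto)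
  moreover have "(0 + (2 * pi * P.rot) * (1 / T)) / om = P.rot" using om by (simp add: T_def)
  moreover have "\<forall>\<^sub>F t in at_top. ((p t - (poincare om B A ^^ N t) (p 0)) / t + a (N t) * (real (N t) / t)) / om = p t / (om * t)"
    using eventually_gt_at_top[of T]
  proof eventually_elim
    case (elim t)
    then have "N t > 0" using NT(2)[of t] T by (cases "N t") auto
    moreover have "t > 0" using elim T by simp
    ultimately show ?case by (simp add: a_def field_simps)
  qed
  ultimately show ?thesis by (simp add: tendsto_cong)
qed

lemma rotation_number_eq:
  assumes om: "om > 0"
  shows "rotation_number om B A = circle_lift.rot (poincare om B A)"
  unfolding rotation_number_def
proof (rule the_equality)
  show "\<forall>phi. is_josephson_solution om B A phi \<longrightarrow> ((\<lambda>t. phi t / (om * t)) \<longlongrightarrow> circle_lift.rot (poincare om B A)) at_top"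
    using josephson_average[OF om] by blast
  fix r assume "\<forall>phi. is_josephson_solution om B A phi \<longrightarrow> ((\<lambda>t. phi t / (om * t)) \<longlongrightarrow> r) at_top"
  then show "r = circle_lift.rot (poincare om B A)"
    using josephson_average[OF om jsol(1)[of om B A 0]] jsol(1)[of om B A 0]
    by (meson tendsto_unique trivial_limit_at_top_linorder)
qed


section \<open>Constrictions\<close>


text \<open>The Josephson equation is the projectivisation of this system:
  \<open>v / u = cis phi\<close> for solutions that start on the unit circle.\<close>

abbreviation jlin_sol :: "real \<Rightarrow> real \<Rightarrow> real \<Rightarrow> (real \<Rightarrow> complex) \<Rightarrow> (real \<Rightarrow> complex) \<Rightarrow> bool" where
  "jlin_sol om B A \<equiv> lin2_sol (\<lambda>t. - \<i> * of_real (B + A * cos (om * t))) (\<lambda>_. 1 / 2) (\<lambda>_. 1 / 2) (\<lambda>_. 0)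
     (\<lambda>_. 0) (\<lambda>_. 0) {0..2 * pi / om}"

lemma has_vector_derivative_cis:
  assumes "(p has_real_derivative p') (at t)"
  shows "((\<lambda>t. cis (p t)) has_vector_derivative (\<i> * of_real p' * cis (p t))) (at t)"
proof -
  have "((\<lambda>t. \<i> * of_real (p t)) has_vector_derivative (\<i> * of_real p')) (at t)"
    using assms by (intro has_vector_derivative_mult_right has_vector_derivative_of_real)
      (simp add: has_real_derivative_iff_has_vector_derivative)
  from field_vector_diff_chain_at[OF this DERIV_exp]
  show ?thesis by (simp only: o_def cis_conv_exp)
qed

text \<open>The defect \<open>v - cis p * u\<close> satisfies a scalar homogeneous linear equation,
  hence stays 0; it is put into the planar format with zero second component.\<close>

lemma jlin_phase:
  assumes sol: "jlin_sol om B A u v" and p: "is_josephson_solution om B A p"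
    and init: "v 0 = cis (p 0) * u 0" and t: "t \<in> {0..2 * pi / om}"
  shows "v t = cis (p t) * u t"
proof -
  have "lin2_sol (\<lambda>t. - cis (p t) / 2) (\<lambda>_. 0) (\<lambda>_. 0) (\<lambda>_. 0) (\<lambda>_. 0) (\<lambda>_. 0) {0..2 * pi / om}
     (\<lambda>t. v t - cis (p t) * u t) (\<lambda>_. 0)"
    unfolding lin2_sol_def
  proof (intro ballI conjI)
    fix t assume t: "t \<in> {0..2 * pi / om}"
    let ?p' = "- sin (p t) + B + A * cos (om * t)"
    have "((\<lambda>t. cis (p t)) has_vector_derivative (\<i> * of_real ?p' * cis (p t))) (at t within {0..2 * pi / om})"
      by (rule has_vector_derivative_at_within[OF has_vector_derivative_cis[OF p[unfolded is_josephson_solution_def, rule_format]]])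
    then have "((\<lambda>t. v t - cis (p t) * u t) has_vector_derivative
        (1 / 2 * u t + 0 * v t + 0) -
        (cis (p t) * (- \<i> * of_real (B + A * cos (om * t)) * u t + 1 / 2 * v t + 0) + (\<i> * of_real ?p' * cis (p t)) * u t))
        (at t within {0..2 * pi / om})"
      by (intro has_vector_derivative_diff has_vector_derivative_mult
          sol[unfolded lin2_sol_def, rule_format, OF t, THEN conjunct1] sol[unfolded lin2_sol_def, rule_format, OF t, THEN conjunct2])
    moreover have "(1 / 2 * u t + 0 * v t + 0) -
        (cis (p t) * (- \<i> * of_real (B + A * cos (om * t)) * u t + 1 / 2 * v t + 0) + (\<i> * of_real ?p' * cis (p t)) * u t)
      = - cis (p t) / 2 * (v t - cis (p t) * u t)"
    proof -
      define c where "c = cis (p t)"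
      define s where "s = complex_of_real (sin (p t))"
      have 1: "2 * \<i> * s = c - cnj c" by (simp add: c_def s_def complex_eq_iff)
      have 2: "c * cnj c = 1" by (simp add: c_def cis_cnj cis_mult)
      have "2 * (\<i> * s * c) = (2 * \<i> * s) * c" by simp
      also have "\<dots> = c\<^sup>2 - c * cnj c"
        unfolding 1 by (simp only: power2_eq_square left_diff_distrib mult.commute[of "cnj c" c])
      finally have 3: "2 * (\<i> * s * c) = c\<^sup>2 - 1" unfolding 2 .
      have "c\<^sup>2 * u t - 2 * (\<i> * s * c) * u t = u t" unfolding 3 by (simp add: algebra_simps)
      then have "u t / 2 = c\<^sup>2 * u t / 2 - \<i> * s * c * u t" by (simp add: field_simps)
      then show ?thesis
        unfolding c_def[symmetric]
        by (simp add: s_def[symmetric] algebra_simps power2_eq_square)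
    qed
    ultimately show "((\<lambda>t. v t - cis (p t) * u t) has_vector_derivative
       - cis (p t) / 2 * (v t - cis (p t) * u t) + 0 * 0 + 0) (at t within {0..2 * pi / om})" by simp
  qed auto
  moreover have "continuous_on {0..2 * pi / om} (\<lambda>t. - cis (p t) / 2)"
  proof -
    have "continuous_on S p" for S
      by (rule DERIV_continuous_on[OF has_field_derivative_at_within[OF p[unfolded is_josephson_solution_def, rule_format]]])
    then show ?thesis by (intro continuous_intros) auto
  qed
  ultimately have "v t - cis (p t) * u t = 0"
    by (rule lin2_sol_zero(1)) (use init t in \<open>auto intro!: continuous_intros\<close>)
  then show ?thesis by simp
qed

text \<open>Along such a solution the derivative of the squared modulus of \<open>u\<close> is
  \<open>cos p\<close> times itself, so it decays at most like \<open>exp (- t)\<close>.\<close>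

lemma jlin_nonvanishing:
  assumes sol: "jlin_sol om B A u v" and p: "is_josephson_solution om B A p"
    and init: "v 0 = cis (p 0) * u 0" "u 0 \<noteq> 0" and om: "om > 0"
  shows "u (2 * pi / om) \<noteq> 0"
proof -
  define T where "T = 2 * pi / om"
  have T: "T \<ge> 0" using om by (simp add: T_def)
  have "exp 0 * (u 0 \<bullet> u 0) \<le> exp T * (u T \<bullet> u T)"
  proof (rule DERIV_nonneg_imp_increasing_open[where f = "\<lambda>t. exp t * (u t \<bullet> u t)"])
    fix t assume t: "0 < t" "t < T"
    then have t': "t \<in> {0..2 * pi / om}" by (simp add: T_def)
    let ?k = "B + A * cos (om * t)"
    have v: "v t = cis (p t) * u t" by (rule jlin_phase[OF sol p init(1) t'])
    define u' where "u' = - \<i> * of_real ?k * u t + 1 / 2 * v t"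
    have "(u has_vector_derivative u') (at t within {0..T})"
      using sol t' unfolding lin2_sol_def u'_def by (simp add: T_def)
    then have der: "(u has_vector_derivative u') (at t)" using t by (simp add: at_within_Icc_at)
    have "((\<lambda>t. u t \<bullet> u t) has_real_derivative 2 * (u t \<bullet> u')) (at t)"
      using has_derivative_inner[of u "\<lambda>h. h *\<^sub>R u'" t UNIV u "\<lambda>h. h *\<^sub>R u'"] der
      by (simp add: has_vector_derivative_def has_field_derivative_def inner_commute mult_commute_abs algebra_simps)
    then have "((\<lambda>t. exp t * (u t \<bullet> u t)) has_real_derivative exp t * (u t \<bullet> u t + 2 * (u t \<bullet> u'))) (at t)"
      by (auto intro!: derivative_eq_intros simp: algebra_simps)
    moreover have "2 * (u t \<bullet> u') = cos (p t) * (u t \<bullet> u t)"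
      by (simp add: u'_def v inner_complex_def field_simps)
    moreover have "u t \<bullet> u t + cos (p t) * (u t \<bullet> u t) \<ge> 0"
    proof -
      have "1 + cos (p t) \<ge> 0" using cos_ge_minus_one[of "p t"] by linarith
      then have "(1 + cos (p t)) * (u t \<bullet> u t) \<ge> 0" by (rule mult_nonneg_nonneg) simp
      then show ?thesis by (simp add: algebra_simps)
    qed
    ultimately show "\<exists>y. ((\<lambda>t. exp t * (u t \<bullet> u t)) has_real_derivative y) (at t) \<and> 0 \<le> y"
      by (intro exI[of _ "exp t * (u t \<bullet> u t + 2 * (u t \<bullet> u'))"]) simp
  next
    show "continuous_on {0..T} (\<lambda>t. exp t * (u t \<bullet> u t))"
      using lin2_sol_continuous(1)[OF sol] unfolding T_def by (intro continuous_intros) auto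
  qed (rule T)
  moreover have "0 < u 0 \<bullet> u 0" using init(2) by (simp add: inner_gt_zero_iff)
  ultimately have "0 < exp T * (u T \<bullet> u T)" unfolding exp_zero mult_1 by (rule order_less_le_trans[rotated])
  then show ?thesis unfolding T_def by (metis inner_zero_left less_irrefl mult_zero_right)
qed

text \<open>The matrix columns are the end values of the solutions starting at (1, 0) and (0, 1). On
  the directions \<open>(1, cis x)\<close> the matrix acts as the Poincare map, the end value of
  \<open>u\<close> being the multiplier.\<close>

lemma jlin_monodromy:
  assumes om: "om > 0"
  obtains \<alpha> \<beta> \<gamma> \<delta> where
    "\<And>u v. jlin_sol om B A u v \<Longrightarrow> u (2 * pi / om) = \<alpha> * u 0 + \<beta> * v 0 \<and> v (2 * pi / om) = \<gamma> * u 0 + \<delta> * v 0"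
    "\<And>x. \<exists>l. l \<noteq> 0 \<and> \<alpha> + \<beta> * cis x = l \<and> \<gamma> + \<delta> * cis x = l * cis (poincare om B A x)"
proof -
  define T where "T = 2 * pi / om"
  have T: "0 \<le> T" using om by (simp add: T_def)
  have cont: "continuous_on {0..T} (\<lambda>t. - \<i> * of_real (B + A * cos (om * t)))"
    "continuous_on {0..T} (\<lambda>_. 1 / 2 :: complex)" "continuous_on {0..T} (\<lambda>_. 0 :: complex)"
    by (intro continuous_intros)+
  note exi = lin2_sol_exists[OF T cont(1,2,2,3,3,3)]
  obtain u1 v1 where s1: "u1 0 = 1" "v1 0 = 0" "jlin_sol om B A u1 v1"
    using exi[of 1 0] unfolding T_def by metis
  obtain u2 v2 where s2: "u2 0 = 0" "v2 0 = 1" "jlin_sol om B A u2 v2"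
    using exi[of 0 1] unfolding T_def by metis
  have mat: "u T = u1 T * u 0 + u2 T * v 0 \<and> v T = v1 T * u 0 + v2 T * v 0" if "jlin_sol om B A u v" for u v
  proof -
    have c: "jlin_sol om B A (\<lambda>t. u 0 * u1 t + v 0 * u2 t) (\<lambda>t. u 0 * v1 t + v 0 * v2 t)"
      by (rule lin2_sol_combine[OF s1(3) s2(3)])
    have "u T = u 0 * u1 T + v 0 * u2 T" "v T = u 0 * v1 T + v 0 * v2 T"
      by (rule lin2_sol_unique[OF that c cont(1,2,2,3)[unfolded T_def]]; use T s1 s2 in \<open>simp add: T_def\<close>)+
    then show ?thesis by (simp add: mult.commute)
  qed
  show ?thesis
  proof (rule that[of "u1 T" "u2 T" "v1 T" "v2 T"])
    fix x
    obtain u v where s: "u 0 = 1" "v 0 = cis x" "jlin_sol om B A u v"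
      using exi[of 1 "cis x"] unfolding T_def by metis
    have init: "v 0 = cis (jsol om B A x 0) * u 0" "u 0 \<noteq> 0" by (auto simp: s jsol)
    have "v T = cis (poincare om B A x) * u T"
      using jlin_phase[OF s(3) jsol(1) init(1), of T] T by (simp add: T_def poincare_def)
    moreover have "u T \<noteq> 0" unfolding T_def by (rule jlin_nonvanishing[OF s(3) jsol(1) init om])
    ultimately show "\<exists>l. l \<noteq> 0 \<and> u1 T + u2 T * cis x = l \<and> v1 T + v2 T * cis x = l * cis (poincare om B A x)"
      using mat[OF s(3)] s by (intro exI[of _ "u T"]) (auto simp: mult.commute)
  qed (use mat in \<open>simp add: T_def\<close>)
qed

lemma cis_eq_imp: "cis x = cis y \<Longrightarrow> \<exists>k. x = y + 2 * pi * of_int k"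
  using sin_cos_eq_iff[of x y] by (auto simp: complex_eq_iff)

text \<open>A linear map with an eigenvector of its \<open>q\<close>-th power that is not an eigenvector of the map
  itself has a scalar \<open>q\<close>-th power: the image of the eigenvector is a second eigenvector for the
  same eigenvalue.\<close>

lemma periodic_point_imp_power_id:
  assumes F: "circle_lift F"
    and lin: "\<And>x. \<exists>l. l \<noteq> 0 \<and> \<alpha> + \<beta> * cis x = l \<and> \<gamma> + \<delta> * cis x = l * cis (F x)"
    and q: "q > 0" and per: "(F ^^ q) x0 = x0 + 2 * pi * of_int p"
    and no_fix: "\<And>k::int. F x0 \<noteq> x0 + 2 * pi * of_int k"
  shows "(F ^^ q) x = x + 2 * pi * of_int p"
proof -
  interpret F: circle_lift F by (rule F)
  define act where "act w = (\<alpha> * fst w + \<beta> * snd w, \<gamma> * fst w + \<delta> * snd w)" for w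
  have act_lin: "(act ^^ n) (s * fst w + t * fst w', s * snd w + t * snd w')
     = (s * fst ((act ^^ n) w) + t * fst ((act ^^ n) w'), s * snd ((act ^^ n) w) + t * snd ((act ^^ n) w'))" for n s t w w'
    by (induction n) (auto simp: act_def algebra_simps)
  have act_cis: "\<exists>l. l \<noteq> 0 \<and> (act ^^ n) (1, cis y) = (l, l * cis ((F ^^ n) y))" for n y
  proof (induction n)
    case (Suc n)
    then obtain l where l: "l \<noteq> 0" "(act ^^ n) (1, cis y) = (l, l * cis ((F ^^ n) y))" by blast
    obtain m where m: "m \<noteq> 0" "\<alpha> + \<beta> * cis ((F ^^ n) y) = m" "\<gamma> + \<delta> * cis ((F ^^ n) y) = m * cis (F ((F ^^ n) y))"
      using lin by blast
    have "(act ^^ Suc n) (1, cis y) = (l * (\<alpha> + \<beta> * cis ((F ^^ n) y)), l * (\<gamma> + \<delta> * cis ((F ^^ n) y)))"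
      by (simp add: l act_def algebra_simps)
    then show ?case using l m by (intro exI[of _ "l * m"]) simp
  qed simp
  obtain l where l: "l \<noteq> 0" "(act ^^ q) (1, cis x0) = (l, l * cis ((F ^^ q) x0))" using act_cis by blast
  have "cis ((F ^^ q) x0) = cis x0"
    unfolding per using sin_cos_eq_iff[of "x0 + 2 * pi * of_int p" x0] by (auto simp: complex_eq_iff)
  with l have e1: "(act ^^ q) (1, cis x0) = (l, l * cis x0)" by simp
  obtain m where m: "m \<noteq> 0" "act (1, cis x0) = (m, m * cis (F x0))" using act_cis[of 1 x0] by auto
  have e2: "(act ^^ q) (m, m * cis (F x0)) = (l * m, l * (m * cis (F x0)))"
  proof -
    have "(act ^^ q) (act (1, cis x0)) = act ((act ^^ q) (1, cis x0))" by (simp add: funpow_swap1)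
    also have "\<dots> = act (l * fst (1 :: complex, cis x0), l * snd (1 :: complex, cis x0))" by (simp add: e1)
    also have "\<dots> = (l * fst (act (1, cis x0)), l * snd (act (1, cis x0)))" by (simp add: act_def algebra_simps)
    finally show ?thesis by (simp add: m)
  qed
  have ne: "cis (F x0) \<noteq> cis x0" using no_fix cis_eq_imp by blast
  define t where "t = (cis x - cis x0) / (m * (cis (F x0) - cis x0))"
  define s where "s = 1 - t * m"
  have st: "s * 1 + t * m = 1" "s * cis x0 + t * (m * cis (F x0)) = cis x"
  proof -
    show "s * 1 + t * m = 1" by (simp add: s_def)
    have "s * cis x0 + t * (m * cis (F x0)) = cis x0 + t * (m * (cis (F x0) - cis x0))"
      by (simp add: s_def algebra_simps)
    also have "t * (m * (cis (F x0) - cis x0)) = cis x - cis x0" using ne m by (simp add: t_def)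
    finally show "s * cis x0 + t * (m * cis (F x0)) = cis x" by simp
  qed
  have "(act ^^ q) (1, cis x) = (act ^^ q) (s * fst (1 :: complex, cis x0) + t * fst (m, m * cis (F x0)),
      s * snd (1 :: complex, cis x0) + t * snd (m, m * cis (F x0)))"
    by (simp only: fst_conv snd_conv st)
  also have "\<dots> = (l * (s * 1 + t * m), l * (s * cis x0 + t * (m * cis (F x0))))"
    unfolding act_lin unfolding e1 e2 fst_conv snd_conv by (simp add: distrib_left mult_ac)
  finally have "(act ^^ q) (1, cis x) = (l * 1, l * cis x)" unfolding st .
  then have "cis ((F ^^ q) x) = cis x" using act_cis[of q x] l(1) by auto
  then obtain k where k: "(F ^^ q) x = x + 2 * pi * of_int k" using cis_eq_imp by blast
  have "F.rot * real q = of_int k" using F.rot_ge[OF q, of x k] F.rot_le[OF q, of x k] k by simp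
  moreover have "F.rot * real q = of_int p" using F.rot_ge[OF q, of x0 p] F.rot_le[OF q, of x0 p] per by simp
  ultimately show ?thesis using k by simp
qed

lemma open_contains_box:
  fixes S :: "(real \<times> real) set"
  assumes "open S" "(b, a) \<in> S"
  obtains \<delta> where "\<delta> > 0" "\<And>x y. \<bar>x - b\<bar> < \<delta> \<Longrightarrow> \<bar>y - a\<bar> < \<delta> \<Longrightarrow> (x, y) \<in> S"
proof -
  obtain e where e: "e > 0" "ball (b, a) e \<subseteq> S" using assms open_contains_ball by blast
  show ?thesis
  proof (rule that[of "e / 2"])
    fix x y assume "\<bar>x - b\<bar> < e / 2" "\<bar>y - a\<bar> < e / 2"
    moreover have "dist (b, a) (x, y) \<le> \<bar>x - b\<bar> + \<bar>y - a\<bar>"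
      using sqrt_sum_squares_le_sum_abs[of "b - x" "a - y"]
      by (simp add: dist_Pair_Pair dist_real_def abs_minus_commute)
    ultimately show "(x, y) \<in> S" using e by auto
  qed (use e in auto)
qed

text \<open>Inside the open set the rotation number does not react to moving \<open>B\<close> by
  \<open>e\<close> either way, so it is rational. At a non-integer value no point is fixed modulo 2
  pi, so the \<open>q\<close>-th iterate is translation by \<open>2 * pi * p\<close> for all nearby
  \<open>B\<close>, although it strictly increases with \<open>B\<close>.\<close>

lemma phase_lock_interior_imp_integer:
  assumes om: "om > 0" and "phase_lock_area om r"
  shows "r \<in> \<int>"
proof (rule ccontr)
  assume r: "r \<notin> \<int>"
  obtain b a where "(b, a) \<in> interior (level_set_rot om r)"
    using assms(2) unfolding phase_lock_area_def by fastforce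
  from open_contains_box[OF open_interior this] obtain d where d: "d > 0"
    "\<And>x y. \<bar>x - b\<bar> < d \<Longrightarrow> \<bar>y - a\<bar> < d \<Longrightarrow> (x, y) \<in> interior (level_set_rot om r)" by blast
  define e where "e = d / 2"
  have e: "e > 0" using d by (simp add: e_def)
  note lift = circle_lift_poincare[OF om]
  have rot: "circle_lift.rot (poincare om x a) = r" if "\<bar>x - b\<bar> \<le> e" for x
    using d(2)[of x a] that d(1) interior_subset rotation_number_eq[OF om] by (force simp: level_set_rot_def e_def)
  note rots = rot[of "b - e"] rot[of b] rot[of "b + e"]
  obtain q p where q: "q > 0" "r * real q = of_int p"
    using circle_lift.locked_imp_rational[OF lift[of b a] lift[of "b - e" a] lift[of "b + e" a]]
      poincare_strict_mono_B[OF om] rots e by (auto simp: less_imp_le)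
  have all: "(poincare om x a ^^ q) y = y + 2 * pi * of_int p" if "\<bar>x - b\<bar> \<le> e" for x y
  proof -
    interpret P: circle_lift "poincare om x a" by (rule lift)
    have Pr: "P.rot = r" by (rule rot[OF that])
    obtain x0 where x0: "(poincare om x a ^^ q) x0 = x0 + 2 * pi * of_int p"
      using P.rot_rational_imp_periodic_point[OF q(1)] q(2) Pr by blast
    have "poincare om x a x0 \<noteq> x0 + 2 * pi * of_int k" for k :: int
      using P.rot_eq_int_iff[of k] r Pr by (metis Ints_of_int)
    then show ?thesis
      using periodic_point_imp_power_id[OF lift _ q(1) x0] jlin_monodromy[OF om, of x a] by metis
  qed
  obtain q' where q': "q = Suc q'" using q by (cases q) auto
  interpret P1: circle_lift "poincare om b a" by (rule lift)
  have le: "(poincare om b a ^^ n) 0 \<le> (poincare om (b + e) a ^^ n) 0" for n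
  proof (induction n)
    case (Suc n)
    have "poincare om b a ((poincare om b a ^^ n) 0) \<le> poincare om b a ((poincare om (b + e) a ^^ n) 0)"
      by (rule P1.mono[OF Suc])
    also have "\<dots> \<le> poincare om (b + e) a ((poincare om (b + e) a ^^ n) 0)"
      using poincare_strict_mono_B[OF om, of b "b + e"] e by (simp add: less_imp_le)
    finally show ?case by simp
  qed simp
  have "(poincare om b a ^^ q) 0 < (poincare om (b + e) a ^^ q) 0"
    using order_le_less_trans[OF P1.mono[OF le[of q']] poincare_strict_mono_B[OF om, of b "b + e"]] e
    by (simp add: q')
  then show False using all[of b 0] all[of "b + e" 0] e by simp
qed

text \<open>Here \<open>D\<close> is the displacement of the Poincare map.  Where it takes both signs the level set is a
  neighbourhood; where it only touches zero, the interior of the level set is locally the region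
  below a graph over the \<open>A\<close>-axis.  The sign \<open>\<sigma>\<close> lets one argument cover both kinds of contact.\<close>

lemma touching_component_unique:
  fixes D :: "real \<Rightarrow> real \<Rightarrow> real \<Rightarrow> real" and \<sigma> :: real
  assumes cont: "continuous_on UNIV (\<lambda>(B, A, x). D B A x)"
    and \<sigma>: "\<sigma> = 1 \<or> \<sigma> = -1"
    and mono: "\<And>B A x e. e > 0 \<Longrightarrow> D (B - \<sigma> * e) A x < D B A x"
    and G: "G = {(B, A). \<exists>x. D B A x = 0}"
    and zero: "D B0 A0 x0 = 0" and pos: "D B0 A0 x1 > 0"
    and C: "C1 \<in> components (interior G)" "C2 \<in> components (interior G)"
    and cl: "(B0, A0) \<in> closure C1" "(B0, A0) \<in> closure C2"
  shows "C1 = C2"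
proof -
  have contx: "continuous_on UNIV (\<lambda>w. D (fst w) (snd w) x)" for x
  proof -
    have "continuous_on UNIV (\<lambda>w::real\<times>real. (fst w, snd w, x))" by (intro continuous_intros)
    from continuous_on_compose2[OF cont this] show ?thesis by simp
  qed
  have cont3: "continuous_on UNIV (D B A)" for B A
  proof -
    have "continuous_on UNIV (\<lambda>x. (B, A, x))" by (intro continuous_intros)
    from continuous_on_compose2[OF cont this] show ?thesis by simp
  qed
  have op1: "open {w. D (fst w) (snd w) x < 0}" and op2: "open {w. 0 < D (fst w) (snd w) x}" for x
    by (intro open_Collect_less contx continuous_on_const)+
  obtain d where d: "d > 0" "\<And>B A. \<bar>B - B0\<bar> < d \<Longrightarrow> \<bar>A - A0\<bar> < d \<Longrightarrow> D B A x1 > 0"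
    using open_contains_box[OF op2, of B0 A0 x1] pos by auto
  \<comment> \<open>Moving by half the box width in the direction in which \<open>D\<close>
    decreases makes \<open>D\<close> negative at \<open>x0\<close>; the vertical segment over
    \<open>B1\<close> will then lie in \<open>W\<close>.\<close>
  define B1 where "B1 = B0 - \<sigma> * (d / 2)"
  have "D B1 A0 x0 < 0" unfolding B1_def using mono[of "d / 2" B0 A0 x0] d zero by simp
  then obtain d' where d': "d' > 0" "\<And>A. \<bar>A - A0\<bar> < d' \<Longrightarrow> D B1 A x0 < 0"
    using open_contains_box[OF op1, of B1 A0 x0] by (metis (no_types, lifting) abs_zero cancel_comm_monoid_add_class.diff_cancel fst_conv mem_Collect_eq snd_conv)
  define \<delta> where "\<delta> = min d d'"
  define U where "U = {B0 - d<..<B0 + d} \<times> {A0 - \<delta><..<A0 + \<delta>}"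
  define W where "W = U \<inter> (\<Union>x. {w. D (fst w) (snd w) x < 0})"
  have \<delta>: "\<delta> > 0" "\<delta> \<le> d" "\<delta> \<le> d'" using d d' by (auto simp: \<delta>_def)
  have "open U" by (simp add: U_def open_Times)
  then have "open W" unfolding W_def using op1 by auto
  have "W \<subseteq> G"
  proof
    fix w assume w: "w \<in> W"
    obtain B A where BA: "w = (B, A)" by (cases w)
    from w obtain x where x: "D B A x < 0" by (auto simp: W_def BA)
    have p: "D B A x1 > 0" by (rule d(2)) (use w \<delta> in \<open>auto simp: W_def U_def BA\<close>)
    have "connected (range (D B A))" by (intro connected_continuous_image cont3) auto
    then have "0 \<in> range (D B A)"
      unfolding connected_iff_interval using x p by (meson less_imp_le rangeI)
    then show "w \<in> G" by (auto simp: G BA)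
  qed
  then have WG: "W \<subseteq> interior G" using \<open>open W\<close> interior_maximal by blast
  \<comment> \<open>At an interior point there is room to move in the direction in which
    \<open>D\<close> increases and still find a zero; moving back makes \<open>D\<close> negative at
    that zero.\<close>
  have GW: "interior G \<inter> U \<subseteq> W"
  proof
    fix w assume w: "w \<in> interior G \<inter> U"
    obtain B A where BA: "w = (B, A)" by (cases w)
    obtain e where e: "e > 0" "\<And>x y. \<bar>x - B\<bar> < e \<Longrightarrow> \<bar>y - A\<bar> < e \<Longrightarrow> (x, y) \<in> interior G"
      using open_contains_box[of "interior G" B A] w BA by auto
    have "(B + \<sigma> * (e / 2), A) \<in> G"
      by (rule subsetD[OF interior_subset], rule e(2)) (use e(1) \<sigma> in \<open>auto simp: abs_mult\<close>)
    then obtain x where "D (B + \<sigma> * (e / 2)) A x = 0" by (auto simp: G)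
    then have "D B A x < 0" using mono[of "e / 2" "B + \<sigma> * (e / 2)" A x] e by simp
    then show "w \<in> W" using w by (auto simp: W_def BA)
  qed
  \<comment> \<open>\<open>V\<close> is vertical on the line \<open>B = B1\<close>, and
    \<open>h w\<close> is the horizontal segment from \<open>w\<close> to that line. Together they
    form a comb whose union is \<open>W\<close>, which shows that \<open>W\<close> is
    connected.\<close>
  define V where "V = {B1} \<times> {A0 - \<delta><..<A0 + \<delta>}"
  define h where "h w = {min (fst w) B1..max (fst w) B1} \<times> {snd w}" for w :: "real \<times> real"
  have B1U: "B1 \<in> {B0 - d<..<B0 + d}" using \<sigma> d by (auto simp: B1_def)
  have low: "D B A x0 < 0" if "B = B1 - \<sigma> * e" "e \<ge> 0" "\<bar>A - A0\<bar> < \<delta>" for B A e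
    using d'(2)[of A] mono[of e B1 A x0] that \<delta> by (cases "e = 0") auto
  have VW: "V \<subseteq> W"
    using B1U low[of B1 0] by (force simp: V_def W_def U_def)
  have hW: "h w \<subseteq> W" if w: "w \<in> W" for w
  proof
    fix z assume z: "z \<in> h w"
    obtain B A where BA: "w = (B, A)" by (cases w)
    obtain B' where z': "z = (B', A)" "min B B1 \<le> B'" "B' \<le> max B B1" using z by (auto simp: h_def BA)
    have AU: "\<bar>A - A0\<bar> < \<delta>" "B \<in> {B0 - d<..<B0 + d}" using w by (auto simp: W_def U_def BA)
    have zU: "z \<in> U" using z' AU B1U by (auto simp: U_def abs_less_iff min_def max_def split: if_splits)
    from w obtain x where x: "D B A x < 0" by (auto simp: W_def BA)
    define e where "e = \<sigma> * (B1 - B')"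
    have B': "B' = B1 - \<sigma> * e" using \<sigma> by (auto simp: e_def)
    show "z \<in> W"
    proof (cases "e \<ge> 0")
      case True
      then have "D B' A x0 < 0" using low[OF B' _ AU(1)] by simp
      then show ?thesis using zU by (auto simp: W_def z')
    next
      case False
      define e' where "e' = \<sigma> * (B - B')"
      have "B' = B - \<sigma> * e'" using \<sigma> by (auto simp: e'_def)
      moreover have "e' \<ge> 0" using False z' \<sigma> by (auto simp: e_def e'_def min_def max_def split: if_splits)
      ultimately have "D B' A x < 0" using mono[of e' B A x] x by (cases "e' = 0") auto
      then show ?thesis using zU by (auto simp: W_def z')
    qed
  qed
  have "connected (\<Union>w\<in>W. h w \<union> V)"
  proof (rule connected_Union)
    show "connected s" if "s \<in> (\<lambda>w. h w \<union> V) ` W" for s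
    proof -
      obtain w where w: "w \<in> W" "s = h w \<union> V" using \<open>s \<in> _\<close> by blast
      have "(B1, snd w) \<in> h w \<inter> V" using w by (auto simp: h_def V_def W_def U_def)
      then have "h w \<inter> V \<noteq> {}" by blast
      moreover have "connected (h w)" "connected V" by (simp_all add: h_def V_def connected_Times)
      ultimately show ?thesis unfolding w(2) by (intro connected_Un)
    qed
    have "(B1, A0) \<in> V" using \<delta> by (simp add: V_def)
    then show "\<Inter> ((\<lambda>w. h w \<union> V) ` W) \<noteq> {}" by auto
  qed
  moreover have "(\<Union>w\<in>W. h w \<union> V) = W"
  proof
    show "(\<Union>w\<in>W. h w \<union> V) \<subseteq> W" using hW VW by blast
    show "W \<subseteq> (\<Union>w\<in>W. h w \<union> V)"
    proof
      fix w assume "w \<in> W"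
      moreover have "w \<in> h w" by (cases w) (auto simp: h_def)
      ultimately show "w \<in> (\<Union>w\<in>W. h w \<union> V)" by blast
    qed
  qed
  ultimately have conn: "connected W" by simp
  \<comment> \<open>A component with the point in its closure meets \<open>U\<close>, hence
    \<open>W\<close>, and then contains the connected set \<open>W\<close>; two such components
    overlap.\<close>
  have sub: "W \<subseteq> C \<and> W \<noteq> {}" if "C \<in> components (interior G)" "(B0, A0) \<in> closure C" for C
  proof -
    have "(B0, A0) \<in> U" using d \<delta> by (simp add: U_def)
    then have "C \<inter> U \<noteq> {}" using that(2) \<open>open U\<close> by (metis disjoint_iff open_Int_closure_eq_empty Int_commute)
    then have ne: "C \<inter> W \<noteq> {}" using GW in_components_subset[OF that(1)] by blast
    then show ?thesis using components_maximal[OF that(1) conn WG] by auto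
  qed
  have "C1 \<inter> C2 \<noteq> {}" using sub[OF C(1) cl(1)] sub[OF C(2) cl(2)] by blast
  then show ?thesis using components_nonoverlap[OF C] by blast
qed

text \<open>The displacement has a zero because the rotation number is an integer. If it were
  nonzero elsewhere, \<open>D\<close> or \<open>- D\<close> would be positive there, and the two
  components meeting at the constriction would coincide. The sign \<open>-1\<close> accounts for
  \<open>- D\<close> decreasing in \<open>B\<close>.\<close>

lemma constriction_imp_poincare_translation:
  assumes om: "om > 0" and con: "constriction om B0 A0"
  shows "\<exists>k::int. \<forall>x. poincare om B0 A0 x = x + 2 * pi * of_int k"
proof -
  obtain r C1 C2 where r: "phase_lock_area om r" "(B0, A0) \<in> level_set_rot om r"
    and C: "C1 \<in> components (interior (level_set_rot om r))" "C2 \<in> components (interior (level_set_rot om r))"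
      "C1 \<noteq> C2" "(B0, A0) \<in> closure C1" "(B0, A0) \<in> closure C2"
    using con unfolding constriction_def by blast
  obtain k where k: "r = of_int k"
    using phase_lock_interior_imp_integer[OF om r(1)] by (auto elim: Ints_cases)
  define D where "D B A x = poincare om B A x - x - 2 * pi * of_int k" for B A x
  have G: "level_set_rot om r = {(B, A). \<exists>x. D B A x = 0}"
    unfolding level_set_rot_def rotation_number_eq[OF om] k circle_lift.rot_eq_int_iff[OF circle_lift_poincare[OF om]] D_def
    by (auto simp: algebra_simps)
  have cont: "continuous_on UNIV (\<lambda>(B, A, x). D B A x)"
    using poincare_continuous[OF om] unfolding D_def case_prod_unfold by (intro continuous_intros)
  have mono: "D B1 A x < D B2 A x" if "B1 < B2" for B1 B2 A x
    using poincare_strict_mono_B[OF om that] by (simp add: D_def)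
  obtain x0 where x0: "D B0 A0 x0 = 0" using r(2) unfolding G by blast
  have "D B0 A0 x = 0" for x
  proof (rule ccontr)
    assume "D B0 A0 x \<noteq> 0"
    then consider "D B0 A0 x > 0" | "- D B0 A0 x > 0" by linarith
    then show False
    proof cases
      case 1
      have "C1 = C2"
        by (rule touching_component_unique[OF cont, of 1 "level_set_rot om r" B0 A0 x0 x])
          (use C x0 1 G mono in auto)
      then show False using C by simp
    next
      case 2
      have cont': "continuous_on UNIV (\<lambda>(B, A, x). - D B A x)"
        using cont unfolding case_prod_unfold by (intro continuous_intros)
      have "C1 = C2"
        by (rule touching_component_unique[OF cont', of "-1" "level_set_rot om r" B0 A0 x0 x])
          (use C x0 2 G mono in auto)
      then show False using C by simp
    qed
  qed
  then show ?thesis by (intro exI[of _ k]) (simp add: D_def algebra_simps)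
qed

lemma constriction_imp_scalar_monodromy:
  assumes om: "om > 0" and con: "constriction om B A"
  shows "\<exists>l. \<forall>u v. jlin_sol om B A u v \<longrightarrow> u (2 * pi / om) = l * u 0 \<and> v (2 * pi / om) = l * v 0"
proof -
  obtain \<alpha> \<beta> \<gamma> \<delta> where M:
    "\<And>u v. jlin_sol om B A u v \<Longrightarrow> u (2 * pi / om) = \<alpha> * u 0 + \<beta> * v 0 \<and> v (2 * pi / om) = \<gamma> * u 0 + \<delta> * v 0"
    "\<And>x. \<exists>l. l \<noteq> 0 \<and> \<alpha> + \<beta> * cis x = l \<and> \<gamma> + \<delta> * cis x = l * cis (poincare om B A x)"
    using jlin_monodromy[OF om, of B A] by metis
  obtain k where k: "\<And>x. poincare om B A x = x + 2 * pi * of_int k"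
    using constriction_imp_poincare_translation[OF om con] by blast
  have "cis (poincare om B A x) = cis x" for x
    unfolding k using sin_cos_eq_iff[of "x + 2 * pi * of_int k" x] by (auto simp: complex_eq_iff)
  then have e: "\<gamma> + \<delta> * cis x = (\<alpha> + \<beta> * cis x) * cis x" for x using M(2)[of x] by auto
  \<comment> \<open>The identity is quadratic in \<open>cis x\<close>; the directions 1, -1 and
    \<open>\<i>\<close> determine all its coefficients.\<close>
  have "\<gamma> + \<delta> = \<alpha> + \<beta>" using e[of 0] by simp
  moreover have "\<gamma> - \<delta> = - \<alpha> + \<beta>" using e[of pi] by (simp add: algebra_simps)
  moreover have "\<gamma> + \<delta> * \<i> = \<alpha> * \<i> - \<beta>" using e[of "pi/2"] by (simp add: cis_pi_half algebra_simps)
  ultimately have "\<gamma> = \<beta>" "\<delta> = \<alpha>" "\<gamma> = - \<beta>"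
    by (simp_all add: complex_eq_iff)
  then have "\<beta> = 0" "\<gamma> = 0" "\<delta> = \<alpha>" by (simp_all add: complex_eq_iff)
  then show ?thesis using M(1) by (intro exI[of _ \<alpha>]) auto
qed


section \<open>Three-term recurrences\<close>


text \<open>The three-term recurrence \<open>\<mu> (y (k+1) + y (k-1)) = c k * y k\<close>, normalised so that a
  solution starting with \<open>y 0 = 0\<close> becomes a convergent sequence, polynomial in \<open>\<mu>\<close>.  The term
  \<open>\<mu>\<^sup>2 / 0 = 0\<close> for \<open>k = 0\<close> is harmless because it multiplies \<open>y 0 = 0\<close>.\<close>

fun rec_poly :: "(nat \<Rightarrow> real) \<Rightarrow> complex \<Rightarrow> nat \<Rightarrow> complex" where
  "rec_poly c \<mu> 0 = 0"
| "rec_poly c \<mu> (Suc 0) = 1"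
| "rec_poly c \<mu> (Suc (Suc k)) = of_real (c (Suc k) / real (Suc k)) * rec_poly c \<mu> (Suc k)
     - \<mu>\<^sup>2 / of_nat (Suc k * k) * rec_poly c \<mu> k"

lemma rec_poly_holomorphic: "(\<lambda>\<mu>. rec_poly c \<mu> k) holomorphic_on S"
proof -
  have "(\<lambda>\<mu>. rec_poly c \<mu> k) holomorphic_on S \<and> (\<lambda>\<mu>. rec_poly c \<mu> (Suc k)) holomorphic_on S"
  proof (induction k)
    case (Suc k)
    have "(\<lambda>\<mu>. of_real (c (Suc k) / real (Suc k)) * rec_poly c \<mu> (Suc k)
       - inverse (of_nat (Suc k * k)) * \<mu>\<^sup>2 * rec_poly c \<mu> k) holomorphic_on S"
      using Suc by (intro holomorphic_intros) auto
    then show ?case using Suc by (simp add: divide_inverse mult.commute)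
  qed simp
  then show ?thesis ..
qed

lemma rec_poly_scaling:
  assumes "\<mu> \<noteq> 0" "y 0 = 0" and rec: "\<And>k. \<mu> * (y (Suc (Suc k)) + y k) = of_real (c (Suc k)) * y (Suc k)"
  shows "y (Suc k) = y 1 * fact k / \<mu> ^ k * rec_poly c \<mu> (Suc k)"
proof -
  have step: "y (Suc (Suc k)) = of_real (c (Suc k)) * y (Suc k) / \<mu> - y k" for k
    using rec[of k] \<open>\<mu> \<noteq> 0\<close> by (simp add: field_simps eq_diff_eq)
  have "y (Suc k) = y 1 * fact k / \<mu> ^ k * rec_poly c \<mu> (Suc k) \<and>
        y (Suc (Suc k)) = y 1 * fact (Suc k) / \<mu> ^ Suc k * rec_poly c \<mu> (Suc (Suc k))"
  proof (induction k)
    case 0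
    show ?case using step[of 0] \<open>y 0 = 0\<close> by simp
  next
    case (Suc k)
    have "y (Suc (Suc (Suc k))) = of_real (c (Suc (Suc k))) * y (Suc (Suc k)) / \<mu> - y (Suc k)"
      by (rule step)
    also have "\<dots> = y 1 * fact (Suc (Suc k)) / \<mu> ^ Suc (Suc k) * rec_poly c \<mu> (Suc (Suc (Suc k)))"
    proof -
      have f: "fact (Suc (Suc k)) = (of_nat (Suc (Suc k)) * (of_nat (Suc k) * fact k) :: complex)"
        "fact (Suc k) = (of_nat (Suc k) * fact k :: complex)" by simp_all
      define P where "P = rec_poly c \<mu> (Suc k)"
      define P' where "P' = rec_poly c \<mu> (Suc (Suc k))"
      have n: "of_nat (Suc (Suc k)) \<noteq> (0::complex)" "of_nat (Suc k) \<noteq> (0::complex)"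
        by (simp_all only: of_nat_eq_0_iff)
      have r: "rec_poly c \<mu> (Suc (Suc (Suc k))) = of_real (c (Suc (Suc k))) / of_nat (Suc (Suc k)) * P'
         - \<mu>\<^sup>2 / (of_nat (Suc (Suc k)) * of_nat (Suc k)) * P"
        unfolding P_def P'_def rec_poly.simps(3)[of c \<mu> "Suc k"] of_nat_mult
        by (simp del: of_nat_Suc rec_poly.simps)
      show ?thesis
        unfolding r conjunct1[OF Suc] conjunct2[OF Suc] P_def[symmetric] P'_def[symmetric] f
        using n \<open>\<mu> \<noteq> 0\<close> by (simp add: field_simps power2_eq_square del: of_nat_Suc)
    qed
    finally show ?case using Suc by blast
  qed
  then show ?thesis ..
qed

text \<open>For \<open>\<mu> = \<i> / x\<close> the recurrence is \<open>Y (k+1) = x * c k * Y k + Y (k-1)\<close>, and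
  \<open>Y K * Y (K+1) = x * (\<Sum>k\<le>K. c k * (Y k)\<^sup>2)\<close>; as \<open>x\<close> tends to \<open>0\<close> the sum tends to the
  sum of \<open>c k\<close> over odd \<open>k\<close>, which is positive for large \<open>K\<close>.\<close>

fun rec_imag :: "(nat \<Rightarrow> real) \<Rightarrow> real \<Rightarrow> nat \<Rightarrow> real" where
  "rec_imag c x 0 = 0"
| "rec_imag c x (Suc 0) = 1"
| "rec_imag c x (Suc (Suc k)) = x * c (Suc k) * rec_imag c x (Suc k) + rec_imag c x k"

lemma rec_imag_continuous: "isCont (\<lambda>x. rec_imag c x k) x"
proof -
  have "isCont (\<lambda>x. rec_imag c x k) x \<and> isCont (\<lambda>x. rec_imag c x (Suc k)) x"
    by (induction k) (auto intro!: continuous_intros)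
  then show ?thesis ..
qed

lemma rec_imag_0: "rec_imag c 0 k = (if odd k then 1 else 0)"
proof -
  have "rec_imag c 0 k = (if odd k then 1 else 0) \<and> rec_imag c 0 (Suc k) = (if odd (Suc k) then 1 else 0)"
    by (induction k) auto
  then show ?thesis ..
qed

lemma rec_imag_product: "rec_imag c x k * rec_imag c x (Suc k) = x * (\<Sum>j\<le>k. c j * (rec_imag c x j)\<^sup>2)"
proof (induction k)
  case (Suc k)
  have "rec_imag c x (Suc k) * rec_imag c x (Suc (Suc k)) = x * (c (Suc k) * (rec_imag c x (Suc k))\<^sup>2) + rec_imag c x k * rec_imag c x (Suc k)"
    by (simp add: power2_eq_square algebra_simps)
  then show ?case unfolding Suc by (simp add: algebra_simps)
qed simp

section \<open>An entire function that vanishes where a solution grows only geometrically\<close>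

text \<open>\<open>q\<close> will be minus the square of \<open>kap om\<close>, and \<open>c\<close>
  arises when one of the two coefficient sequences of a power series solution is eliminated. For
  \<open>k \<le> l\<close> the value \<open>c k\<close> may be zero or negative, so weights and
  estimates start after \<open>l\<close>.\<close>

context
  fixes l :: nat and q :: real and c :: "nat \<Rightarrow> real"
  assumes q: "q > 0"
    and c_def: "\<And>k. c k = real k - real l + q / real k"
begin

lemma c_pos: "k > l \<Longrightarrow> c k > 0"
  using q by (simp add: c_def add_pos_nonneg)

lemma c_ge: "k > l \<Longrightarrow> c k / real k \<ge> 1 / (real l + 1)"
proof -
  assume k: "k > l"
  have "real k * (real l + 1) \<ge> 0" by simp
  have "real l * (real k - real l - 1) \<ge> 0" using k by (intro mult_nonneg_nonneg) auto
  then have "real k \<le> (real k - real l) * (real l + 1)" by (simp add: algebra_simps)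
  also have "\<dots> \<le> c k * (real l + 1)" using q by (intro mult_right_mono) (auto simp: c_def)
  finally show ?thesis using k by (simp add: field_simps)
qed

text \<open>Chosen so that in the rescaled recurrence the preceding term gets coefficient 1; the
  solution then changes only by a summable multiple of the term before that.\<close>

definition rec_weight :: "nat \<Rightarrow> real" where "rec_weight k = (\<Prod>j\<in>{l<..<k}. real j / c j)"

lemma rec_weight_Suc: "k > l \<Longrightarrow> rec_weight (Suc k) = rec_weight k * (real k / c k)"
proof -
  assume "k > l"
  then have "{l<..<Suc k} = insert k {l<..<k}" by auto
  then show ?thesis by (simp add: rec_weight_def mult.commute)
qed

lemma rec_weight_pos: "rec_weight k > 0"
  unfolding rec_weight_def using c_pos by (intro prod_pos) auto

lemma rec_weight_le: "rec_weight k \<le> (real l + 1) ^ k"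
proof (induction k)
  case (Suc k)
  show ?case
  proof (cases "k > l")
    case True
    have "real k / c k \<le> real l + 1" using c_ge[OF True] c_pos[OF True] True by (simp add: field_simps)
    then have "rec_weight k * (real k / c k) \<le> (real l + 1) ^ k * (real l + 1)"
      using Suc rec_weight_pos[of k] c_pos[OF True] by (intro mult_mono) (auto simp: less_imp_le)
    then show ?thesis by (simp add: rec_weight_Suc[OF True] mult.commute)
  next
    case False
    then have "{l<..<Suc k} = {}" by auto
    then have "rec_weight (Suc k) = 1" by (simp add: rec_weight_def)
    then show ?thesis using one_le_power[of "real l + 1" "Suc k"] by simp
  qed
qed (simp add: rec_weight_def)

definition rec_scaled :: "complex \<Rightarrow> nat \<Rightarrow> complex" where
  "rec_scaled \<mu> k = of_real (rec_weight k) * rec_poly c \<mu> k"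

definition rec_coef :: "nat \<Rightarrow> real" where
  "rec_coef k = rec_weight (Suc (Suc k)) / (rec_weight k * (real (Suc k) * real k))"

lemma rec_scaled_step: "k > l \<Longrightarrow> rec_scaled \<mu> (Suc (Suc k)) = rec_scaled \<mu> (Suc k) - \<mu>\<^sup>2 * of_real (rec_coef k) * rec_scaled \<mu> k"
proof -
  assume k: "k > l"
  have 1: "rec_weight (Suc (Suc k)) * (c (Suc k) / real (Suc k)) = rec_weight (Suc k)"
    using rec_weight_Suc[of "Suc k"] c_pos[of "Suc k"] k by simp
  have "rec_scaled \<mu> (Suc (Suc k)) = of_real (rec_weight (Suc (Suc k)) * (c (Suc k) / real (Suc k))) * rec_poly c \<mu> (Suc k)
      - of_real (rec_weight (Suc (Suc k))) * (\<mu>\<^sup>2 / of_nat (Suc k * k)) * rec_poly c \<mu> k"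
    unfolding rec_scaled_def rec_poly.simps of_real_mult by (simp only: right_diff_distrib mult.assoc)
  also have "of_real (rec_weight (Suc (Suc k))) * (\<mu>\<^sup>2 / of_nat (Suc k * k)) * rec_poly c \<mu> k = \<mu>\<^sup>2 * of_real (rec_coef k) * rec_scaled \<mu> k"
  proof -
    have "rec_weight (Suc (Suc k)) / real (Suc k * k) = rec_coef k * rec_weight k"
      unfolding of_nat_mult using rec_weight_pos[of k] by (simp add: rec_coef_def)
    then have eq: "complex_of_real (rec_weight (Suc (Suc k))) / of_nat (Suc k * k) = of_real (rec_coef k) * of_real (rec_weight k)"
      by (metis of_real_divide of_real_mult of_real_of_nat_eq)
    have "complex_of_real (rec_weight (Suc (Suc k))) * (\<mu>\<^sup>2 / of_nat (Suc k * k)) * rec_poly c \<mu> k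
      = complex_of_real (rec_weight (Suc (Suc k))) / of_nat (Suc k * k) * (\<mu>\<^sup>2 * rec_poly c \<mu> k)"
      by simp
    then show ?thesis unfolding eq rec_scaled_def by (simp only: mult_ac)
  qed
  finally show ?thesis unfolding 1 by (simp only: rec_scaled_def)
qed

text \<open>Two weight ratios cost at most \<open>l + 1\<close> each, and
  \<open>1 / (k * (k + 1))\<close> telescopes.\<close>

lemma rec_coef_bound: "k > l \<Longrightarrow> 0 < rec_coef k \<and> rec_coef k \<le> (real l + 1)\<^sup>2 * (1 / real k - 1 / real (Suc k))"
proof -
  assume k: "k > l"
  have le: "real j / c j \<le> real l + 1" if "j > l" for j
    using c_ge[OF that] c_pos[OF that] that by (simp add: field_simps)
  have pos: "real j / c j \<ge> 0" if "j > l" for j using c_pos[OF that] by simp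
  have "rec_weight (Suc (Suc k)) / rec_weight k = (real k / c k) * (real (Suc k) / c (Suc k))"
    using rec_weight_Suc[of "Suc k"] rec_weight_Suc[OF k] k rec_weight_pos[of k] by simp
  also have "\<dots> \<le> (real l + 1) * (real l + 1)"
    using le[OF k] le[of "Suc k"] pos[OF k] pos[of "Suc k"] k by (intro mult_mono) auto
  finally have "rec_weight (Suc (Suc k)) / rec_weight k \<le> (real l + 1)\<^sup>2" by (simp add: power2_eq_square)
  then have "rec_weight (Suc (Suc k)) / rec_weight k / (real (Suc k) * real k) \<le> (real l + 1)\<^sup>2 / (real (Suc k) * real k)"
    by (rule divide_right_mono) simp
  moreover have "1 / (real (Suc k) * real k) = 1 / real k - 1 / real (Suc k)"
    using k by (simp add: field_simps)
  ultimately have "rec_coef k \<le> (real l + 1)\<^sup>2 * (1 / real k - 1 / real (Suc k))"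
    unfolding rec_coef_def by (metis (no_types, lifting) divide_divide_eq_left mult.right_neutral times_divide_eq_right)
  moreover have "0 < rec_coef k" unfolding rec_coef_def using rec_weight_pos k by simp
  ultimately show ?thesis by blast
qed

text \<open>A discrete Gronwall estimate: the increments telescope to exponents
  \<open>C * (1 - 1 / k)\<close>, all below \<open>C\<close>. Two neighbouring terms are bounded
  together because the recurrence has order two.\<close>

lemma rec_scaled_bound:
  assumes "cmod \<mu> \<le> R" "cmod (rec_scaled \<mu> (Suc l)) \<le> T" "cmod (rec_scaled \<mu> (Suc (Suc l))) \<le> T" and k: "k > l"
  defines "C \<equiv> R\<^sup>2 * (real l + 1)\<^sup>2"
  shows "cmod (rec_scaled \<mu> k) \<le> T * exp C" (is ?a)
    "cmod (rec_scaled \<mu> (Suc (Suc k)) - rec_scaled \<mu> (Suc k)) \<le> C * (T * exp C) * (1 / real k - 1 / real (Suc k))" (is ?b)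
proof -
  have R: "R \<ge> 0" using assms(1) norm_ge_zero order_trans by blast
  have T: "T \<ge> 0" using assms(2) norm_ge_zero order_trans by blast
  have C: "C \<ge> 0" by (simp add: C_def)
  have step: "cmod (rec_scaled \<mu> (Suc (Suc k)) - rec_scaled \<mu> (Suc k)) \<le> C * (1 / real k - 1 / real (Suc k)) * cmod (rec_scaled \<mu> k)"
    if "k > l" for k
  proof -
    have "cmod (rec_scaled \<mu> (Suc (Suc k)) - rec_scaled \<mu> (Suc k)) = (cmod \<mu>)\<^sup>2 * rec_coef k * cmod (rec_scaled \<mu> k)"
      using rec_coef_bound[OF that] by (simp add: rec_scaled_step[OF that] norm_mult norm_power)
    also have "\<dots> \<le> R\<^sup>2 * ((real l + 1)\<^sup>2 * (1 / real k - 1 / real (Suc k))) * cmod (rec_scaled \<mu> k)"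
      using rec_coef_bound[OF that] assms(1) R by (intro mult_right_mono mult_mono power_mono) auto
    finally show ?thesis by (simp add: C_def mult.assoc)
  qed
  have B: "cmod (rec_scaled \<mu> k) \<le> T * exp (C * (1 - 1 / real k)) \<and> cmod (rec_scaled \<mu> (Suc k)) \<le> T * exp (C * (1 - 1 / real k))"
    if "Suc l \<le> k" for k
    using that
  proof (induction k rule: nat_induct_at_least)
    case base
    have "1 \<le> exp (C * (1 - 1 / real (Suc l)))" using C by simp
    then have "T \<le> T * exp (C * (1 - 1 / real (Suc l)))" using T mult_left_mono[of 1 _ T] by simp
    then show ?case using assms(2,3) by linarith
  next
    case (Suc k)
    then have kl: "k > l" by simp
    define e where "e = C * (1 / real k - 1 / real (Suc k))"
    have e0: "e \<ge> 0" unfolding e_def using C kl by (intro mult_nonneg_nonneg) (auto simp: field_simps)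
    have ee: "C * (1 - 1 / real k) + e = C * (1 - 1 / real (Suc k))" by (simp add: e_def algebra_simps)
    have "cmod (rec_scaled \<mu> (Suc (Suc k))) \<le> cmod (rec_scaled \<mu> (Suc k)) + cmod (rec_scaled \<mu> (Suc (Suc k)) - rec_scaled \<mu> (Suc k))"
      using norm_triangle_ineq[of "rec_scaled \<mu> (Suc k)" "rec_scaled \<mu> (Suc (Suc k)) - rec_scaled \<mu> (Suc k)"] by simp
    also have "\<dots> \<le> T * exp (C * (1 - 1 / real k)) + e * (T * exp (C * (1 - 1 / real k)))"
      using step[OF kl] Suc e0 unfolding e_def[symmetric]
      by (intro add_mono) (auto intro: order_trans[OF _ mult_left_mono])
    also have "\<dots> = T * exp (C * (1 - 1 / real k)) * (1 + e)" by (simp add: algebra_simps)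
    also have "\<dots> \<le> T * exp (C * (1 - 1 / real k)) * exp e"
      using T by (intro mult_left_mono exp_ge_add_one_self) auto
    also have "\<dots> = T * exp (C * (1 - 1 / real (Suc k)))"
      unfolding mult.assoc exp_add[symmetric] ee ..
    finally have "cmod (rec_scaled \<mu> (Suc (Suc k))) \<le> T * exp (C * (1 - 1 / real (Suc k)))" .
    moreover have "T * exp (C * (1 - 1 / real k)) \<le> T * exp (C * (1 - 1 / real (Suc k)))"
      unfolding ee[symmetric] using T e0 by (intro mult_left_mono) auto
    ultimately show ?case using Suc by linarith
  qed
  have a: "cmod (rec_scaled \<mu> k) \<le> T * exp C" if "k > l" for k
  proof -
    have "C * (1 - 1 / real k) \<le> C * 1" using C by (intro mult_left_mono) auto
    then have "T * exp (C * (1 - 1 / real k)) \<le> T * exp C" using T by (intro mult_left_mono) auto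
    then show ?thesis using B[of k] that by (simp add: Suc_le_eq)
  qed
  show ?a by (rule a[OF k])
  have "C * (1 / real k - 1 / real (Suc k)) * cmod (rec_scaled \<mu> k) \<le> C * (1 / real k - 1 / real (Suc k)) * (T * exp C)"
    using C k by (intro mult_left_mono a mult_nonneg_nonneg) (auto simp: field_simps)
  then show ?b using step[OF k] by (simp add: mult_ac)
qed

text \<open>The leading coefficient of the factorially growing behaviour of the solution with
  \<open>y 0 = 0\<close>. Written as a series of increments, it converges uniformly on discs by the
  Weierstrass test.\<close>

definition rec_limit :: "complex \<Rightarrow> complex" where
  "rec_limit \<mu> = rec_scaled \<mu> (Suc (Suc l)) + (\<Sum>n. rec_scaled \<mu> (n + l + 3) - rec_scaled \<mu> (n + l + 2))"

lemma rec_limit_uniform: "uniform_limit (cball 0 R) (\<lambda>n \<mu>. rec_scaled \<mu> (n + l + 2)) rec_limit sequentially"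
proof -
  have "bounded ((\<lambda>\<mu>. rec_scaled \<mu> k) ` cball 0 R)" for k
    unfolding rec_scaled_def
    by (intro compact_imp_bounded compact_continuous_image holomorphic_on_imp_continuous_on holomorphic_intros rec_poly_holomorphic) simp
  then obtain T1 T2 where T12: "\<forall>x \<in> (\<lambda>\<mu>. rec_scaled \<mu> (Suc l)) ` cball 0 R. cmod x \<le> T1"
    "\<forall>x \<in> (\<lambda>\<mu>. rec_scaled \<mu> (Suc (Suc l))) ` cball 0 R. cmod x \<le> T2"
    unfolding bounded_iff by meson
  define T where "T = max T1 T2"
  define C where "C = R\<^sup>2 * (real l + 1)\<^sup>2"
  have b: "cmod (rec_scaled \<mu> (n + l + 3) - rec_scaled \<mu> (n + l + 2)) \<le> C * (T * exp C) * (1 / real (n + l + 1) - 1 / real (Suc (n + l + 1)))"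
    if "\<mu> \<in> cball 0 R" for n \<mu>
    using rec_scaled_bound(2)[of \<mu> R T "n + l + 1"] that T12
    by (simp add: C_def T_def eval_nat_numeral image_iff le_max_iff_disj)
  have part: "rec_scaled \<mu> (n + l + 2) = rec_scaled \<mu> (Suc (Suc l)) + (\<Sum>k<n. rec_scaled \<mu> (k + l + 3) - rec_scaled \<mu> (k + l + 2))" for \<mu> n
    by (induction n) (auto simp: eval_nat_numeral)
  have "uniform_limit (cball 0 R) (\<lambda>n \<mu>. \<Sum>k<n. rec_scaled \<mu> (k + l + 3) - rec_scaled \<mu> (k + l + 2))
     (\<lambda>\<mu>. \<Sum>n. rec_scaled \<mu> (n + l + 3) - rec_scaled \<mu> (n + l + 2)) sequentially"
  proof (rule Weierstrass_m_test[OF b])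
    have "(\<lambda>n. 1 / real (n + l + 1)) \<longlonglongrightarrow> 0"
      using LIMSEQ_ignore_initial_segment[OF lim_const_over_n[of 1], of "l + 1"] by (simp add: add.assoc)
    from telescope_summable'[OF this]
    show "summable (\<lambda>n. C * (T * exp C) * (1 / real (n + l + 1) - 1 / real (Suc (n + l + 1))))"
      by (intro summable_mult) simp
  qed
  then have "uniform_limit (cball 0 R) (\<lambda>n \<mu>. rec_scaled \<mu> (Suc (Suc l)) + (\<Sum>k<n. rec_scaled \<mu> (k + l + 3) - rec_scaled \<mu> (k + l + 2)))
     (\<lambda>\<mu>. rec_scaled \<mu> (Suc (Suc l)) + (\<Sum>n. rec_scaled \<mu> (n + l + 3) - rec_scaled \<mu> (n + l + 2))) sequentially"
    by (intro uniform_limit_intros)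
  then show ?thesis unfolding rec_limit_def part[symmetric] .
qed

lemma rec_limit_holomorphic: "rec_limit holomorphic_on UNIV"
proof (rule holomorphic_uniform_sequence[where f = "\<lambda>n \<mu>. rec_scaled \<mu> (n + l + 2)"])
  fix x :: complex
  have "cball x 1 \<subseteq> cball 0 (cmod x + 1)"
  proof
    fix y assume "y \<in> cball x 1"
    then show "y \<in> cball 0 (cmod x + 1)" using norm_triangle_sub[of y x] by (simp add: dist_norm norm_minus_commute)
  qed
  then show "\<exists>d>0. cball x d \<subseteq> UNIV \<and> uniform_limit (cball x d) (\<lambda>n \<mu>. rec_scaled \<mu> (n + l + 2)) rec_limit sequentially"
    using uniform_limit_on_subset[OF rec_limit_uniform] by (intro exI[of _ 1]) auto
qed (auto simp: rec_scaled_def intro!: holomorphic_intros rec_poly_holomorphic)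

lemma rec_limit_lim: "(\<lambda>n. rec_scaled \<mu> (n + l + 2)) \<longlonglongrightarrow> rec_limit \<mu>"
  by (rule tendsto_uniform_limitI[OF rec_limit_uniform[of "cmod \<mu>"]]) simp

text \<open>Up to geometric factors the rescaling divides the \<open>k\<close>-th term by a
  factorial, so geometric growth is flattened to 0.\<close>

lemma rec_limit_zero_of_bounded_solution:
  assumes "\<mu> \<noteq> 0" "y 0 = 0" "y 1 \<noteq> 0"
    and rec: "\<And>k. \<mu> * (y (Suc (Suc k)) + y k) = of_real (c (Suc k)) * y (Suc k)"
    and bd: "\<And>k. cmod (y k) \<le> M * R ^ k"
  shows "rec_limit \<mu> = 0"
proof -
  define a where "a = cmod \<mu> * (real l + 1) * R"
  have le: "cmod (rec_scaled \<mu> (Suc k)) \<le> M * (real l + 1) * R / cmod (y 1) * (a ^ k / fact k)" for k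
  proof -
    have "rec_scaled \<mu> (Suc k) = of_real (rec_weight (Suc k)) * (y (Suc k) * \<mu> ^ k / (y 1 * fact k))"
      using rec_poly_scaling[of \<mu> y c k, OF assms(1,2) rec] assms(1,3) by (simp add: rec_scaled_def)
    then have "cmod (rec_scaled \<mu> (Suc k)) = rec_weight (Suc k) * (cmod (y (Suc k)) * cmod \<mu> ^ k / (cmod (y 1) * fact k))"
      using rec_weight_pos[of "Suc k"] by (simp add: norm_mult norm_divide norm_power)
    also have "\<dots> \<le> (real l + 1) ^ Suc k * (M * R ^ Suc k * cmod \<mu> ^ k / (cmod (y 1) * fact k))"
      using rec_weight_le[of "Suc k"] bd[of "Suc k"] by (intro mult_mono divide_right_mono mult_right_mono) auto
    also have "\<dots> = M * (real l + 1) * R / cmod (y 1) * (a ^ k / fact k)"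
      unfolding a_def power_mult_distrib power_Suc by (simp add: mult_ac divide_inverse)
    finally show ?thesis .
  qed
  have "(\<lambda>k. a ^ k / fact k) \<longlonglongrightarrow> 0"
    using summable_LIMSEQ_zero[OF summable_exp[of a]] by (simp add: field_simps)
  then have "(\<lambda>k. M * (real l + 1) * R / cmod (y 1) * (a ^ k / fact k)) \<longlonglongrightarrow> 0"
    by (rule tendsto_mult_right_zero)
  then have "(\<lambda>k. rec_scaled \<mu> (Suc k)) \<longlonglongrightarrow> 0"
    by (rule Lim_null_comparison[rotated]) (use le in auto)
  from LIMSEQ_ignore_initial_segment[OF this, of "l + 1"]
  have "(\<lambda>n. rec_scaled \<mu> (n + l + 2)) \<longlonglongrightarrow> 0" by (simp add: add.assoc)
  then show ?thesis using rec_limit_lim LIMSEQ_unique by blast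
qed

text \<open>The odd numbers up to \<open>2 * n + 1\<close> sum to \<open>(n + 1)^2\<close>, which at
  \<open>n = l\<close> exceeds \<open>l\<close> subtracted \<open>n + 1\<close> times; of the terms
  \<open>q / j\<close> only the one for \<open>j = 1\<close> is kept.\<close>

lemma sum_odd_c_pos: "(\<Sum>j\<le>Suc (2 * l). c j * (rec_imag c 0 j)\<^sup>2) > 0"
proof -
  have ge: "(\<Sum>j\<le>Suc (2 * n). c j * (rec_imag c 0 j)\<^sup>2) \<ge> (real n + 1) * (real n + 1 - real l) + q" for n
  proof (induction n)
    case 0
    show ?case by (simp add: rec_imag_0 c_def[of "Suc 0"])
  next
    case (Suc n)
    have "(\<Sum>j\<le>Suc (2 * Suc n). c j * (rec_imag c 0 j)\<^sup>2) = (\<Sum>j\<le>Suc (2 * n). c j * (rec_imag c 0 j)\<^sup>2) + c (2 * n + 3)"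
    proof -
      have "Suc (2 * Suc n) = Suc (Suc (Suc (2 * n)))" by simp
      then show ?thesis unfolding sum.atMost_Suc by (simp add: rec_imag_0 numeral_3_eq_3)
    qed
    moreover have "c (2 * n + 3) \<ge> 2 * real n + 3 - real l" using q by (simp add: c_def[of "2 * n + 3"])
    ultimately show ?case using Suc by (simp add: algebra_simps)
  qed
  show ?thesis by (rule less_le_trans[OF _ ge[of l]]) (use q in \<open>simp add: add_pos_pos\<close>)
qed

lemma rec_poly_imag:
  assumes "x > 0"
  shows "rec_poly c (\<i> / of_real x) (Suc k) = of_real (rec_imag c x (Suc k) / (x ^ k * fact k))"
proof -
  have "rec_poly c (\<i> / of_real x) (Suc k) = of_real (rec_imag c x (Suc k) / (x ^ k * fact k)) \<and>
    rec_poly c (\<i> / of_real x) (Suc (Suc k)) = of_real (rec_imag c x (Suc (Suc k)) / (x ^ Suc k * fact (Suc k)))"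
  proof (induction k)
    case 0
    show ?case using assms by simp
  next
    case (Suc k)
    have "rec_poly c (\<i> / of_real x) (Suc (Suc (Suc k))) =
       of_real (c (Suc (Suc k)) / real (Suc (Suc k))) * of_real (rec_imag c x (Suc (Suc k)) / (x ^ Suc k * fact (Suc k)))
       - (\<i> / of_real x)\<^sup>2 / of_nat (Suc (Suc k) * Suc k) * of_real (rec_imag c x (Suc k) / (x ^ k * fact k))"
      unfolding rec_poly.simps(3)[of c _ "Suc k"] conjunct1[OF Suc] conjunct2[OF Suc] ..
    also have "(\<i> / of_real x)\<^sup>2 = of_real (- (1 / x\<^sup>2))" by (simp add: power_divide)
    also have "of_real (c (Suc (Suc k)) / real (Suc (Suc k))) * of_real (rec_imag c x (Suc (Suc k)) / (x ^ Suc k * fact (Suc k)))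
       - of_real (- (1 / x\<^sup>2)) / of_nat (Suc (Suc k) * Suc k) * of_real (rec_imag c x (Suc k) / (x ^ k * fact k))
       = complex_of_real ((c (Suc (Suc k)) / real (Suc (Suc k))) * (rec_imag c x (Suc (Suc k)) / (x ^ Suc k * fact (Suc k)))
       + (1 / x\<^sup>2) / real (Suc (Suc k) * Suc k) * (rec_imag c x (Suc k) / (x ^ k * fact k)))"
      by (simp del: of_nat_Suc of_nat_mult fact_Suc)
    also have "(c (Suc (Suc k)) / real (Suc (Suc k))) * (rec_imag c x (Suc (Suc k)) / (x ^ Suc k * fact (Suc k)))
       + (1 / x\<^sup>2) / real (Suc (Suc k) * Suc k) * (rec_imag c x (Suc k) / (x ^ k * fact k))
       = rec_imag c x (Suc (Suc (Suc k))) / (x ^ Suc (Suc k) * fact (Suc (Suc k)))"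
    proof -
      define a where "a = real (Suc k)"
      define b where "b = real (Suc (Suc k))"
      have ab: "a > 0" "b > 0" by (auto simp: a_def b_def)
      have f: "fact (Suc k) = a * fact k" "fact (Suc (Suc k)) = b * (a * fact k)" "real (Suc (Suc k) * Suc k) = b * a"
        by (simp_all add: a_def b_def algebra_simps)
      have y: "rec_imag c x (Suc (Suc (Suc k))) = x * c (Suc (Suc k)) * rec_imag c x (Suc (Suc k)) + rec_imag c x (Suc k)" by simp
      show ?thesis unfolding y f b_def[symmetric] using ab assms by (simp add: field_simps power2_eq_square)
    qed
    finally show ?case using Suc by blast
  qed
  then show ?thesis ..
qed

text \<open>On the imaginary axis \<open>\<mu>^2\<close> is negative: once two consecutive terms
  beyond \<open>l\<close> have the same sign all later ones do, and the rescaled sequence moves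
  monotonically away from 0.\<close>

lemma rec_limit_nonzero: "\<exists>\<mu>. rec_limit \<mu> \<noteq> 0"
proof -
  let ?S = "\<lambda>x. \<Sum>j\<le>Suc (2 * l). c j * (rec_imag c x j)\<^sup>2"
  \<comment> \<open>Serves twice: the weighted sum up to \<open>K\<close> is positive for small
    \<open>x\<close>, and \<open>c\<close> is positive beyond \<open>K\<close>.\<close>
  define K where "K = Suc (2 * l)"
  have "isCont ?S 0" by (intro continuous_intros rec_imag_continuous)
  then have "(?S \<longlongrightarrow> ?S 0) (at_right 0)"
    unfolding isCont_def by (rule filterlim_mono) (auto simp: at_le)
  then have "\<forall>\<^sub>F x in at_right 0. ?S x > 0" using sum_odd_c_pos by (rule order_tendstoD)
  moreover have "\<forall>\<^sub>F x::real in at_right 0. x > 0" by (rule eventually_at_right_less)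
  ultimately have "\<forall>\<^sub>F x in at_right 0. ?S x > 0 \<and> x > 0" by eventually_elim auto
  then obtain x where x: "?S x > 0" "x > 0"
    using eventually_happens'[OF trivial_limit_at_right_real] by blast
  \<comment> \<open>Only the product of two neighbours is known to be positive; multiplying by
    \<open>s\<close> makes both of them positive.\<close>
  define s where "s = sgn (rec_imag c x K)"
  have "rec_imag c x K * rec_imag c x (Suc K) > 0" unfolding rec_imag_product K_def using x by simp
  then have s: "s * rec_imag c x K > 0" "s * rec_imag c x (Suc K) > 0"
    by (auto simp: s_def sgn_if zero_less_mult_iff split: if_splits)
  have spos: "s * rec_imag c x k > 0 \<and> s * rec_imag c x (Suc k) > 0" if "k \<ge> K" for k
    using that
  proof (induction k rule: nat_induct_at_least)
    case base then show ?case using s by simp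
  next
    case (Suc k)
    then have "c (Suc k) > 0" by (intro c_pos) (simp add: K_def)
    then have "x * c (Suc k) * (s * rec_imag c x (Suc k)) + s * rec_imag c x k > 0"
      using Suc x(2) by (intro add_pos_pos mult_pos_pos[OF mult_pos_pos[OF x(2)]]) auto
    then show ?case using Suc by (simp add: algebra_simps)
  qed
  define u where "u k = s * (rec_weight (Suc k) * (rec_imag c x (Suc k) / (x ^ k * fact k)))" for k
  let ?\<mu> = "\<i> / of_real x"
  have tu: "of_real s * rec_scaled ?\<mu> (Suc k) = of_real (u k)" for k
    unfolding rec_scaled_def rec_poly_imag[OF x(2)] u_def of_real_mult ..
  have upos: "u k > 0" if "k \<ge> K" for k
  proof -
    have "rec_weight (Suc k) / (x ^ k * fact k) * (s * rec_imag c x (Suc k)) > 0"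
      using spos[OF that] rec_weight_pos x(2)
      by (intro mult_pos_pos[OF divide_pos_pos, OF rec_weight_pos _ conjunct2[OF spos[OF that]]]) simp
    then show ?thesis by (simp add: u_def mult_ac)
  qed
  have mono: "u (Suc k) \<le> u (Suc (Suc k))" if "k \<ge> K" for k
  proof -
    have k: "Suc k > l" using that by (simp add: K_def)
    have "rec_scaled ?\<mu> (Suc (Suc (Suc k))) = rec_scaled ?\<mu> (Suc (Suc k)) + of_real (1 / x\<^sup>2 * rec_coef (Suc k)) * rec_scaled ?\<mu> (Suc k)"
      unfolding rec_scaled_step[OF k] by (simp add: power_divide)
    then have "of_real s * rec_scaled ?\<mu> (Suc (Suc (Suc k))) = of_real s * rec_scaled ?\<mu> (Suc (Suc k)) + of_real (1 / x\<^sup>2 * rec_coef (Suc k)) * (of_real s * rec_scaled ?\<mu> (Suc k))"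
      by (simp only: distrib_left mult.left_commute)
    then have "of_real (u (Suc (Suc k))) = complex_of_real (u (Suc k) + 1 / x\<^sup>2 * rec_coef (Suc k) * u k)"
      unfolding tu by simp
    then have "u (Suc (Suc k)) = u (Suc k) + 1 / x\<^sup>2 * rec_coef (Suc k) * u k" by (simp only: of_real_eq_iff)
    moreover have "1 / x\<^sup>2 * rec_coef (Suc k) * u k \<ge> 0"
      using rec_coef_bound[OF k] upos[OF that] x by (intro mult_nonneg_nonneg) auto
    ultimately show ?thesis by simp
  qed
  have ge: "u k \<ge> u (Suc K)" if "k \<ge> Suc K" for k
    using that
  proof (induction k rule: nat_induct_at_least)
    case (Suc k)
    then obtain j where "k = Suc j" "j \<ge> K" by (cases k) auto
    then show ?case using mono[of j] Suc by simp
  qed simp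
  have "(\<lambda>n. Re (of_real s * rec_scaled ?\<mu> (n + l + 2))) \<longlonglongrightarrow> Re (of_real s * rec_limit ?\<mu>)"
    by (intro tendsto_intros rec_limit_lim)
  then have "Re (of_real s * rec_limit ?\<mu>) \<ge> u (Suc K)"
  proof (rule LIMSEQ_le_const)
    show "\<exists>N. \<forall>n\<ge>N. u (Suc K) \<le> Re (of_real s * rec_scaled ?\<mu> (n + l + 2))"
    proof (intro exI allI impI)
      fix n assume "n \<ge> Suc K"
      then have "u (Suc K) \<le> u (n + l + 1)" by (intro ge) simp
      moreover have "Re (of_real s * rec_scaled ?\<mu> (n + l + 2)) = u (n + l + 1)"
        using tu[of "n + l + 1"] by simp
      ultimately show "u (Suc K) \<le> Re (of_real s * rec_scaled ?\<mu> (n + l + 2))" by simp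
    qed
  qed
  then have "rec_limit ?\<mu> \<noteq> 0" using upos[of "Suc K"] by auto
  then show ?thesis ..
qed

end

lemma recurrence_characteristic_function:
  assumes "q > 0"
  obtains D where "D holomorphic_on UNIV" "\<exists>\<mu>. D \<mu> \<noteq> 0"
    "\<And>\<mu> y M R. \<mu> \<noteq> 0 \<Longrightarrow> y 0 = 0 \<Longrightarrow> y 1 \<noteq> 0 \<Longrightarrow>
       (\<And>k. \<mu> * (y (Suc (Suc k)) + y k) = of_real (real (Suc k) - real l + q / real (Suc k)) * y (Suc k)) \<Longrightarrow>
       (\<And>k. cmod (y k) \<le> M * R ^ k) \<Longrightarrow> D \<mu> = 0"
proof (rule that)
  let ?c = "\<lambda>k. real k - real l + q / real k"
  note ax = assms refl[of "?c _"]
  show "rec_limit l ?c holomorphic_on UNIV" by (rule rec_limit_holomorphic[OF ax])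
  show "\<exists>\<mu>. rec_limit l ?c \<mu> \<noteq> 0" by (rule rec_limit_nonzero[OF ax])
  show "rec_limit l ?c \<mu> = 0" if "\<mu> \<noteq> 0" "y 0 = 0" "y 1 \<noteq> 0"
       "\<And>k. \<mu> * (y (Suc (Suc k)) + y k) = of_real (real (Suc k) - real l + q / real (Suc k)) * y (Suc k)"
       "\<And>k. cmod (y k) \<le> M * R ^ k" for \<mu> y M R
    by (rule rec_limit_zero_of_bounded_solution[OF ax that])
qed


text \<open>The parameter is the supremum of those for which the solution stays positive.  There it
  is still positive, but can no longer grow, hence decays superexponentially.\<close>

fun rec_real :: "(nat \<Rightarrow> real) \<Rightarrow> real \<Rightarrow> nat \<Rightarrow> real" where
  "rec_real c \<mu> 0 = 0"
| "rec_real c \<mu> (Suc 0) = 1"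
| "rec_real c \<mu> (Suc (Suc k)) = c (Suc k) / \<mu> * rec_real c \<mu> (Suc k) - rec_real c \<mu> k"

lemma rec_real_continuous: "\<mu> \<noteq> 0 \<Longrightarrow> isCont (\<lambda>\<mu>. rec_real c \<mu> k) \<mu>"
proof -
  assume "\<mu> \<noteq> 0"
  then have "isCont (\<lambda>\<mu>. rec_real c \<mu> k) \<mu> \<and> isCont (\<lambda>\<mu>. rec_real c \<mu> (Suc k)) \<mu>"
    by (induction k) (auto intro!: continuous_intros)
  then show ?thesis ..
qed

text \<open>With \<open>c (Suc k) / \<mu> \<ge> 2\<close> the sequence is convex, so a positive
  increment never shrinks.\<close>

lemma rec_real_growing:
  assumes \<mu>: "\<mu> > 0" and c: "\<And>k. k \<ge> K \<Longrightarrow> c (Suc k) \<ge> 2 * \<mu>"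
    and init: "0 \<le> rec_real c \<mu> K" "rec_real c \<mu> K < rec_real c \<mu> (Suc K)" and k: "k \<ge> K"
  shows "0 \<le> rec_real c \<mu> k \<and> rec_real c \<mu> k < rec_real c \<mu> (Suc k)"
  using k
proof (induction k rule: nat_induct_at_least)
  case base
  then show ?case using init by simp
next
  case (Suc k)
  let ?w = "rec_real c \<mu>"
  have "c (Suc k) / \<mu> \<ge> 2" using c[of k] Suc \<mu> by (simp add: field_simps)
  then have "c (Suc k) / \<mu> * ?w (Suc k) \<ge> 2 * ?w (Suc k)"
    using Suc by (intro mult_right_mono) auto
  then show ?case using Suc by simp
qed

lemma exists_positive_minimal_solution:
  assumes c: "\<And>k. k \<ge> 1 \<Longrightarrow> c k \<ge> real k"
  obtains \<mu> w where "\<mu> > 0" "w 0 = 0" "w 1 = 1"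
    "\<And>k. \<mu> * (w (Suc (Suc k)) + w k) = c (Suc k) * w (Suc k)"
    "\<And>k. k \<ge> 1 \<Longrightarrow> w k > (0::real)" "\<And>R. summable (\<lambda>k. w k * R ^ k)"
proof -
  define G where "G = {\<mu>. \<mu> > 0 \<and> (\<forall>k\<ge>1. rec_real c \<mu> k > 0)}"
  \<comment> \<open>Here \<open>2 * \<mu> = 1\<close>, so \<open>c k \<ge> k\<close> lets the growth
    lemma start at index 0.\<close>
  have half: "1 / 2 \<in> G"
  proof -
    have g: "0 \<le> rec_real c (1/2) k \<and> rec_real c (1/2) k < rec_real c (1/2) (Suc k)" for k
      by (rule rec_real_growing[of "1/2" 0]) (use order_trans[OF _ c] in auto)
    have "rec_real c (1/2) k > 0" if "k \<ge> 1" for k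
      using g[of "k - 1"] that by (cases k) auto
    then show ?thesis by (simp add: G_def)
  qed
  \<comment> \<open>Positivity of the term with index 3 alone already forces
    \<open>\<mu> * \<mu> < c 1 * c 2\<close>.\<close>
  have bdd: "\<mu> \<le> c 1 * c 2 + 1" if "\<mu> \<in> G" for \<mu>
  proof (rule ccontr)
    assume "\<not> ?thesis"
    then have m: "\<mu> > c 1 * c 2 + 1" by simp
    have c12: "c 1 \<ge> 1" "c 2 \<ge> 2" using c[of 1] c[of 2] by auto
    then have cc: "c 1 * c 2 \<ge> 0" by simp
    then have m1: "\<mu> > 1" using m by simp
    have "rec_real c \<mu> 3 > 0" using that by (simp add: G_def)
    then have "c 2 / \<mu> * (c 1 / \<mu>) > 1" by (simp add: numeral_3_eq_3 numeral_2_eq_2)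
    then have "c 1 * c 2 > \<mu> * \<mu>" using m1 by (simp add: field_simps)
    moreover have "\<mu> * \<mu> \<ge> \<mu>" using m1 by simp
    ultimately show False using m by simp
  qed
  have bddG: "bdd_above G" using bdd by (intro bdd_aboveI) auto
  have Gne: "G \<noteq> {}" using half by blast
  define \<mu> where "\<mu> = Sup G"
  let ?w = "rec_real c \<mu>"
  have mu: "\<mu> \<ge> 1 / 2" unfolding \<mu>_def using half bddG by (intro cSup_upper)
  then have mu0: "\<mu> > 0" "\<mu> \<noteq> 0" by auto
  \<comment> \<open>Negativity of a term is an open condition on the parameter, and \<open>G\<close>
    has elements arbitrarily close to its supremum.\<close>
  have ge0: "?w k \<ge> 0" for k
  proof (rule ccontr)
    assume "\<not> ?w k \<ge> 0"
    then have neg: "?w k < 0" by simp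
    have "((\<lambda>\<mu>. rec_real c \<mu> k) \<longlongrightarrow> ?w k) (at \<mu>)"
      using rec_real_continuous[OF mu0(2)] by (simp add: isCont_def)
    from order_tendstoD(2)[OF this neg]
    obtain d where d: "d > 0" "\<And>x. x \<noteq> \<mu> \<Longrightarrow> dist x \<mu> < d \<Longrightarrow> rec_real c x k < 0"
      unfolding eventually_at by auto
    obtain x where x: "x \<in> G" "\<mu> - d < x" using less_cSupD[OF Gne, of "\<mu> - d"] d unfolding \<mu>_def by auto
    have "x \<le> \<mu>" unfolding \<mu>_def using x bddG by (intro cSup_upper)
    then have "rec_real c x k < 0" using d(2)[of x] x neg by (cases "x = \<mu>") (auto simp: dist_real_def)
    then show False using x(1) by (cases "k = 0") (auto simp: G_def not_less[symmetric] dest!: spec[of _ k])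
  qed
  have pos: "?w (Suc k) > 0" for k
  proof (induction k)
    case (Suc k)
    show ?case
    proof (rule ccontr)
      assume "\<not> ?w (Suc (Suc k)) > 0"
      then have "?w (Suc (Suc k)) = 0" using ge0[of "Suc (Suc k)"] by linarith
      then have "?w (Suc (Suc (Suc k))) = - ?w (Suc k)" by simp
      then show False using Suc ge0[of "Suc (Suc (Suc k))"] by linarith
    qed
  qed simp
  \<comment> \<open>Leaves room for parameters up to \<open>\<mu> + 1\<close>, for which the growth
    lemma still applies from \<open>K\<close> on.\<close>
  define K where "K = Suc (nat \<lceil>2 * (\<mu> + 1)\<rceil>)"
  have K: "real K \<ge> 2 * (\<mu> + 1)" unfolding K_def by linarith
  \<comment> \<open>A growing step beyond \<open>K\<close> survives a small increase of the
    parameter; the growth lemma then keeps all later terms positive, so a parameter above the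
    supremum would belong to \<open>G\<close>.\<close>
  have dec: "?w (Suc k) \<le> ?w k" if k: "k \<ge> K" for k
  proof (rule ccontr)
    assume "\<not> ?thesis"
    then have gr: "?w k < ?w (Suc k)" by simp
    have kpos: "k \<ge> 1" using k by (simp add: K_def)
    have "\<forall>\<^sub>F x in at \<mu>. rec_real c x j > 0" if "j \<in> {1..Suc k}" for j
    proof -
      have "((\<lambda>\<mu>. rec_real c \<mu> j) \<longlongrightarrow> ?w j) (at \<mu>)"
        using rec_real_continuous[OF mu0(2)] by (simp add: isCont_def)
      moreover have "?w j > 0" using pos[of "j - 1"] that by simp
      ultimately show ?thesis by (rule order_tendstoD(1))
    qed
    then have 1: "\<forall>\<^sub>F x in at \<mu>. \<forall>j\<in>{1..Suc k}. rec_real c x j > 0"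
      by (intro eventually_ball_finite) auto
    have "((\<lambda>\<mu>. rec_real c \<mu> (Suc k) - rec_real c \<mu> k) \<longlongrightarrow> ?w (Suc k) - ?w k) (at \<mu>)"
      using rec_real_continuous[OF mu0(2)] unfolding isCont_def by (intro tendsto_diff)
    then have 2: "\<forall>\<^sub>F x in at \<mu>. rec_real c x (Suc k) - rec_real c x k > 0"
      by (rule order_tendstoD(1)) (use gr in simp)
    from 1 2 have "\<forall>\<^sub>F x in at \<mu>. (\<forall>j\<in>{1..Suc k}. rec_real c x j > 0) \<and> rec_real c x (Suc k) - rec_real c x k > 0"
      by (rule eventually_conj)
    then obtain d where d: "d > 0" "\<And>x. x \<noteq> \<mu> \<Longrightarrow> dist x \<mu> < d \<Longrightarrow>
        (\<forall>j\<in>{1..Suc k}. rec_real c x j > 0) \<and> rec_real c x (Suc k) - rec_real c x k > 0"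
      unfolding eventually_at by blast
    define x where "x = \<mu> + min d 1 / 2"
    have x: "x > \<mu>" "x < \<mu> + 1" "dist x \<mu> < d" using d(1) by (auto simp: x_def dist_real_def min_def)
    note dx = d(2)[OF _ x(3)]
    have grow: "0 \<le> rec_real c x j \<and> rec_real c x j < rec_real c x (Suc j)" if "j \<ge> k" for j
    proof (rule rec_real_growing[OF _ _ _ _ that])
      show "c (Suc i) \<ge> 2 * x" if "i \<ge> k" for i
        using c[of "Suc i"] that k K x by auto
      show "0 \<le> rec_real c x k" "rec_real c x k < rec_real c x (Suc k)" using dx x kpos by (auto simp: less_imp_le)
    qed (use x mu0 in auto)
    have "rec_real c x j > 0" if "j \<ge> 1" for j
    proof (cases "j \<le> Suc k")
      case True then show ?thesis using dx x that by auto
    next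
      case False
      then obtain i where "j = Suc i" "i \<ge> k" by (cases j) auto
      then show ?thesis using grow[of i] by simp
    qed
    then have "x \<in> G" using x mu0 by (auto simp: G_def)
    then have "x \<le> \<mu>" unfolding \<mu>_def using bddG by (intro cSup_upper)
    then show False using x by simp
  qed
  have rec: "\<mu> * (?w (Suc (Suc k)) + ?w k) = c (Suc k) * ?w (Suc k)" for k
    using mu0 by (simp add: field_simps)
  \<comment> \<open>As the terms do not increase, the recurrence bounds each by
    \<open>2 * \<mu> / (k + 1)\<close> times the one before, which gives convergence for every
    \<open>R\<close>.\<close>
  have decay: "real (Suc k) * ?w (Suc k) \<le> 2 * \<mu> * ?w k" if "k \<ge> K" for k
  proof -
    have "real (Suc k) * ?w (Suc k) \<le> c (Suc k) * ?w (Suc k)"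
      using c[of "Suc k"] ge0 by (intro mult_right_mono) auto
    also have "\<dots> = \<mu> * (?w (Suc (Suc k)) + ?w k)" by (rule rec[symmetric])
    also have "\<dots> \<le> \<mu> * (?w k + ?w k)"
      using dec[of k] dec[of "Suc k"] that mu0 by (intro mult_left_mono add_mono) auto
    finally show ?thesis by simp
  qed
  have summ: "summable (\<lambda>k. ?w k * R ^ k)" for R
  proof (rule summable_ratio_test[of "1/2" "max K (nat \<lceil>4 * \<mu> * \<bar>R\<bar>\<rceil>)"])
    fix k assume "k \<ge> max K (nat \<lceil>4 * \<mu> * \<bar>R\<bar>\<rceil>)"
    then have k: "k \<ge> K" "4 * \<mu> * \<bar>R\<bar> \<le> real (Suc k)" by linarith+
    have "real (Suc k) * (?w (Suc k) * \<bar>R\<bar>) = (real (Suc k) * ?w (Suc k)) * \<bar>R\<bar>" by simp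
    also have "\<dots> \<le> (2 * \<mu> * ?w k) * \<bar>R\<bar>" using decay[OF k(1)] by (intro mult_right_mono) auto
    also have "\<dots> = (4 * \<mu> * \<bar>R\<bar>) * (?w k / 2)" by simp
    also have "\<dots> \<le> real (Suc k) * (?w k / 2)" using k(2) ge0[of k] by (intro mult_right_mono) auto
    finally have "?w (Suc k) * \<bar>R\<bar> \<le> ?w k / 2" by (rule mult_left_le_imp_le) simp
    then have "?w (Suc k) * \<bar>R\<bar> * \<bar>R\<bar> ^ k \<le> ?w k / 2 * \<bar>R\<bar> ^ k" by (rule mult_right_mono) simp
    then show "norm (?w (Suc k) * R ^ Suc k) \<le> 1 / 2 * norm (?w k * R ^ k)"
      using ge0[of k] ge0[of "Suc k"] by (simp add: abs_mult power_abs mult.assoc del: rec_real.simps)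
  qed simp
  show ?thesis
  proof (rule that[of \<mu> ?w])
    show "?w k > 0" if "k \<ge> 1" for k using pos[of "k - 1"] that by simp
  qed (use mu0 rec summ in \<open>auto simp del: rec_real.simps(3)\<close>)
qed


section \<open>The system (L) along rays and circles\<close>


text \<open>Time reversal yields uniqueness from the right end point; the reflection about half a
  period at a constriction also rests on it.\<close>

lemma lin2_sol_reverse:
  assumes "lin2_sol a b c d (\<lambda>_. 0) (\<lambda>_. 0) {p..q} u v"
  shows "lin2_sol (\<lambda>t. - a (p + q - t)) (\<lambda>t. - b (p + q - t)) (\<lambda>t. - c (p + q - t)) (\<lambda>t. - d (p + q - t))
     (\<lambda>_. 0) (\<lambda>_. 0) {p..q} (\<lambda>t. u (p + q - t)) (\<lambda>t. v (p + q - t))"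
proof -
  have rev: "((\<lambda>t. f (p + q - t)) has_vector_derivative - f') (at t within {p..q})"
    if "(f has_vector_derivative f') (at (p + q - t) within {p..q})" for f :: "real \<Rightarrow> complex" and f' t
  proof -
    have "((\<lambda>t. p + q - t) has_vector_derivative -1) (at t within {p..q})"
      unfolding has_real_derivative_iff_has_vector_derivative[symmetric]
      by (rule derivative_eq_intros refl | simp)+
    moreover have "(\<lambda>t. p + q - t) ` {p..q} = {p..q}"
      by (auto intro!: image_eqI[where x = "p + q - _"])
    ultimately show ?thesis
      using vector_diff_chain_within[of "\<lambda>t. p + q - t" "-1" t "{p..q}" f f'] that by (simp add: o_def)
  qed
  show ?thesis
    unfolding lin2_sol_def
  proof (intro ballI conjI)
    fix t assume "t \<in> {p..q}"
    then have t: "p + q - t \<in> {p..q}" by auto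
    note D = assms[unfolded lin2_sol_def, rule_format, OF t]
    show "((\<lambda>t. u (p + q - t)) has_vector_derivative - a (p + q - t) * u (p + q - t) + - b (p + q - t) * v (p + q - t) + 0) (at t within {p..q})"
      using rev[OF conjunct1[OF D]] by simp
    show "((\<lambda>t. v (p + q - t)) has_vector_derivative - c (p + q - t) * u (p + q - t) + - d (p + q - t) * v (p + q - t) + 0) (at t within {p..q})"
      using rev[OF conjunct2[OF D]] by simp
  qed
qed

lemma lin2_sol_zero_backward:
  assumes sol: "lin2_sol a b c d (\<lambda>_. 0) (\<lambda>_. 0) {p..q} u v"
    and cont: "continuous_on {p..q} a" "continuous_on {p..q} b" "continuous_on {p..q} c" "continuous_on {p..q} d"
    and "u q = 0" "v q = 0" "t \<in> {p..q}"
  shows "u t = 0" "v t = 0"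
proof -
  have c: "continuous_on {p..q} (\<lambda>t. - f (p + q - t))" if "continuous_on {p..q} f" for f :: "real \<Rightarrow> complex"
    by (intro continuous_on_minus continuous_on_compose2[OF that] continuous_intros) auto
  have t: "p + q - t \<in> {p..q}" using assms(8) by auto
  show "u t = 0" "v t = 0"
    using lin2_sol_zero[OF lin2_sol_reverse[OF sol] c[OF cont(1)] c[OF cont(2)] c[OF cont(3)] c[OF cont(4)] _ _ t]
      assms(6,7) by simp_all
qed

lemma lin2_sol_unique_backward:
  assumes "lin2_sol a b c d (\<lambda>_. 0) (\<lambda>_. 0) {p..q} u v" "lin2_sol a b c d (\<lambda>_. 0) (\<lambda>_. 0) {p..q} u' v'"
    and "continuous_on {p..q} a" "continuous_on {p..q} b" "continuous_on {p..q} c" "continuous_on {p..q} d"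
    and "u q = u' q" "v q = v' q" "t \<in> {p..q}"
  shows "u t = u' t" "v t = v' t"
proof -
  have "lin2_sol a b c d (\<lambda>_. 0) (\<lambda>_. 0) {p..q} (\<lambda>t. u t - u' t) (\<lambda>t. v t - v' t)"
    using lin2_sol_diff[OF assms(1,2)] by simp
  from lin2_sol_zero_backward[OF this assms(3-6)] show "u t = u' t" "v t = v' t"
    using assms(7-9) by auto
qed

lemma has_vector_derivative_cnj_comp:
  "(f has_vector_derivative f') F \<Longrightarrow> ((\<lambda>t. cnj (f t)) has_vector_derivative cnj f') F"
  by (rule bounded_linear.has_vector_derivative[OF bounded_linear_cnj])

text \<open>The mirror symmetry of (L) on curves. The sign of the off-diagonal coefficients fits on
  the real axis because \<open>kap om\<close> is imaginary, and for the Josephson system because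
  time is reversed as well.\<close>

lemma lin2_sol_cnj:
  assumes "lin2_sol a b c d (\<lambda>_. 0) (\<lambda>_. 0) I u v"
    and "\<And>t. t \<in> I \<Longrightarrow> a' t = cnj (a t)" "\<And>t. t \<in> I \<Longrightarrow> b' t = - cnj (b t)"
      "\<And>t. t \<in> I \<Longrightarrow> c' t = - cnj (c t)" "\<And>t. t \<in> I \<Longrightarrow> d' t = cnj (d t)"
  shows "lin2_sol a' b' c' d' (\<lambda>_. 0) (\<lambda>_. 0) I (\<lambda>t. cnj (u t)) (\<lambda>t. - cnj (v t))"
  unfolding lin2_sol_def
proof (intro ballI conjI)
  fix t assume t: "t \<in> I"
  note D = assms(1)[unfolded lin2_sol_def, rule_format, OF t]
  show "((\<lambda>t. cnj (u t)) has_vector_derivative a' t * cnj (u t) + b' t * - cnj (v t) + 0) (at t within I)"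
    using has_vector_derivative_cnj_comp[OF conjunct1[OF D]] by (simp add: assms(2-5)[OF t])
  show "((\<lambda>t. - cnj (v t)) has_vector_derivative c' t * cnj (u t) + d' t * - cnj (v t) + 0) (at t within I)"
    using has_vector_derivative_minus[OF has_vector_derivative_cnj_comp[OF conjunct2[OF D]]] by (simp add: assms(2-5)[OF t])
qed

text \<open>The equal imaginary off-diagonal coefficients drop out of the derivative of the energy,
  so only upper bounds for the real parts of the diagonal enter. Unlike the Gronwall estimate this
  survives the singularity of the coefficients at 0.\<close>

lemma lin2_sol_energy:
  assumes sol: "lin2_sol a b b d (\<lambda>_. 0) (\<lambda>_. 0) {p..q} u v" and pq: "p \<le> q"
    and b: "\<And>t. t \<in> {p..q} \<Longrightarrow> Re (b t) = 0"
    and a: "\<And>t. t \<in> {p..q} \<Longrightarrow> Re (a t) \<le> C" and d: "\<And>t. t \<in> {p..q} \<Longrightarrow> Re (d t) \<le> C"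
  shows "(cmod (u q))\<^sup>2 + (cmod (v q))\<^sup>2 \<le> ((cmod (u p))\<^sup>2 + (cmod (v p))\<^sup>2) * exp (2 * C * (q - p))"
proof -
  define g where "g t = exp (- 2 * C * (t - p)) * (u t \<bullet> u t + v t \<bullet> v t)" for t
  have "g q \<le> g p"
  proof (rule DERIV_nonpos_imp_decreasing_open[OF pq])
    fix t assume t: "p < t" "t < q"
    then have t': "t \<in> {p..q}" by simp
    define u' where "u' = a t * u t + b t * v t"
    define v' where "v' = b t * u t + d t * v t"
    have "(u has_vector_derivative u') (at t)" "(v has_vector_derivative v') (at t)"
      using sol[unfolded lin2_sol_def, rule_format, OF t'] t by (simp_all add: at_within_Icc_at u'_def v'_def)
    then have du: "((\<lambda>t. u t \<bullet> u t) has_real_derivative 2 * (u t \<bullet> u')) (at t)"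
      and dv: "((\<lambda>t. v t \<bullet> v t) has_real_derivative 2 * (v t \<bullet> v')) (at t)"
      using has_derivative_inner[of u "\<lambda>h. h *\<^sub>R u'" t UNIV u "\<lambda>h. h *\<^sub>R u'"]
        has_derivative_inner[of v "\<lambda>h. h *\<^sub>R v'" t UNIV v "\<lambda>h. h *\<^sub>R v'"]
      by (simp_all add: has_vector_derivative_def has_field_derivative_def inner_commute mult_commute_abs algebra_simps)
    have e: "u t \<bullet> u' + v t \<bullet> v' = Re (a t) * (u t \<bullet> u t) + Re (d t) * (v t \<bullet> v t)"
      using b[OF t'] by (simp add: u'_def v'_def inner_complex_def algebra_simps)
    also have "\<dots> \<le> C * (u t \<bullet> u t) + C * (v t \<bullet> v t)"
      using a[OF t'] d[OF t'] by (intro add_mono mult_right_mono) auto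
    finally have le: "2 * (u t \<bullet> u') + 2 * (v t \<bullet> v') - 2 * C * (u t \<bullet> u t + v t \<bullet> v t) \<le> 0"
      by (simp add: algebra_simps)
    have "(g has_real_derivative exp (- 2 * C * (t - p)) * (2 * (u t \<bullet> u') + 2 * (v t \<bullet> v') - 2 * C * (u t \<bullet> u t + v t \<bullet> v t))) (at t)"
      unfolding g_def by (rule derivative_eq_intros du dv refl | simp add: algebra_simps)+
    then show "\<exists>y. (g has_real_derivative y) (at t) \<and> y \<le> 0"
      using le by (metis exp_ge_zero mult_nonneg_nonpos)
  next
    show "continuous_on {p..q} g"
      using lin2_sol_continuous[OF sol] unfolding g_def by (intro continuous_intros)
  qed
  then have "exp (- 2 * C * (q - p)) * ((cmod (u q))\<^sup>2 + (cmod (v q))\<^sup>2) \<le> (cmod (u p))\<^sup>2 + (cmod (v p))\<^sup>2"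
    by (simp add: g_def power2_norm_eq_inner)
  then have "exp (2 * C * (q - p)) * (exp (- 2 * C * (q - p)) * ((cmod (u q))\<^sup>2 + (cmod (v q))\<^sup>2))
      \<le> exp (2 * C * (q - p)) * ((cmod (u p))\<^sup>2 + (cmod (v p))\<^sup>2)"
    by (rule mult_left_mono) simp
  moreover have "exp (2 * C * (q - p)) * (exp (- 2 * C * (q - p)) * ((cmod (u q))\<^sup>2 + (cmod (v q))\<^sup>2)) = (cmod (u q))\<^sup>2 + (cmod (v q))\<^sup>2"
    unfolding mult.assoc[symmetric] exp_add[symmetric] by simp
  ultimately show ?thesis by (simp only: mult.commute)
qed

section \<open>System (L), its reduced form, and restrictions to rays and to the unit circle\<close>

definition kap :: "real \<Rightarrow> complex" where "kap om = 1 / (2 * \<i> * of_real om)"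

lemma kap_eq: "kap om = - \<i> * of_real (1 / (2 * om))"
  by (cases "om = 0") (simp_all add: kap_def field_simps)

lemma kap_nonzero: "om > 0 \<Longrightarrow> kap om \<noteq> 0"
  by (simp add: kap_def)

definition kdiag :: "nat \<Rightarrow> real \<Rightarrow> complex \<Rightarrow> complex" where
  "kdiag l mu z = - (of_nat l * z + of_real mu * (1 + z\<^sup>2)) / z\<^sup>2"

text \<open>\<open>L_sol\<close>: solutions of (L); \<open>L_red\<close>: the same after division by \<open>expfac\<close>.\<close>

definition L_sol :: "real \<Rightarrow> nat \<Rightarrow> real \<Rightarrow> (complex \<Rightarrow> complex) \<Rightarrow> (complex \<Rightarrow> complex) \<Rightarrow> complex \<Rightarrow> bool" where
  "L_sol om l mu u v z \<longleftrightarrow> (u has_field_derivative kdiag l mu z * u z + kap om / z * v z) (at z) \<and>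
     (v has_field_derivative kap om / z * u z) (at z)"

definition L_red :: "real \<Rightarrow> nat \<Rightarrow> real \<Rightarrow> (complex \<Rightarrow> complex) \<Rightarrow> (complex \<Rightarrow> complex) \<Rightarrow> complex \<Rightarrow> bool" where
  "L_red om l mu a b z \<longleftrightarrow> (a has_field_derivative kap om / z * b z) (at z) \<and>
     (b has_field_derivative kap om / z * a z - kdiag l mu z * b z) (at z)"

lemma expfac_has_field_derivative:
  assumes "z \<noteq> 0"
  shows "(expfac l mu has_field_derivative kdiag l mu z * expfac l mu z) (at z)"
proof -
  have p: "((\<lambda>z. inverse (z ^ l)) has_field_derivative - (of_nat l / z) * inverse (z ^ l)) (at z)"
  proof (cases l)
    case (Suc n)
    have "((\<lambda>z. inverse (z ^ l)) has_field_derivative - (inverse (z ^ l) * (of_nat l * z ^ (l - 1)) * inverse (z ^ l))) (at z)"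
      by (rule derivative_eq_intros refl | use assms in simp)+
    moreover have "inverse (z ^ l) * (of_nat l * z ^ (l - 1)) * inverse (z ^ l) = of_nat l / z * inverse (z ^ l)"
      using assms by (simp add: Suc field_simps)
    ultimately show ?thesis by simp
  qed simp
  have e: "((\<lambda>z. exp (of_real mu * (1 / z - z))) has_field_derivative exp (of_real mu * (1 / z - z)) * (of_real mu * (- (1 / z\<^sup>2) - 1))) (at z)"
    by (rule derivative_eq_intros refl | use assms in \<open>simp add: power2_eq_square\<close>)+
  have "kdiag l mu z = - (of_nat l / z) + of_real mu * (- (1 / z\<^sup>2) - 1)"
    using assms by (simp add: kdiag_def field_simps power2_eq_square)
  moreover have "- x * p * e + e * m * p = (- x + m) * (p * e)" for x p e m :: complex
    by (simp add: algebra_simps)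
  ultimately have "- (of_nat l / z) * inverse (z ^ l) * exp (of_real mu * (1 / z - z)) + exp (of_real mu * (1 / z - z)) * (of_real mu * (- (1 / z\<^sup>2) - 1)) * inverse (z ^ l)
     = kdiag l mu z * expfac l mu z"
    by (simp only: expfac_def)
  moreover have "expfac l mu = (\<lambda>z. inverse (z ^ l) * exp (of_real mu * (1 / z - z)))"
    by (simp add: fun_eq_iff expfac_def)
  ultimately show ?thesis using DERIV_mult[OF p e] by simp
qed

lemma L_sol_of_L_red:
  assumes "z \<noteq> 0" "L_red om l mu a b z"
  shows "L_sol om l mu (\<lambda>z. expfac l mu z * a z) (\<lambda>z. expfac l mu z * b z) z"
proof -
  note E = expfac_has_field_derivative[OF assms(1), of l mu]
  have "((\<lambda>z. expfac l mu z * a z) has_field_derivative kdiag l mu z * expfac l mu z * a z + kap om / z * b z * expfac l mu z) (at z)"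
    "((\<lambda>z. expfac l mu z * b z) has_field_derivative kdiag l mu z * expfac l mu z * b z + (kap om / z * a z - kdiag l mu z * b z) * expfac l mu z) (at z)"
    using DERIV_mult[OF E conjunct1[OF assms(2)[unfolded L_red_def]]]
      DERIV_mult[OF E conjunct2[OF assms(2)[unfolded L_red_def]]] by simp_all
  then show ?thesis unfolding L_sol_def by (simp add: algebra_simps)
qed

text \<open>The reduced form of the involution: multiplied by \<open>expfac\<close> and the constant
  \<open>\<i>\<close>, this is the map used in \<open>What\<close>.\<close>

lemma L_red_inverse:
  assumes "z \<noteq> 0" "L_sol om l mu u v (1 / z)"
  shows "L_red om l mu (\<lambda>z. v (1 / z)) (\<lambda>z. - u (1 / z)) z"
proof -
  have i: "((\<lambda>z. 1 / z) has_field_derivative - (1 / z\<^sup>2)) (at z)"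
    by (rule derivative_eq_intros refl | use assms in \<open>simp add: power2_eq_square\<close>)+
  have "((\<lambda>z. v (1 / z)) has_field_derivative kap om / (1 / z) * u (1 / z) * (- (1 / z\<^sup>2))) (at z)"
    "((\<lambda>z. u (1 / z)) has_field_derivative (kdiag l mu (1 / z) * u (1 / z) + kap om / (1 / z) * v (1 / z)) * (- (1 / z\<^sup>2))) (at z)"
    using DERIV_chain2[OF conjunct2[OF assms(2)[unfolded L_sol_def]] i]
      DERIV_chain2[OF conjunct1[OF assms(2)[unfolded L_sol_def]] i] by simp_all
  from this(1) DERIV_minus[OF this(2)] show ?thesis
    unfolding L_red_def using assms(1)
    by (auto simp: kdiag_def field_simps power2_eq_square elim!: DERIV_cong)
qed

text \<open>(L) along the ray \<open>z = t\<close>, its reduced form along \<open>z = -t\<close>, and (L) along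
  \<open>z = cis (pi - t)\<close>, each with a complex parameter in place of \<open>mu\<close>.\<close>

abbreviation right_ray :: "real \<Rightarrow> nat \<Rightarrow> complex \<Rightarrow> real set \<Rightarrow> (real \<Rightarrow> complex) \<Rightarrow> (real \<Rightarrow> complex) \<Rightarrow> bool" where
  "right_ray om l \<mu> \<equiv> lin2_sol (\<lambda>t. - of_real (real l / t) + \<mu> * - of_real ((1 + t\<^sup>2) / t\<^sup>2))
     (\<lambda>t. kap om / of_real t) (\<lambda>t. kap om / of_real t) (\<lambda>t. 0 + \<mu> * 0) (\<lambda>_. 0) (\<lambda>_. 0)"

abbreviation left_ray :: "real \<Rightarrow> nat \<Rightarrow> complex \<Rightarrow> real set \<Rightarrow> (real \<Rightarrow> complex) \<Rightarrow> (real \<Rightarrow> complex) \<Rightarrow> bool" where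
  "left_ray om l \<mu> \<equiv> lin2_sol (\<lambda>t. 0 + \<mu> * 0)
     (\<lambda>t. kap om / of_real t) (\<lambda>t. kap om / of_real t) (\<lambda>t. of_real (real l / t) + \<mu> * - of_real ((1 + t\<^sup>2) / t\<^sup>2)) (\<lambda>_. 0) (\<lambda>_. 0)"

abbreviation arc_sol :: "real \<Rightarrow> nat \<Rightarrow> complex \<Rightarrow> (real \<Rightarrow> complex) \<Rightarrow> (real \<Rightarrow> complex) \<Rightarrow> bool" where
  "arc_sol om l \<mu> \<equiv> lin2_sol (\<lambda>t. \<i> * of_nat l + \<mu> * (- 2 * \<i> * of_real (cos t)))
     (\<lambda>t. - \<i> * kap om) (\<lambda>t. - \<i> * kap om) (\<lambda>t. 0 + \<mu> * 0) (\<lambda>_. 0) (\<lambda>_. 0) {0..pi}"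

text \<open>Constant and \<open>\<mu>\<close>-linear parts are listed separately, as
  \<open>lin2_sol_holomorphic\<close> takes them; this also explains \<open>0 + \<mu> * 0\<close> in
  the abbreviations.\<close>

lemma right_ray_continuous:
  assumes "e > 0"
  shows "continuous_on {e..1} (\<lambda>t. - complex_of_real (real l / t))"
    "continuous_on {e..1} (\<lambda>t. - complex_of_real ((1 + t\<^sup>2) / t\<^sup>2))"
    "continuous_on {e..1} (\<lambda>t. kap om / of_real t)"
    "continuous_on {e..1} (\<lambda>t. complex_of_real (real l / t))"
  using assms by (auto intro!: continuous_intros)

lemma right_ray_of_L_sol:
  assumes "e > 0" "\<And>t. t \<in> {e..1} \<Longrightarrow> L_sol om l mu u v (of_real t)"
  shows "right_ray om l (of_real mu) {e..1} (\<lambda>t. u (of_real t)) (\<lambda>t. v (of_real t))"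
  unfolding lin2_sol_def
proof (intro ballI conjI)
  fix t assume t: "t \<in> {e..1}"
  then have "t > 0" using assms(1) by auto
  note D = assms(2)[OF t, unfolded L_sol_def]
  have k: "kdiag l mu (of_real t) = - of_real (real l / t) + of_real mu * - of_real ((1 + t\<^sup>2) / t\<^sup>2)"
    using \<open>t > 0\<close> by (simp add: kdiag_def field_simps power2_eq_square)
  show "((\<lambda>t. u (of_real t)) has_vector_derivative (- of_real (real l / t) + of_real mu * - of_real ((1 + t\<^sup>2) / t\<^sup>2)) * u (of_real t)
      + kap om / of_real t * v (of_real t) + 0) (at t within {e..1})"
    using has_vector_derivative_real_field[OF conjunct1[OF D]] unfolding k by simp
  show "((\<lambda>t. v (of_real t)) has_vector_derivative kap om / of_real t * u (of_real t)
      + (0 + of_real mu * 0) * v (of_real t) + 0) (at t within {e..1})"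
    using has_vector_derivative_real_field[OF conjunct2[OF D]] by simp
qed

lemma left_ray_of_L_red:
  assumes "e > 0" "\<And>t. t \<in> {e..1} \<Longrightarrow> L_red om l mu a b (- of_real t)"
  shows "left_ray om l (of_real mu) {e..1} (\<lambda>t. a (- of_real t)) (\<lambda>t. b (- of_real t))"
  unfolding lin2_sol_def
proof (intro ballI conjI)
  fix t assume t: "t \<in> {e..1}"
  then have "t > 0" using assms(1) by auto
  note D = assms(2)[OF t, unfolded L_red_def]
  have k: "kdiag l mu (- of_real t) = of_real (real l / t) + of_real mu * - of_real ((1 + t\<^sup>2) / t\<^sup>2)"
    using \<open>t > 0\<close> by (simp add: kdiag_def field_simps power2_eq_square)
  have neg: "(kap om / - of_real t * x - K * y) * - 1 = kap om / of_real t * x + K * y" for x y K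
    by simp
  have m: "((\<lambda>z. - z) has_field_derivative -1) (at z)" for z :: complex
    by (rule derivative_eq_intros refl | simp)+
  show "((\<lambda>t. a (- of_real t)) has_vector_derivative (0 + of_real mu * 0) * a (- of_real t)
      + kap om / of_real t * b (- of_real t) + 0) (at t within {e..1})"
    using has_vector_derivative_real_field[OF DERIV_chain2[OF conjunct1[OF D] m]] by simp
  show "((\<lambda>t. b (- of_real t)) has_vector_derivative kap om / of_real t * a (- of_real t)
      + (of_real (real l / t) + of_real mu * - of_real ((1 + t\<^sup>2) / t\<^sup>2)) * b (- of_real t) + 0) (at t within {e..1})"
    using has_vector_derivative_real_field[OF DERIV_chain2[OF conjunct2[OF D] m]] unfolding k neg by simp
qed

text \<open>Used at two speeds: \<open>\<alpha> = pi\<close>, \<open>\<beta> = -1\<close> for the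
  arc from -1 to 1, and \<open>\<alpha> = 0\<close>, \<open>\<beta> = om\<close> for Josephson time.
  The cosine comes from \<open>z + 1 / z\<close> on the unit circle.\<close>

lemma circle_of_L_sol:
  assumes "L_sol om l mu u v (cis (\<alpha> + \<beta> * t))"
  shows "((\<lambda>t. u (cis (\<alpha> + \<beta> * t))) has_vector_derivative
       - \<i> * of_real \<beta> * (of_nat l + 2 * of_real mu * of_real (cos (\<alpha> + \<beta> * t))) * u (cis (\<alpha> + \<beta> * t))
       + \<i> * of_real \<beta> * kap om * v (cis (\<alpha> + \<beta> * t))) (at t within I)"
    "((\<lambda>t. v (cis (\<alpha> + \<beta> * t))) has_vector_derivative \<i> * of_real \<beta> * kap om * u (cis (\<alpha> + \<beta> * t))) (at t within I)"
proof -
  define z where "z = cis (\<alpha> + \<beta> * t)"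
  have z0: "z \<noteq> 0" by (simp add: z_def)
  have cisw: "cis (\<alpha> + \<beta> * t) = exp (\<i> * (of_real \<alpha> + of_real \<beta> * of_real t))" for t
    by (simp add: cis_conv_exp)
  have d: "((\<lambda>w. exp (\<i> * (of_real \<alpha> + of_real \<beta> * w))) has_field_derivative z * (\<i> * of_real \<beta>)) (at (of_real t))"
    unfolding z_def cisw by (rule derivative_eq_intros refl | simp)+
  note D = assms[folded z_def, unfolded L_sol_def]
  have ez: "exp (\<i> * (of_real \<alpha> + of_real \<beta> * of_real t)) = z" by (simp add: z_def cisw)
  have D1: "(u has_field_derivative kdiag l mu z * u z + kap om / z * v z) (at (exp (\<i> * (of_real \<alpha> + of_real \<beta> * of_real t))))"
    "(v has_field_derivative kap om / z * u z) (at (exp (\<i> * (of_real \<alpha> + of_real \<beta> * of_real t))))"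
    using D unfolding ez by auto
  have zk: "z * kdiag l mu z = - (of_nat l + 2 * of_real mu * of_real (cos (\<alpha> + \<beta> * t)))"
  proof -
    have "z + 1 / z = 2 * of_real (cos (\<alpha> + \<beta> * t))"
    proof -
      define \<theta> where "\<theta> = \<alpha> + \<beta> * t"
      have "cis \<theta> + 1 / cis \<theta> = 2 * of_real (cos \<theta>)"
        by (simp add: complex_eq_iff divide_inverse)
      then show ?thesis by (simp only: z_def \<theta>_def)
    qed
    moreover have "z * kdiag l mu z = - (of_nat l + of_real mu * (z + 1 / z))"
      using z0 by (simp add: kdiag_def field_simps power2_eq_square)
    ultimately show ?thesis by simp
  qed
  have "(kdiag l mu z * u z + kap om / z * v z) * (z * (\<i> * of_real \<beta>)) = \<i> * of_real \<beta> * (z * kdiag l mu z) * u z + \<i> * of_real \<beta> * kap om * v z"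
    using z0 by (simp add: field_simps)
  then have 1: "(kdiag l mu z * u z + kap om / z * v z) * (z * (\<i> * of_real \<beta>)) =
     - \<i> * of_real \<beta> * (of_nat l + 2 * of_real mu * of_real (cos (\<alpha> + \<beta> * t))) * u z + \<i> * of_real \<beta> * kap om * v z"
    unfolding zk by (simp only: mult_minus_left mult_minus_right)
  have 2: "kap om / z * u z * (z * (\<i> * of_real \<beta>)) = \<i> * of_real \<beta> * kap om * u z"
    using z0 by (simp add: field_simps)
  show "((\<lambda>t. u (cis (\<alpha> + \<beta> * t))) has_vector_derivative
       - \<i> * of_real \<beta> * (of_nat l + 2 * of_real mu * of_real (cos (\<alpha> + \<beta> * t))) * u (cis (\<alpha> + \<beta> * t))
       + \<i> * of_real \<beta> * kap om * v (cis (\<alpha> + \<beta> * t))) (at t within I)"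
    using has_vector_derivative_real_field[OF DERIV_chain2[OF D1(1) d], of I]
    unfolding 1 by (simp only: cisw ez)
  show "((\<lambda>t. v (cis (\<alpha> + \<beta> * t))) has_vector_derivative \<i> * of_real \<beta> * kap om * u (cis (\<alpha> + \<beta> * t))) (at t within I)"
    using has_vector_derivative_real_field[OF DERIV_chain2[OF D1(2) d], of I]
    unfolding 2 by (simp only: cisw ez)
qed

lemma arc_of_L_sol:
  assumes "\<And>t. t \<in> {0..pi} \<Longrightarrow> L_sol om l mu u v (cis (pi - t))"
  shows "arc_sol om l (of_real mu) (\<lambda>t. u (cis (pi - t))) (\<lambda>t. v (cis (pi - t)))"
  unfolding lin2_sol_def
proof (intro ballI conjI)
  fix t assume t: "t \<in> {0..pi}"
  have "L_sol om l mu u v (cis (pi + -1 * t))" using assms[OF t] by simp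
  note D = circle_of_L_sol[OF this, of "{0..pi}"]
  show "((\<lambda>t. u (cis (pi - t))) has_vector_derivative (\<i> * of_nat l + of_real mu * (- 2 * \<i> * of_real (cos t))) * u (cis (pi - t))
     + - \<i> * kap om * v (cis (pi - t)) + 0) (at t within {0..pi})"
    using D(1) by (simp add: algebra_simps)
  show "((\<lambda>t. v (cis (pi - t))) has_vector_derivative - \<i> * kap om * u (cis (pi - t))
     + (0 + of_real mu * 0) * v (cis (pi - t)) + 0) (at t within {0..pi})"
    using D(2) by simp
qed

lemma arc_continuous:
  "continuous_on {0..pi} (\<lambda>_. \<i> * of_nat l :: complex)"
  "continuous_on {0..pi} (\<lambda>t. - 2 * \<i> * complex_of_real (cos t))"
  "continuous_on {0..pi} (\<lambda>_. - \<i> * kap om)" "continuous_on {0..pi} (\<lambda>_. 0 :: complex)"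
  by (intro continuous_intros)+

lemma arc_coefficients_continuous:
  "continuous_on {0..pi} (\<lambda>t. \<i> * of_nat l + \<mu> * (- 2 * \<i> * complex_of_real (cos t)))"
  "continuous_on {0..pi} (\<lambda>_. - \<i> * kap om)" "continuous_on {0..pi} (\<lambda>_. 0 + \<mu> * 0)"
  by (intro continuous_intros)+


section \<open>Normalised solutions\<close>


text \<open>Both diagonal coefficients have nonpositive real part. The bound is free of
  \<open>e\<close>, so \<open>e\<close> may tend to 0, and it allows complex \<open>\<mu>\<close>,
  as the normal family argument requires.\<close>

lemma right_ray_energy:
  assumes sol: "right_ray om l \<mu> {e..1} u v" and e: "e > 0" "e \<le> t" "t \<le> 1" and \<mu>: "Re \<mu> \<ge> 0"
  shows "(cmod (u t))\<^sup>2 + (cmod (v t))\<^sup>2 \<le> (cmod (u e))\<^sup>2 + (cmod (v e))\<^sup>2"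
proof -
  have "(cmod (u t))\<^sup>2 + (cmod (v t))\<^sup>2 \<le> ((cmod (u e))\<^sup>2 + (cmod (v e))\<^sup>2) * exp (2 * 0 * (t - e))"
  proof (rule lin2_sol_energy[OF lin2_sol_subset[OF sol]])
    fix s assume "s \<in> {e..t}"
    then have s: "s > 0" using e by auto
    show "Re (kap om / of_real s) = 0" by (simp add: kap_eq)
    have "0 \<le> real l / s" "0 \<le> Re \<mu> * ((1 + s\<^sup>2) / s\<^sup>2)"
      using s \<mu> by (auto intro!: mult_nonneg_nonneg divide_nonneg_nonneg)
    then show "Re (- of_real (real l / s) + \<mu> * - of_real ((1 + s\<^sup>2) / s\<^sup>2)) \<le> 0"
      by (simp del: of_real_divide of_real_add of_real_power)
  qed (use e in auto)
  then show ?thesis by simp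
qed

lemma left_ray_energy:
  assumes sol: "left_ray om l \<mu> {e..1} u v" and e: "e > 0" "e \<le> t" "t \<le> 1" and m: "m > 0" "m \<le> Re \<mu>"
  shows "(cmod (u t))\<^sup>2 + (cmod (v t))\<^sup>2 \<le> ((cmod (u e))\<^sup>2 + (cmod (v e))\<^sup>2) * exp ((real l)\<^sup>2 / (2 * m))"
proof -
  \<comment> \<open>Completing the square bounds \<open>l / s - m / s^2\<close> by this constant for
    every \<open>s\<close>.\<close>
  define C where "C = (real l)\<^sup>2 / (4 * m)"
  have C: "C \<ge> 0" using m by (simp add: C_def)
  have "(cmod (u t))\<^sup>2 + (cmod (v t))\<^sup>2 \<le> ((cmod (u e))\<^sup>2 + (cmod (v e))\<^sup>2) * exp (2 * C * (t - e))"
  proof (rule lin2_sol_energy[OF lin2_sol_subset[OF sol]])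
    fix s assume "s \<in> {e..t}"
    then have s: "s > 0" using e by auto
    show "Re (kap om / of_real s) = 0" by (simp add: kap_eq)
    have "m * (1 / s\<^sup>2) \<le> Re \<mu> * ((1 + s\<^sup>2) / s\<^sup>2)"
      using s m by (intro mult_mono divide_right_mono) auto
    moreover have "real l / s - m * (1 / s\<^sup>2) \<le> C"
    proof -
      have "0 \<le> m * (1 / s - real l / (2 * m))\<^sup>2" using m by simp
      also have "\<dots> = m * (1 / s\<^sup>2) - real l / s + C"
        using m s by (simp add: C_def power2_eq_square field_simps)
      finally show ?thesis by simp
    qed
    ultimately show "Re (of_real (real l / s) + \<mu> * - of_real ((1 + s\<^sup>2) / s\<^sup>2)) \<le> C"
      by (simp del: of_real_divide of_real_add of_real_power)
  qed (use e C in auto)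
  also have "\<dots> \<le> ((cmod (u e))\<^sup>2 + (cmod (v e))\<^sup>2) * exp ((real l)\<^sup>2 / (2 * m))"
  proof (intro mult_left_mono)
    have "2 * C * (t - e) \<le> 2 * C * 1" using C e by (intro mult_left_mono) auto
    also have "\<dots> = (real l)\<^sup>2 / (2 * m)" by (simp add: C_def)
    finally show "exp (2 * C * (t - e)) \<le> exp ((real l)\<^sup>2 / (2 * m))" by simp
  qed simp
  finally show ?thesis .
qed

lemma null_of_bounded_by_tendsto_zero:
  fixes u v :: "real \<Rightarrow> complex"
  assumes lim: "(u \<longlongrightarrow> 0) (at_right 0)" "(v \<longlongrightarrow> 0) (at_right 0)" and "t > 0"
    and bd: "\<And>e. e > 0 \<Longrightarrow> e \<le> t \<Longrightarrow> x \<le> ((cmod (u e))\<^sup>2 + (cmod (v e))\<^sup>2) * M"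
  shows "x \<le> 0"
proof -
  have "((\<lambda>e. ((cmod (u e))\<^sup>2 + (cmod (v e))\<^sup>2) * M) \<longlongrightarrow> ((cmod 0)\<^sup>2 + (cmod 0)\<^sup>2) * M) (at_right 0)"
    by (intro tendsto_intros lim)
  then have "((\<lambda>e. ((cmod (u e))\<^sup>2 + (cmod (v e))\<^sup>2) * M) \<longlongrightarrow> 0) (at_right 0)" by simp
  moreover have "\<forall>\<^sub>F e in at_right 0. x \<le> ((cmod (u e))\<^sup>2 + (cmod (v e))\<^sup>2) * M"
    using eventually_at_right_less[of 0] eventually_at_right_real[OF \<open>t > 0\<close>]
    by eventually_elim (use bd in auto)
  ultimately show ?thesis by (rule tendsto_lowerbound) simp
qed

text \<open>Uniqueness at the singular point: start the energy estimate at \<open>e\<close> and let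
  \<open>e\<close> tend to 0.\<close>

lemma right_ray_null:
  assumes sol: "\<And>e. e > 0 \<Longrightarrow> right_ray om l \<mu> {e..1} u v" and \<mu>: "Re \<mu> \<ge> 0"
    and lim: "(u \<longlongrightarrow> 0) (at_right 0)" "(v \<longlongrightarrow> 0) (at_right 0)" and t: "0 < t" "t \<le> 1"
  shows "u t = 0" "v t = 0"
proof -
  have "(cmod (u t))\<^sup>2 + (cmod (v t))\<^sup>2 \<le> 0"
    by (rule null_of_bounded_by_tendsto_zero[OF lim t(1), of _ 1])
      (use right_ray_energy[OF sol _ _ t(2) \<mu>] in auto)
  then show "u t = 0" "v t = 0" by (simp_all add: sum_power2_le_zero_iff)
qed

lemma left_ray_null:
  assumes sol: "\<And>e. e > 0 \<Longrightarrow> left_ray om l \<mu> {e..1} u v" and \<mu>: "Re \<mu> > 0"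
    and lim: "(u \<longlongrightarrow> 0) (at_right 0)" "(v \<longlongrightarrow> 0) (at_right 0)" and t: "0 < t" "t \<le> 1"
  shows "u t = 0" "v t = 0"
proof -
  have "(cmod (u t))\<^sup>2 + (cmod (v t))\<^sup>2 \<le> 0"
    by (rule null_of_bounded_by_tendsto_zero[OF lim t(1), of _ "exp ((real l)\<^sup>2 / (2 * Re \<mu>))"])
      (use left_ray_energy[OF sol _ _ t(2) \<mu> order_refl] in auto)
  then show "u t = 0" "v t = 0" by (simp_all add: sum_power2_le_zero_iff)
qed

text \<open>Rotating the bisector onto the positive axis keeps the sector away from the cut of
  \<open>Arg\<close>, since half its opening is less than pi; there \<open>Arg\<close> is
  continuous.\<close>

lemma sector_open:
  assumes "t2 - t1 < 2 * pi"
  shows "open (sector t1 t2)"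
proof -
  define m where "m = (t1 + t2) / 2"
  define w where "w = (t2 - t1) / 2"
  define N where "N = {x \<in> - \<real>\<^sub>\<le>\<^sub>0. Arg x \<in> {- w<..<w}}"
  have w: "w < pi" using assms by (simp add: w_def)
  have "N = - \<real>\<^sub>\<le>\<^sub>0 \<inter> Arg -` {- w<..<w}" by (auto simp: N_def)
  moreover have "open (- \<real>\<^sub>\<le>\<^sub>0 \<inter> Arg -` {- w<..<w})"
    by (rule continuous_open_preimage[OF continuous_on_Arg]) auto
  ultimately have "open N" by simp
  moreover have "sector t1 t2 = (\<lambda>z. z * cis (- m)) -` N"
  proof (intro set_eqI iffI)
    fix z assume "z \<in> sector t1 t2"
    then obtain t where t: "z \<noteq> 0" "t1 < t" "t < t2" "z = of_real (cmod z) * cis t"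
      by (auto simp: sector_def)
    have tm: "- w < t - m" "t - m < w" using t by (auto simp: w_def m_def field_simps)
    have z: "z * cis (- m) = of_real (cmod z) * cis (t - m)"
      by (subst t(4)) (simp add: cis_mult)
    have A: "Arg (z * cis (- m)) = t - m"
      by (rule Arg_unique[of "cmod z"]) (use z t tm w in \<open>auto simp: cis_conv_exp\<close>)
    have "z * cis (- m) \<notin> \<real>\<^sub>\<le>\<^sub>0"
    proof
      assume "z * cis (- m) \<in> \<real>\<^sub>\<le>\<^sub>0"
      moreover have "z * cis (- m) \<noteq> 0" using t(1) by simp
      ultimately have "Re (z * cis (- m)) < 0 \<and> Im (z * cis (- m)) = 0"
        unfolding complex_nonpos_Reals_iff complex_eq_iff by auto
      then have "Arg (z * cis (- m)) = pi" using Arg_eq_pi by blast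
      then show False using A tm w by simp
    qed
    then show "z \<in> (\<lambda>z. z * cis (- m)) -` N" using A tm by (simp add: N_def)
  next
    fix z assume z: "z \<in> (\<lambda>z. z * cis (- m)) -` N"
    define t where "t = Arg (z * cis (- m)) + m"
    have t: "t1 < t" "t < t2" using z by (auto simp: N_def t_def w_def m_def field_simps)
    have "z \<noteq> 0" using z by (auto simp: N_def)
    have "z * cis (- m) = of_real (cmod z) * cis (Arg (z * cis (- m)))"
      using rcis_cmod_Arg[of "z * cis (- m)"] by (simp add: rcis_def norm_mult)
    then have "z * cis (- m) * cis m = of_real (cmod z) * cis (Arg (z * cis (- m))) * cis m" by simp
    then have "z = of_real (cmod z) * cis t" by (simp add: mult.assoc cis_mult t_def)
    then show "z \<in> sector t1 t2" using t \<open>z \<noteq> 0\<close> by (auto simp: sector_def)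
  qed
  ultimately show ?thesis by (simp add: open_vimage continuous_intros)
qed

text \<open>Two readings of \<open>$\<close> would make every matrix entry an ambiguous term.\<close>

no_notation fps_nth (infixl "$" 75)

section \<open>Normalised solutions at one parameter value\<close>

locale normalised =
  fixes om :: real and l :: nat and mu :: real and S :: "complex set" and H :: "complex \<Rightarrow> complex^2^2"
  assumes om: "om > 0" and mu: "mu > 0" and adm: "admissible_Splus S" and nrm: "is_normaliser om l mu S H"
begin

abbreviation h :: "2 \<Rightarrow> 2 \<Rightarrow> complex \<Rightarrow> complex" where "h i j z \<equiv> H z $ i $ j"

lemma open_S: "open S"
proof -
  obtain t1 t2 where "- pi/2 < t1" "t1 < 0" "pi < t2" "t2 < 3*pi/2" "S = sector t1 t2"
    using adm unfolding admissible_Splus_def by blast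
  then show ?thesis using sector_open[of t2 t1] by simp
qed

lemma upper_in_S: "Im z \<ge> 0 \<Longrightarrow> z \<noteq> 0 \<Longrightarrow> z \<in> S"
proof -
  assume z: "Im z \<ge> 0" "z \<noteq> 0"
  obtain t1 t2 where t: "- pi/2 < t1" "t1 < 0" "pi < t2" "t2 < 3*pi/2" "S = sector t1 t2"
    using adm unfolding admissible_Splus_def by blast
  have "0 \<le> Arg z" "Arg z \<le> pi" using z Arg_less_0 Arg_le_pi by auto
  moreover have "z = of_real (cmod z) * cis (Arg z)" using rcis_cmod_Arg[of z] by (simp add: rcis_def)
  ultimately have "z \<noteq> 0 \<and> t1 < Arg z \<and> Arg z < t2 \<and> z = of_real (cmod z) * cis (Arg z)"
    using t z by linarith
  then show ?thesis unfolding t(5) sector_def by blast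
qed

lemma h_deriv:
  assumes "z \<in> S"
  shows "(h i j has_field_derivative (Kmat om l mu z ** H z - H z ** Dmat om l mu z) $ i $ j) (at z)"
proof -
  have "h i j holomorphic_on S" using nrm unfolding is_normaliser_def by blast
  then have "(h i j has_field_derivative deriv (h i j) z) (at z)"
    using holomorphic_derivI[OF _ open_S assms] by blast
  moreover have "mderiv H z = Kmat om l mu z ** H z - H z ** Dmat om l mu z"
    using nrm assms unfolding is_normaliser_def by blast
  then have "deriv (h i j) z = (Kmat om l mu z ** H z - H z ** Dmat om l mu z) $ i $ j"
    unfolding mderiv_def by (auto simp: vec_eq_iff)
  ultimately show ?thesis by simp
qed

text \<open>\<open>Dmat\<close> has only its upper left entry, so \<open>H' = K H - H D\<close>
  decouples by columns: the second solves (L) itself, the first is a solution of (L) divided by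
  \<open>expfac\<close>.\<close>

lemma h_derivs:
  assumes "z \<in> S"
  shows "L_red om l mu (h 1 1) (h 2 1) z" "L_sol om l mu (h 1 2) (h 2 2) z"
proof -
  note D = h_deriv[OF assms]
  show "L_red om l mu (h 1 1) (h 2 1) z"
    unfolding L_red_def
    by (intro conjI DERIV_cong[OF D[of 1 1]] DERIV_cong[OF D[of 2 1]])
      (simp_all add: Kmat_def Dmat_def mat2_def matrix_matrix_mult_def sum_2 kap_def kdiag_def mult_ac)
  show "L_sol om l mu (h 1 2) (h 2 2) z"
    unfolding L_sol_def
    by (intro conjI DERIV_cong[OF D[of 1 2]] DERIV_cong[OF D[of 2 2]])
      (simp_all add: Kmat_def Dmat_def mat2_def matrix_matrix_mult_def sum_2 kap_def kdiag_def mult_ac)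
qed

lemma h_lim: "(h i j \<longlongrightarrow> mat 1 $ i $ j) (at 0 within S)"
  using nrm unfolding is_normaliser_def by blast

lemma h_lim_right: "((\<lambda>t. h i j (of_real t)) \<longlongrightarrow> mat 1 $ i $ j) (at_right 0)"
proof (rule filterlim_compose[OF h_lim])
  have "((\<lambda>t. complex_of_real t) \<longlongrightarrow> of_real 0) (at_right 0)" by (intro tendsto_intros)
  moreover have "\<forall>\<^sub>F t in at_right 0. complex_of_real t \<in> S \<and> complex_of_real t \<noteq> 0"
    using eventually_at_right_less[of 0] by eventually_elim (auto intro: upper_in_S)
  ultimately show "filterlim complex_of_real (at 0 within S) (at_right 0)"
    by (simp add: filterlim_at)
qed

lemma h_lim_left: "((\<lambda>t. h i j (- of_real t)) \<longlongrightarrow> mat 1 $ i $ j) (at_right 0)"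
proof (rule filterlim_compose[OF h_lim])
  have "((\<lambda>t. - complex_of_real t) \<longlongrightarrow> - of_real 0) (at_right 0)" by (intro tendsto_intros)
  moreover have "\<forall>\<^sub>F t in at_right 0. - complex_of_real t \<in> S \<and> - complex_of_real t \<noteq> 0"
    using eventually_at_right_less[of 0] by eventually_elim (auto intro: upper_in_S)
  ultimately show "filterlim (\<lambda>t. - complex_of_real t) (at 0 within S) (at_right 0)"
    by (simp add: filterlim_at)
qed

lemma col2_right: "e > 0 \<Longrightarrow> right_ray om l (of_real mu) {e..1} (\<lambda>t. h 1 2 (of_real t)) (\<lambda>t. h 2 2 (of_real t))"
  by (rule right_ray_of_L_sol) (auto intro!: h_derivs upper_in_S)

lemma col1_left: "e > 0 \<Longrightarrow> left_ray om l (of_real mu) {e..1} (\<lambda>t. h 1 1 (- of_real t)) (\<lambda>t. h 2 1 (- of_real t))"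
  by (rule left_ray_of_L_red) (auto intro!: h_derivs upper_in_S)

lemma lims:
  "((\<lambda>t. h 1 2 (of_real t)) \<longlongrightarrow> 0) (at_right 0)" "((\<lambda>t. h 2 2 (of_real t)) \<longlongrightarrow> 1) (at_right 0)"
  "((\<lambda>t. h 1 1 (- of_real t)) \<longlongrightarrow> 1) (at_right 0)" "((\<lambda>t. h 2 1 (- of_real t)) \<longlongrightarrow> 0) (at_right 0)"
  using h_lim_right[of 1 2] h_lim_right[of 2 2] h_lim_left[of 1 1] h_lim_left[of 2 1]
  by (simp_all add: mat_def)

text \<open>The mirror image of column 2 has limit (0, -1), so its sum with the column tends to 0
  along the positive axis and vanishes.\<close>

lemma col2_reality:
  assumes "0 < t" "t \<le> 1"
  shows "cnj (h 1 2 (of_real t)) = - h 1 2 (of_real t)" "cnj (h 2 2 (of_real t)) = h 2 2 (of_real t)"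
proof -
  have sol: "right_ray om l (of_real mu) {e..1} (\<lambda>t. h 1 2 (of_real t) + cnj (h 1 2 (of_real t))) (\<lambda>t. h 2 2 (of_real t) - cnj (h 2 2 (of_real t)))"
    if "e > 0" for e
  proof -
    have "right_ray om l (of_real mu) {e..1} (\<lambda>t. cnj (h 1 2 (of_real t))) (\<lambda>t. - cnj (h 2 2 (of_real t)))"
      by (rule lin2_sol_cnj[OF col2_right[OF that]]) (auto simp: kap_eq)
    from lin2_sol_combine[OF col2_right[OF that] this, of 1 1] show ?thesis by simp
  qed
  have l1: "((\<lambda>t. h 1 2 (of_real t) + cnj (h 1 2 (of_real t))) \<longlongrightarrow> 0 + cnj 0) (at_right 0)"
    "((\<lambda>t. h 2 2 (of_real t) - cnj (h 2 2 (of_real t))) \<longlongrightarrow> 1 - cnj 1) (at_right 0)"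
    by (intro tendsto_intros lims)+
  then have l2: "((\<lambda>t. h 1 2 (of_real t) + cnj (h 1 2 (of_real t))) \<longlongrightarrow> 0) (at_right 0)"
    "((\<lambda>t. h 2 2 (of_real t) - cnj (h 2 2 (of_real t))) \<longlongrightarrow> 0) (at_right 0)" by simp_all
  have "h 1 2 (of_real t) + cnj (h 1 2 (of_real t)) = 0" "h 2 2 (of_real t) - cnj (h 2 2 (of_real t)) = 0"
    using right_ray_null[OF sol _ l2 assms] mu by simp_all
  then show "cnj (h 1 2 (of_real t)) = - h 1 2 (of_real t)" "cnj (h 2 2 (of_real t)) = h 2 2 (of_real t)"
    by (simp_all add: add_eq_0_iff)
qed

text \<open>The mirror image of column 1 has the same limit (1, 0), so here the difference vanishes.
  The argument runs on the negative axis, where the diagonal of the reduced system is bounded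
  above.\<close>

lemma col1_reality:
  assumes "0 < t" "t \<le> 1"
  shows "cnj (h 1 1 (- of_real t)) = h 1 1 (- of_real t)" "cnj (h 2 1 (- of_real t)) = - h 2 1 (- of_real t)"
proof -
  have sol: "left_ray om l (of_real mu) {e..1} (\<lambda>t. h 1 1 (- of_real t) - cnj (h 1 1 (- of_real t))) (\<lambda>t. h 2 1 (- of_real t) + cnj (h 2 1 (- of_real t)))"
    if "e > 0" for e
  proof -
    have "left_ray om l (of_real mu) {e..1} (\<lambda>t. cnj (h 1 1 (- of_real t))) (\<lambda>t. - cnj (h 2 1 (- of_real t)))"
      by (rule lin2_sol_cnj[OF col1_left[OF that]]) (auto simp: kap_eq)
    from lin2_sol_combine[OF col1_left[OF that] this, of 1 "-1"] show ?thesis by simp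
  qed
  have l1: "((\<lambda>t. h 1 1 (- of_real t) - cnj (h 1 1 (- of_real t))) \<longlongrightarrow> 1 - cnj 1) (at_right 0)"
    "((\<lambda>t. h 2 1 (- of_real t) + cnj (h 2 1 (- of_real t))) \<longlongrightarrow> 0 + cnj 0) (at_right 0)"
    by (intro tendsto_intros lims)+
  then have l2: "((\<lambda>t. h 1 1 (- of_real t) - cnj (h 1 1 (- of_real t))) \<longlongrightarrow> 0) (at_right 0)"
    "((\<lambda>t. h 2 1 (- of_real t) + cnj (h 2 1 (- of_real t))) \<longlongrightarrow> 0) (at_right 0)" by simp_all
  have "h 1 1 (- of_real t) - cnj (h 1 1 (- of_real t)) = 0" "h 2 1 (- of_real t) + cnj (h 2 1 (- of_real t)) = 0"
    using left_ray_null[OF sol _ l2 assms] mu by simp_all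
  then show "cnj (h 1 1 (- of_real t)) = h 1 1 (- of_real t)" "cnj (h 2 1 (- of_real t)) = - h 2 1 (- of_real t)"
    by (simp_all add: add_eq_0_iff)
qed

text \<open>\<open>Kmat\<close> and \<open>Dmat\<close> have the same trace, so the determinant of
  \<open>H\<close> is constant along the positive axis, and its limit at 0 is 1.\<close>

lemma det_at_1: "h 1 1 1 * h 2 2 1 - h 1 2 1 * h 2 1 1 = 1"
proof -
  define d where "d z = h 1 1 z * h 2 2 z - h 1 2 z * h 2 1 z" for z
  have der: "(d has_field_derivative 0) (at z)" if "z \<in> S" for z
  proof -
    note D1 = h_derivs(1)[OF that, unfolded L_red_def] and D2 = h_derivs(2)[OF that, unfolded L_sol_def]
    have "(d has_field_derivative
       (kap om / z * h 2 1 z) * h 2 2 z + (kap om / z * h 1 2 z) * h 1 1 z -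
       ((kdiag l mu z * h 1 2 z + kap om / z * h 2 2 z) * h 2 1 z + (kap om / z * h 1 1 z - kdiag l mu z * h 2 1 z) * h 1 2 z)) (at z)"
      unfolding d_def
      by (intro DERIV_diff DERIV_mult conjunct1[OF D1] conjunct2[OF D1] conjunct1[OF D2] conjunct2[OF D2])
    then show ?thesis by (rule DERIV_cong) (simp add: algebra_simps)
  qed
  have eq: "d (of_real e) = d 1" if e: "0 < e" "e \<le> 1" for e
  proof -
    have "((\<lambda>t. d (of_real t)) has_vector_derivative 0) (at t within {e..1})" if "t \<in> {e..1}" for t
      using has_vector_derivative_real_field[OF der[OF upper_in_S], of t "{e..1}"] that e by simp
    then obtain c where "\<And>t. t \<in> {e..1} \<Longrightarrow> d (of_real t) = c"
      using has_vector_derivative_zero_constant[of "{e..1}" "\<lambda>t. d (of_real t)"] by auto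
    from this[of e] this[of 1] show ?thesis using e by simp
  qed
  have "((\<lambda>t. d (of_real t)) \<longlongrightarrow> (mat 1 :: complex^2^2) $ 1 $ 1 * (mat 1 :: complex^2^2) $ 2 $ 2
       - (mat 1 :: complex^2^2) $ 1 $ 2 * (mat 1 :: complex^2^2) $ 2 $ 1) (at_right 0)"
    unfolding d_def by (intro tendsto_intros h_lim_right)
  then have "((\<lambda>t. d (of_real t)) \<longlongrightarrow> 1) (at_right 0)" by (simp add: mat_def)
  moreover have "\<forall>\<^sub>F t in at_right 0. d (of_real t) = d 1"
    using eventually_at_right_less[of 0] eventually_at_right_real[of 0 1]
    by (auto elim!: eventually_elim2 intro!: eq)
  then have "((\<lambda>t. d (of_real t)) \<longlongrightarrow> d 1) (at_right 0)" by (rule tendsto_eventually)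
  ultimately show ?thesis using tendsto_unique[OF trivial_limit_at_right_real] unfolding d_def by blast
qed

lemma one_in_Sigma1: "1 \<in> Sigma1 S"
proof -
  have "1 \<in> S" by (rule upper_in_S) auto
  then have "1 \<in> S \<inter> Sminus S" by (auto simp: Sminus_def image_iff intro!: bexI[of _ 1])
  then show ?thesis by (simp add: Sigma1_def connected_component_refl)
qed

text \<open>\<open>Q\<close> is constant, so one point of \<open>Sigma1\<close> determines it. At
  \<open>z = 1\<close> both sides are built from the same matrix \<open>H 1\<close>, and Cramer's
  rule with determinant 1 turns the off-diagonal entries into sums of squares.\<close>

lemma Q_entries:
  fixes Q :: "complex^2^2"
  assumes "WplusMN l mu H 1 = What l mu H 1 ** Q"
  shows "Q $ 1 $ 2 = \<i> * ((h 1 2 1)\<^sup>2 + (h 2 2 1)\<^sup>2)" "Q $ 2 $ 1 = - \<i> * ((h 1 1 1)\<^sup>2 + (h 2 1 1)\<^sup>2)"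
proof -
  have "exp (- 2 * of_real pi * \<i> * of_nat l) = cis (- (2 * pi * real l))"
    by (simp add: cis_conv_exp mult_ac)
  also have "\<dots> = 1" using cis_multiple_2pi[of "- real l"] by simp
  finally have MN: "MN l = mat 1"
    unfolding MN_def mat2_def mat_def by (simp add: vec_eq_iff forall_2)
  have "expfac l mu 1 = 1" by (simp add: expfac_def)
  then have F: "Fmat l mu 1 = mat 1" unfolding Fmat_def mat2_def mat_def by (simp add: vec_eq_iff forall_2)
  have W: "WplusMN l mu H 1 = H 1" by (simp add: WplusMN_def F MN matrix_mul_rid)
  have Wh: "What l mu H 1 $ 1 $ j = \<i> * h 2 j 1" "What l mu H 1 $ 2 $ j = - \<i> * h 1 j 1" for j
    using W by (simp_all add: What_def \<open>expfac l mu 1 = 1\<close>)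
  have e: "h i j 1 = What l mu H 1 $ i $ 1 * Q $ 1 $ j + What l mu H 1 $ i $ 2 * Q $ 2 $ j" for i j
    using arg_cong[OF assms, of "\<lambda>M. M $ i $ j"] unfolding W by (simp add: matrix_matrix_mult_def sum_2)
  have u1: "h 1 1 1 = \<i> * h 2 1 1 * Q $ 1 $ 1 + \<i> * h 2 2 1 * Q $ 2 $ 1"
    and v1: "h 2 1 1 = - \<i> * h 1 1 1 * Q $ 1 $ 1 + - \<i> * h 1 2 1 * Q $ 2 $ 1"
    and u2: "h 1 2 1 = \<i> * h 2 1 1 * Q $ 1 $ 2 + \<i> * h 2 2 1 * Q $ 2 $ 2"
    and v2: "h 2 2 1 = - \<i> * h 1 1 1 * Q $ 1 $ 2 + - \<i> * h 1 2 1 * Q $ 2 $ 2"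
    using e[of 1 1, unfolded Wh] e[of 2 1, unfolded Wh] e[of 1 2, unfolded Wh] e[of 2 2, unfolded Wh] by -
  \<comment> \<open>Taking \<open>(w, w')\<close> to be column 1 removes the unknown
    \<open>x\<close>, and taking it to be column 2 removes \<open>y\<close>.\<close>
  have alg: "u * w + v * w' = \<i> * (v1 * w - u1 * w') * x + \<i> * (v2 * w - u2 * w') * y"
    if "u = \<i> * v1 * x + \<i> * v2 * y" "v = - \<i> * u1 * x + - \<i> * u2 * y" for u v w w' u1 v1 u2 v2 x y :: complex
    unfolding that by (simp add: algebra_simps)
  have "\<i> * (h 2 2 1 * h 1 1 1 - h 1 2 1 * h 2 1 1) * Q $ 2 $ 1 = \<i> * Q $ 2 $ 1"
    using det_at_1 by (simp add: mult.commute)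
  then have "(h 1 1 1)\<^sup>2 + (h 2 1 1)\<^sup>2 = \<i> * Q $ 2 $ 1"
    using alg[OF u1 v1, of "h 1 1 1" "h 2 1 1"] unfolding power2_eq_square by (simp only: mult.commute[of "h 2 1 1" "h 1 1 1"] diff_self mult_zero_right mult_zero_left add_0_left)
  then show "Q $ 2 $ 1 = - \<i> * ((h 1 1 1)\<^sup>2 + (h 2 1 1)\<^sup>2)" by simp
  have "\<i> * (h 2 1 1 * h 1 2 1 - h 1 1 1 * h 2 2 1) * Q $ 1 $ 2 = - \<i> * Q $ 1 $ 2"
  proof -
    have "h 2 1 1 * h 1 2 1 - h 1 1 1 * h 2 2 1 = - (h 1 1 1 * h 2 2 1 - h 1 2 1 * h 2 1 1)" by simp
    then show ?thesis unfolding det_at_1 by simp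
  qed
  then have "(h 1 2 1)\<^sup>2 + (h 2 2 1)\<^sup>2 = - \<i> * Q $ 1 $ 2"
    using alg[OF u2 v2, of "h 1 2 1" "h 2 2 1"] unfolding power2_eq_square by (simp only: mult.commute[of "h 2 2 1" "h 1 2 1"] diff_self mult_zero_right mult_zero_left add_0_right)
  then show "Q $ 1 $ 2 = \<i> * ((h 1 2 1)\<^sup>2 + (h 2 2 1)\<^sup>2)" by simp
qed

definition "p = Im (h 1 2 1)"
definition "t = Re (h 2 2 1)"

lemma col2_at_1: "h 1 2 1 = \<i> * of_real p" "h 2 2 1 = of_real t"
  using col2_reality[of 1] by (auto simp: p_def t_def complex_eq_iff)

lemma det_real: "h 1 1 1 * of_real t - \<i> * of_real p * h 2 1 1 = 1"
  using det_at_1 by (simp add: col2_at_1)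

lemma det_parts: "Re (h 1 1 1) * t + p * Im (h 2 1 1) = 1" "Im (h 1 1 1) * t = p * Re (h 2 1 1)"
  using det_real by (simp_all add: complex_eq_iff)

text \<open>In the next lemma \<open>\<tau>\<close> is half a Stokes multiplier at \<open>0\<close>; \<open>alpha\<close> is the real part of the entry \<open>a\<close> of
  the transition matrix.\<close>

definition "alpha = Re (h 1 1 1) * p + Im (h 2 1 1) * t"

lemma obtains_tau:
  obtains \<tau> where "Im (h 1 1 1) = \<tau> * p" "Re (h 2 1 1) = \<tau> * t"
    "Im ((h 1 1 1)\<^sup>2 + (h 2 1 1)\<^sup>2) = 2 * \<tau> * alpha"
proof -
  have nz: "p\<^sup>2 + t\<^sup>2 > 0"
    using det_parts(1) by (auto simp: sum_power2_gt_zero_iff)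
  \<comment> \<open>The imaginary part of the determinant relation says that
    \<open>(Im (h 1 1 1), Re (h 2 1 1))\<close> is parallel to the nonzero vector
    \<open>(p, t)\<close>; \<open>\<tau>\<close> is the factor, found by projection.\<close>
  define \<tau> where "\<tau> = (Im (h 1 1 1) * p + Re (h 2 1 1) * t) / (p\<^sup>2 + t\<^sup>2)"
  have "Im (h 1 1 1) * (p\<^sup>2 + t\<^sup>2) = Im (h 1 1 1) * p * p + (Im (h 1 1 1) * t) * t"
    by (simp add: power2_eq_square algebra_simps)
  also have "\<dots> = (Im (h 1 1 1) * p + Re (h 2 1 1) * t) * p"
    unfolding det_parts(2) by (simp add: algebra_simps)
  finally have 1: "Im (h 1 1 1) * (p\<^sup>2 + t\<^sup>2) = (Im (h 1 1 1) * p + Re (h 2 1 1) * t) * p" .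
  have "Re (h 2 1 1) * (p\<^sup>2 + t\<^sup>2) = (p * Re (h 2 1 1)) * p + Re (h 2 1 1) * t * t"
    by (simp add: power2_eq_square algebra_simps)
  also have "\<dots> = (Im (h 1 1 1) * p + Re (h 2 1 1) * t) * t"
    unfolding det_parts(2)[symmetric] by (simp add: algebra_simps)
  finally have 2: "Re (h 2 1 1) * (p\<^sup>2 + t\<^sup>2) = (Im (h 1 1 1) * p + Re (h 2 1 1) * t) * t" .
  have "Im (h 1 1 1) = \<tau> * p" "Re (h 2 1 1) = \<tau> * t"
    unfolding \<tau>_def times_divide_eq_left 1[symmetric] 2[symmetric] using nz by auto
  moreover from this have "Im ((h 1 1 1)\<^sup>2 + (h 2 1 1)\<^sup>2) = 2 * \<tau> * alpha"
    by (simp add: power2_eq_square alpha_def algebra_simps)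
  ultimately show ?thesis by (rule that)
qed

end


section \<open>Real first columns: constrictions, and Taylor expansion at 0\<close>

context normalised
begin

lemma expfac_minus_1: "expfac l m (-1) = of_real ((-1) ^ l)"
  by (simp add: expfac_def power_inverse[symmetric])

lemma col1_circle:
  assumes "0 \<le> om * s" "om * s \<le> pi"
  shows "L_sol om l mu (\<lambda>z. expfac l mu z * h 1 1 z) (\<lambda>z. expfac l mu z * h 2 1 z) (cis (om * s))"
  by (intro L_sol_of_L_red h_derivs upper_in_S) (use assms sin_ge_zero in auto)

text \<open>In the time \<open>s\<close> with \<open>z = cis (om * s)\<close>, (L) is the linearised
  Josephson equation. The solution starting as column 1 at \<open>1\<close> is mirror symmetric at
  half a period, so its end value is the mirror image of its initial value; the scalar monodromy
  makes this a multiple of the initial value.\<close>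

lemma constriction_imp_reality:
  assumes "constriction om (om * real l) (2 * om * mu)"
  shows "Im (h 1 1 1) = 0" "Re (h 2 1 1) = 0"
proof -
  define T where "T = 2 * pi / om"
  have T: "T > 0" "T / 2 = pi / om" using om by (simp_all add: T_def)
  let ?a = "\<lambda>s. - \<i> * of_real (om * real l + 2 * om * mu * cos (om * s))"
  have cont: "continuous_on X ?a" "continuous_on X (\<lambda>_. 1 / 2 :: complex)" "continuous_on X (\<lambda>_. 0 :: complex)" for X
    by (intro continuous_intros)+
  define f1 where "f1 s = expfac l mu (cis (om * s)) * h 1 1 (cis (om * s))" for s
  define f2 where "f2 s = expfac l mu (cis (om * s)) * h 2 1 (cis (om * s))" for s
  have half: "\<i> * of_real om * kap om = 1 / 2" using om by (simp add: kap_def)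
  have f: "lin2_sol ?a (\<lambda>_. 1 / 2) (\<lambda>_. 1 / 2) (\<lambda>_. 0) (\<lambda>_. 0) (\<lambda>_. 0) {0..T/2} f1 f2"
    unfolding lin2_sol_def
  proof (intro ballI conjI)
    fix s assume s: "s \<in> {0..T/2}"
    then have "0 \<le> om * s" "om * s \<le> pi" using om unfolding T(2) by (auto simp: field_simps)
    then have "L_sol om l mu (\<lambda>z. expfac l mu z * h 1 1 z) (\<lambda>z. expfac l mu z * h 2 1 z) (cis (0 + om * s))"
      using col1_circle[of s] by simp
    note D = circle_of_L_sol[OF this, of "{0..T/2}", unfolded half]
    have e: "- \<i> * of_real om * (of_nat l + 2 * of_real mu * of_real (cos (0 + om * s))) = ?a s"
      by (simp add: algebra_simps)
    show "(f1 has_vector_derivative ?a s * f1 s + 1 / 2 * f2 s + 0) (at s within {0..T/2})"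
      using D(1) unfolding e f1_def f2_def by simp
    show "(f2 has_vector_derivative 1 / 2 * f1 s + 0 * f2 s + 0) (at s within {0..T/2})"
      using D(2) unfolding f1_def f2_def by simp
  qed
  have T0: "0 \<le> T" using T by simp
  \<comment> \<open>\<open>H\<close> is used only on the upper half circle; past
    \<open>z = -1\<close> the solution is continued by the differential equation.\<close>
  obtain U V where UV: "U 0 = f1 0" "V 0 = f2 0"
    "lin2_sol ?a (\<lambda>_. 1 / 2) (\<lambda>_. 1 / 2) (\<lambda>_. 0) (\<lambda>_. 0) (\<lambda>_. 0) {0..T} U V"
    using lin2_sol_exists[OF T0 cont(1,2,2,3,3,3), of "f1 0" "f2 0"] by metis
  have f0: "f1 0 = h 1 1 1" "f2 0 = h 2 1 1" by (simp_all add: f1_def f2_def expfac_def)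
  have "lin2_sol ?a (\<lambda>_. 1 / 2) (\<lambda>_. 1 / 2) (\<lambda>_. 0) (\<lambda>_. 0) (\<lambda>_. 0) {0..T/2} U V"
    by (rule lin2_sol_subset[OF UV(3)]) (use T in auto)
  note eq = lin2_sol_unique[OF this f cont(1,2,2,3) UV(1,2), of "T / 2"]
  have hT: "om * (T / 2) = pi" using om by (simp add: T_def)
  have mid: "cnj (U (T / 2)) = U (T / 2)" "- cnj (V (T / 2)) = V (T / 2)"
    using eq T col1_reality[of 1] unfolding f1_def f2_def hT by (simp_all add: expfac_minus_1)
  let ?U = "\<lambda>s. cnj (U (0 + T - s))" and ?V = "\<lambda>s. - cnj (V (0 + T - s))"
  have "cos (om * (T - s)) = cos (om * s)" for s
  proof -
    have "om * (T - s) = 2 * pi - om * s" using om by (simp add: T_def right_diff_distrib)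
    then show ?thesis by (simp add: cos_diff)
  qed
  then have R: "lin2_sol ?a (\<lambda>_. 1 / 2) (\<lambda>_. 1 / 2) (\<lambda>_. 0) (\<lambda>_. 0) (\<lambda>_. 0) {0..T} ?U ?V"
    by (intro lin2_sol_cnj[OF lin2_sol_reverse[OF UV(3)]]) auto
  have sub: "{T/2..T} \<subseteq> {0..T}" using T(1) by auto
  have "T / 2 = 0 + T - T / 2" by simp
  then have p1: "U (T / 2) = ?U (T / 2)" "V (T / 2) = ?V (T / 2)" using mid by simp_all
  have p2: "T \<in> {T/2..T}" using T(1) by (simp only: atLeastAtMost_iff) linarith
  have UT: "U T = cnj (U 0)" "V T = - cnj (V 0)"
    using lin2_sol_unique[OF lin2_sol_subset[OF UV(3) sub] lin2_sol_subset[OF R sub] cont(1,2,2,3) p1 p2]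
    by simp_all
  obtain c where "\<forall>u v. jlin_sol om (om * real l) (2 * om * mu) u v \<longrightarrow> u T = c * u 0 \<and> v T = c * v 0"
    using constriction_imp_scalar_monodromy[OF om assms] unfolding T_def by blast
  from this[rule_format, OF UV(3)[unfolded T_def]]
  have c: "cnj (h 1 1 1) = c * h 1 1 1" "- cnj (h 2 1 1) = c * h 2 1 1"
    unfolding UV(1,2) UT f0 by simp_all
  \<comment> \<open>Conjugating the determinant relation multiplies both entries of column 1 by
    \<open>c\<close>, hence \<open>c = 1\<close>.\<close>
  have "cnj (h 1 1 1) * of_real t - \<i> * of_real p * - cnj (h 2 1 1) = 1"
    using arg_cong[OF det_real, of cnj] by simp
  then have "c * (h 1 1 1 * of_real t - \<i> * of_real p * h 2 1 1) = 1"
    unfolding c by (simp only: right_diff_distrib mult_ac)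
  then have "c = 1" unfolding det_real by simp
  with c
  show "Im (h 1 1 1) = 0" "Re (h 2 1 1) = 0"
    by (simp_all add: complex_eq_iff)
qed

text \<open>Reality at \<open>1\<close> is carried towards 0 by uniqueness for the differential
  equation; the limit at 0 would not give it on the positive axis.\<close>

lemma col1_reality_right:
  assumes "Im (h 1 1 1) = 0" "Re (h 2 1 1) = 0" "0 < s" "s \<le> 1"
  shows "cnj (h 1 1 (of_real s)) = h 1 1 (of_real s)" "cnj (h 2 1 (of_real s)) = - h 2 1 (of_real s)"
proof -
  let ?b = "\<lambda>s. kap om / of_real s" and ?d = "\<lambda>s. - kdiag l mu (of_real s)"
  have sol: "lin2_sol (\<lambda>_. 0) ?b ?b ?d (\<lambda>_. 0) (\<lambda>_. 0) {s..1} (\<lambda>s. h 1 1 (of_real s)) (\<lambda>s. h 2 1 (of_real s))"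
    unfolding lin2_sol_def
  proof (intro ballI conjI)
    fix r assume "r \<in> {s..1}"
    then have "of_real r \<in> S" using assms by (intro upper_in_S) auto
    note D = h_derivs(1)[OF this, unfolded L_red_def]
    show "((\<lambda>s. h 1 1 (of_real s)) has_vector_derivative 0 * h 1 1 (of_real r) + ?b r * h 2 1 (of_real r) + 0) (at r within {s..1})"
      using has_vector_derivative_real_field[OF conjunct1[OF D]] by simp
    show "((\<lambda>s. h 2 1 (of_real s)) has_vector_derivative ?b r * h 1 1 (of_real r) + ?d r * h 2 1 (of_real r) + 0) (at r within {s..1})"
      using has_vector_derivative_real_field[OF conjunct2[OF D]] by simp
  qed
  have sol': "lin2_sol (\<lambda>_. 0) ?b ?b ?d (\<lambda>_. 0) (\<lambda>_. 0) {s..1} (\<lambda>s. cnj (h 1 1 (of_real s))) (\<lambda>s. - cnj (h 2 1 (of_real s)))"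
    by (rule lin2_sol_cnj[OF sol]) (auto simp: kap_eq kdiag_def)
  have cont: "continuous_on {s..1} (\<lambda>_. 0 :: complex)" "continuous_on {s..1} ?b" "continuous_on {s..1} ?d"
    unfolding kdiag_def using assms(3) by (auto intro!: continuous_intros)
  have "cnj (h 1 1 1) = h 1 1 1" "- cnj (h 2 1 1) = h 2 1 1" using assms by (auto simp: complex_eq_iff)
  then have "cnj (h 1 1 (of_real s)) = h 1 1 (of_real s)" "- cnj (h 2 1 (of_real s)) = h 2 1 (of_real s)"
    using lin2_sol_unique_backward[OF sol' sol cont(1,2,2,3), of s] assms by simp_all
  then show "cnj (h 1 1 (of_real s)) = h 1 1 (of_real s)" "cnj (h 2 1 (of_real s)) = - h 2 1 (of_real s)"
    by (auto simp: complex_eq_iff)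
qed

text \<open>Reality on both half-axes allows Schwarz reflection across the whole diameter; the limit
  within \<open>S\<close> supplies the continuity at 0.\<close>

lemma reflection_holomorphic:
  assumes lim: "(f \<longlongrightarrow> c) (at 0 within S)" and hol: "f holomorphic_on S" and c: "cnj c = c"
    and re: "\<And>s. 0 < s \<Longrightarrow> s < 1 \<Longrightarrow> cnj (f (of_real s)) = f (of_real s)"
      "\<And>s. 0 < s \<Longrightarrow> s < 1 \<Longrightarrow> cnj (f (- of_real s)) = f (- of_real s)"
  obtains F where "F holomorphic_on ball 0 1" "\<And>z. Im z > 0 \<Longrightarrow> F z = f z" "F 0 = c"
proof -
  define g where "g z = (if z = 0 then c else f z)" for z
  define F where "F = (\<lambda>z. if 0 \<le> Im z then g z else cnj (g (cnj z)))"
  have "F holomorphic_on ball 0 1"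
    unfolding F_def
  proof (rule Schwarz_reflection)
    have sub: "ball 0 1 \<inter> {z. 0 < Im z} \<subseteq> S" by (auto intro: upper_in_S)
    show "g holomorphic_on ball 0 1 \<inter> {z. 0 < Im z}"
      by (rule holomorphic_transform[OF holomorphic_on_subset[OF hol sub]]) (auto simp: g_def)
    show "continuous_on (ball 0 1 \<inter> {z. 0 \<le> Im z}) g"
      unfolding continuous_on_eq_continuous_within
    proof
      fix z assume z: "z \<in> ball 0 1 \<inter> {z. 0 \<le> Im z}"
      show "continuous (at z within ball 0 1 \<inter> {z. 0 \<le> Im z}) g"
      proof (cases "z = 0")
        case False
        then have "z \<in> S" using z by (auto intro: upper_in_S)
        then have "isCont f z" using hol open_S by (metis holomorphic_on_imp_continuous_on continuous_on_eq_continuous_at)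
        moreover have "\<forall>\<^sub>F w in nhds z. f w = g w"
          using t1_space_nhds[OF False] by eventually_elim (auto simp: g_def)
        ultimately have "isCont g z" by (simp add: isCont_cong)
        then show ?thesis by (rule continuous_at_imp_continuous_at_within)
      next
        case True
        have "filterlim (\<lambda>w. w) (at 0 within S) (at 0 within ball 0 1 \<inter> {z. 0 \<le> Im z})"
          unfolding filterlim_at
        proof
          show "\<forall>\<^sub>F w in at 0 within ball 0 1 \<inter> {z. 0 \<le> Im z}. w \<in> S \<and> w \<noteq> 0"
            unfolding eventually_at_filter by (rule always_eventually) (auto intro: upper_in_S)
        qed (rule tendsto_ident_at)
        from filterlim_compose[OF lim this]
        have "(f \<longlongrightarrow> c) (at 0 within ball 0 1 \<inter> {z. 0 \<le> Im z})" .
        moreover have "\<forall>\<^sub>F w in at 0 within ball 0 1 \<inter> {z. 0 \<le> Im z}. f w = g w"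
          unfolding eventually_at_filter by (rule always_eventually) (auto simp: g_def)
        ultimately have "(g \<longlongrightarrow> c) (at 0 within ball 0 1 \<inter> {z. 0 \<le> Im z})"
          by (simp add: tendsto_cong)
        then show ?thesis unfolding True continuous_within by (simp add: g_def)
      qed
    qed
    show "g z \<in> \<real>" if z: "z \<in> ball 0 1" "z \<in> \<real>" for z
    proof -
      obtain r where r: "z = of_real r" using z(2) by (auto elim: Reals_cases)
      have r1: "\<bar>r\<bar> < 1" using z(1) by (simp add: r)
      consider "r = 0" | "r > 0" | "r < 0" by linarith
      then have "cnj (g z) = g z"
        using re(1)[of r] re(2)[of "- r"] r1 c by cases (auto simp: g_def r)
      then show ?thesis by (simp add: Reals_cnj_iff)
    qed
  qed auto
  moreover have "F z = f z" if "Im z > 0" for z using that by (auto simp: F_def g_def)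
  moreover have "F 0 = c" by (simp add: F_def g_def)
  ultimately show ?thesis by (rule that)
qed

text \<open>A first column that is mirror symmetric on both half-axes extends holomorphically
  through the singular point, so the reduced system has a convergent power series solution.
  Eliminating the coefficients of the first component leaves the recurrence.\<close>

lemma real_imp_bounded_recurrence:
  assumes "Im (h 1 1 1) = 0" "Re (h 2 1 1) = 0"
  obtains y M where "y 0 = 0" "y 1 \<noteq> 0"
    "\<And>k. of_real mu * (y (Suc (Suc k)) + y k) = of_real (real (Suc k) - real l + (1 / (2 * om))\<^sup>2 / real (Suc k)) * y (Suc k)"
    "\<And>k. cmod (y k) \<le> M * 2 ^ k"
proof -
  have hol: "h i j holomorphic_on S" for i j using nrm unfolding is_normaliser_def by blast
  obtain U where U: "U holomorphic_on ball 0 1" "\<And>z. Im z > 0 \<Longrightarrow> U z = h 1 1 z" "U 0 = 1"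
  proof (rule reflection_holomorphic[of "h 1 1" 1])
    show "(h 1 1 \<longlongrightarrow> 1) (at 0 within S)" using h_lim[of 1 1] by (simp add: mat_def)
    show "cnj (h 1 1 (of_real s)) = h 1 1 (of_real s)" if "0 < s" "s < 1" for s
      using col1_reality_right(1)[OF assms, of s] that by simp
    show "cnj (h 1 1 (- of_real s)) = h 1 1 (- of_real s)" if "0 < s" "s < 1" for s
      using col1_reality(1)[of s] that by simp
  qed (use hol in auto)
  \<comment> \<open>The second component is imaginary on the axis; the factor \<open>\<i>\<close>
    makes it real for the reflection.\<close>
  obtain G where G: "G holomorphic_on ball 0 1" "\<And>z. Im z > 0 \<Longrightarrow> G z = \<i> * h 2 1 z" "G 0 = 0"
  proof (rule reflection_holomorphic[of "\<lambda>z. \<i> * h 2 1 z" 0])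
    have "((\<lambda>z. \<i> * h 2 1 z) \<longlongrightarrow> \<i> * 0) (at 0 within S)" using h_lim[of 2 1] by (intro tendsto_intros) (simp add: mat_def)
    then show "((\<lambda>z. \<i> * h 2 1 z) \<longlongrightarrow> 0) (at 0 within S)" by simp
    show "cnj (\<i> * h 2 1 (of_real s)) = \<i> * h 2 1 (of_real s)" if "0 < s" "s < 1" for s
      using col1_reality_right(2)[OF assms, of s] that by simp
    show "cnj (\<i> * h 2 1 (- of_real s)) = \<i> * h 2 1 (- of_real s)" if "0 < s" "s < 1" for s
      using col1_reality(2)[of s] that by simp
  qed (use hol in \<open>auto intro!: holomorphic_intros\<close>)
  define V where "V z = - \<i> * G z" for z
  have V: "V holomorphic_on ball 0 1" "\<And>z. Im z > 0 \<Longrightarrow> V z = h 2 1 z"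
    unfolding V_def using G by (auto intro!: holomorphic_intros)
  define \<kappa> where "\<kappa> = kap om"
  let ?X = "ball 0 1 \<inter> {z. 0 < Im z} :: complex set"
  have oX: "open ?X" by (intro open_Int open_ball open_halfspace_Im_gt)
  have neX: "?X \<noteq> {}"
  proof -
    have "\<i> / 2 \<in> ?X" by (simp add: norm_divide)
    then show ?thesis by blast
  qed
  have der: "deriv U z = \<kappa> / z * h 2 1 z" "deriv V z = \<kappa> / z * h 1 1 z - kdiag l mu z * h 2 1 z"
    if z: "z \<in> ?X" for z
  proof -
    have zS: "z \<in> S" using z by (intro upper_in_S) auto
    note D = h_derivs(1)[OF zS, unfolded L_red_def, folded \<kappa>_def]
    have "(U has_field_derivative \<kappa> / z * h 2 1 z) (at z)"
      by (rule has_field_derivative_transform_within_open[OF conjunct1[OF D] oX z]) (simp add: U)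
    then show "deriv U z = \<kappa> / z * h 2 1 z" by (rule DERIV_imp_deriv)
    have "(V has_field_derivative \<kappa> / z * h 1 1 z - kdiag l mu z * h 2 1 z) (at z)"
      by (rule has_field_derivative_transform_within_open[OF conjunct2[OF D] oX z]) (simp add: V)
    then show "deriv V z = \<kappa> / z * h 1 1 z - kdiag l mu z * h 2 1 z" by (rule DERIV_imp_deriv)
  qed
  \<comment> \<open>Clearing the poles makes both sides holomorphic on the disc, so the identity
    spreads from the upper half disc.\<close>
  have ode1: "z * deriv U z = \<kappa> * V z" if "z \<in> ball 0 1" for z
  proof (rule analytic_continuation_open[OF oX open_ball neX connected_ball _ _ _ _ that])
    show "z * deriv U z = \<kappa> * V z" if "z \<in> ?X" for z
      using that by (auto simp: der V)
  qed (use U V in \<open>auto intro!: holomorphic_intros holomorphic_deriv\<close>)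
  have ode2: "z ^ 2 * deriv V z = \<kappa> * (z * U z) + of_nat l * (z * V z) + of_real mu * V z + of_real mu * (z ^ 2 * V z)"
    if "z \<in> ball 0 1" for z
  proof (rule analytic_continuation_open[OF oX open_ball neX connected_ball _ _ _ _ that])
    show "z ^ 2 * deriv V z = \<kappa> * (z * U z) + of_nat l * (z * V z) + of_real mu * V z + of_real mu * (z ^ 2 * V z)"
      if "z \<in> ?X" for z
    proof -
      have z: "z \<noteq> 0" "Im z > 0" using that by auto
      show ?thesis unfolding der(2)[OF that] U(2)[OF z(2)] V(2)[OF z(2)] kdiag_def
        using z(1) by (simp add: field_simps power2_eq_square)
    qed
  qed (use U V in \<open>auto intro!: holomorphic_intros holomorphic_deriv\<close>)
  define FU where "FU = fps_expansion U 0"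
  define FV where "FV = fps_expansion V 0"
  have FU: "U has_fps_expansion FU" unfolding FU_def using U by (intro has_fps_expansion_fps_expansion[of "ball 0 1"]) auto
  have FV: "V has_fps_expansion FV" unfolding FV_def using V by (intro has_fps_expansion_fps_expansion[of "ball 0 1"]) auto
  have ball: "\<forall>\<^sub>F z in nhds 0. z \<in> ball (0::complex) 1" by (rule eventually_nhds_in_open) auto
  have e1: "fps_X * fps_deriv FU = fps_const \<kappa> * FV"
  proof (rule fps_expansion_unique_complex)
    show "(\<lambda>z. z * deriv U z) has_fps_expansion fps_X * fps_deriv FU"
      by (intro fps_expansion_intros FU)
    have "\<forall>\<^sub>F z in nhds 0. z * deriv U z = \<kappa> * V z" using ball by eventually_elim (rule ode1)
    then show "(\<lambda>z. z * deriv U z) has_fps_expansion fps_const \<kappa> * FV"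
      by (subst has_fps_expansion_cong[OF _ refl]) (auto intro!: fps_expansion_intros FV)
  qed
  have e2: "fps_X ^ 2 * fps_deriv FV = fps_const \<kappa> * (fps_X * FU) + fps_const (of_nat l) * (fps_X * FV)
      + fps_const (of_real mu) * FV + fps_const (of_real mu) * (fps_X ^ 2 * FV)"
  proof (rule fps_expansion_unique_complex)
    show "(\<lambda>z. z ^ 2 * deriv V z) has_fps_expansion fps_X ^ 2 * fps_deriv FV"
      by (intro fps_expansion_intros FV)
    have "\<forall>\<^sub>F z in nhds 0. z ^ 2 * deriv V z = \<kappa> * (z * U z) + of_nat l * (z * V z) + of_real mu * V z + of_real mu * (z ^ 2 * V z)"
      using ball by eventually_elim (rule ode2)
    then show "(\<lambda>z. z ^ 2 * deriv V z) has_fps_expansion fps_const \<kappa> * (fps_X * FU) + fps_const (of_nat l) * (fps_X * FV)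
      + fps_const (of_real mu) * FV + fps_const (of_real mu) * (fps_X ^ 2 * FV)"
      by (subst has_fps_expansion_cong[OF _ refl]) (auto intro!: fps_expansion_intros FU FV)
  qed
  define x where "x = fps_nth FU"
  define y where "y = fps_nth FV"
  have \<kappa>0: "\<kappa> \<noteq> 0" using om by (simp add: \<kappa>_def kap_nonzero)
  have \<kappa>2: "\<kappa> * \<kappa> = - of_real ((1 / (2 * om))\<^sup>2)" by (simp add: \<kappa>_def kap_eq power2_eq_square)
  have x0: "x 0 = 1" using U(3) by (simp add: x_def FU_def fps_expansion_def)
  have y0: "y 0 = 0" using arg_cong[OF e1, of "\<lambda>F. fps_nth F 0"] \<kappa>0 by (simp add: y_def)
  have xS: "of_nat (Suc k) * x (Suc k) = \<kappa> * y (Suc k)" for k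
    using arg_cong[OF e1, of "\<lambda>F. fps_nth F (Suc k)"] by (simp add: x_def y_def)
  \<comment> \<open>The coefficient of \<open>z\<close> reads \<open>mu * y 1 = - \<kappa>\<close>,
    which excludes the zero solution of the recurrence.\<close>
  have "0 = \<kappa> * x 0 + of_nat l * y 0 + of_real mu * y 1"
    using arg_cong[OF e2, of "\<lambda>F. fps_nth F 1"] by (simp add: x_def y_def fps_X_power_mult_nth)
  then have y1: "y 1 \<noteq> 0" using x0 y0 \<kappa>0 by auto
  have yS: "of_nat (Suc k) * y (Suc k) = \<kappa> * x (Suc k) + of_nat l * y (Suc k) + of_real mu * y (Suc (Suc k)) + of_real mu * y k" for k
    using arg_cong[OF e2, of "\<lambda>F. fps_nth F (Suc (Suc k))"] by (simp add: x_def y_def fps_X_power_mult_nth)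
  have rec: "of_real mu * (y (Suc (Suc k)) + y k) = of_real (real (Suc k) - real l + (1 / (2 * om))\<^sup>2 / real (Suc k)) * y (Suc k)" for k
  proof -
    have n0: "(of_nat (Suc k) :: complex) \<noteq> 0" by (simp only: of_nat_eq_0_iff)
    have "x (Suc k) = \<kappa> * y (Suc k) / of_nat (Suc k)" using xS[of k] n0 by (simp add: field_simps del: of_nat_Suc)
    then have "\<kappa> * x (Suc k) = - of_real ((1 / (2 * om))\<^sup>2) * y (Suc k) / of_nat (Suc k)"
      using \<kappa>2 by (metis (no_types, lifting) mult.assoc times_divide_eq_right)
    then have "of_real mu * y (Suc (Suc k)) + of_real mu * y k = of_nat (Suc k) * y (Suc k) - of_nat l * y (Suc k)
       + of_real ((1 / (2 * om))\<^sup>2) / of_nat (Suc k) * y (Suc k)"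
      using yS[of k] by (simp add: algebra_simps del: of_nat_Suc)
    then show ?thesis by (simp add: algebra_simps del: of_nat_Suc)
  qed
  \<comment> \<open>Convergence at 1/2, inside the disc of holomorphy, limits the growth to
    \<open>2 ^ n\<close>.\<close>
  have "(\<lambda>n. (deriv ^^ n) V 0 / fact n * (1 / 2 - 0) ^ n) sums V (1 / 2)"
    by (rule holomorphic_power_series[OF V(1)]) (simp add: norm_divide)
  then have "(\<lambda>n. y n * (1 / 2) ^ n) \<longlonglongrightarrow> 0"
    by (intro summable_LIMSEQ_zero) (auto simp: y_def FV_def fps_expansion_def sums_iff)
  then have "Bseq (\<lambda>n. y n * (1 / 2) ^ n)" by (intro convergent_imp_Bseq convergentI)
  then obtain M where M: "\<And>n. cmod (y n * (1 / 2) ^ n) \<le> M" by (auto simp: Bseq_def)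
  have "cmod (y n) \<le> M * 2 ^ n" for n
    using M[of n] by (simp add: norm_mult norm_power norm_divide field_simps)
  with y0 y1 rec show ?thesis by (rule that)
qed

end


section \<open>Holomorphic dependence of the transition matrix\<close>


lemma tendsto_zero_of_sum_squares_le:
  fixes x y :: "nat \<Rightarrow> complex"
  assumes "\<And>n. (cmod (x n))\<^sup>2 + (cmod (y n))\<^sup>2 \<le> b n" "b \<longlonglongrightarrow> 0"
  shows "x \<longlonglongrightarrow> 0" "y \<longlonglongrightarrow> 0"
proof -
  have s: "(\<lambda>n. sqrt (b n)) \<longlonglongrightarrow> 0"
    using tendsto_real_sqrt[OF assms(2)] by simp
  have "cmod (x n) \<le> sqrt (b n)" "cmod (y n) \<le> sqrt (b n)" for n
    using assms(1)[of n] zero_le_power2[of "cmod (x n)"] zero_le_power2[of "cmod (y n)"]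
    by (intro real_le_rsqrt; linarith)+
  then show "x \<longlonglongrightarrow> 0" "y \<longlonglongrightarrow> 0"
    by (auto intro!: Lim_null_comparison[OF _ s] always_eventually)
qed

text \<open>The solutions that start at distance \<open>1 / n\<close> from the singular point depend
  holomorphically on the parameter, are locally uniformly bounded by the energy estimates, and
  converge for real parameters to the normalised ones; Montel's theorem does the rest.\<close>

lemma transition_entry_holomorphic:
  fixes S :: "real \<Rightarrow> complex set" and H :: "real \<Rightarrow> complex \<Rightarrow> complex^2^2"
  assumes nrm: "\<And>mu. mu > 0 \<Longrightarrow> normalised om l mu (S mu) (H mu)"
  obtains G where "G holomorphic_on {\<mu>. Re \<mu> > 0}"
    "\<And>mu. mu > 0 \<Longrightarrow> G (of_real mu) = - \<i> * (H mu 1 $ 1 $ 1 * H mu 1 $ 1 $ 2 + H mu 1 $ 2 $ 1 * H mu 1 $ 2 $ 2)"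
proof -
  define e where "e n = 1 / real (Suc n)" for n
  have e: "e n > 0" "e n \<le> 1" for n by (simp_all add: e_def)
  have e_lim: "filterlim e (at_right 0) sequentially"
  proof -
    have "e = (\<lambda>n. inverse (real (Suc n)))" by (simp add: e_def inverse_eq_divide fun_eq_iff)
    then have "e \<longlonglongrightarrow> 0" using LIMSEQ_inverse_real_of_nat by simp
    then show ?thesis unfolding filterlim_at using e by (auto intro!: always_eventually simp: less_imp_neq[symmetric])
  qed
  \<comment> \<open>The initial values (0, 1) here and (1, 0) for \<open>L\<close> below are the
    limits of the two columns at 0.\<close>
  define R where "R n U V \<longleftrightarrow> U holomorphic_on UNIV \<and> V holomorphic_on UNIV \<and>
    (\<forall>\<mu>. \<exists>u v. right_ray om l \<mu> {e n..1} u v \<and> u (e n) = 0 \<and> v (e n) = 1 \<and> u 1 = U \<mu> \<and> v 1 = V \<mu>)" for n U V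
  have "\<exists>U V. R n U V" for n
    unfolding R_def
    by (rule lin2_sol_holomorphic[OF e(2) right_ray_continuous(1,2,3,3)[OF e(1)] continuous_on_const continuous_on_const,
        where ?u0.0 = 0 and ?v0.0 = 1]) blast
  then obtain RU RV where "\<And>n. R n (RU n) (RV n)" by metis
  then have R: "\<And>n. RU n holomorphic_on UNIV" "\<And>n. RV n holomorphic_on UNIV"
    "\<And>n \<mu>. \<exists>u v. right_ray om l \<mu> {e n..1} u v \<and> u (e n) = 0 \<and> v (e n) = 1 \<and> u 1 = RU n \<mu> \<and> v 1 = RV n \<mu>"
    unfolding R_def by blast+
  define L where "L n U V \<longleftrightarrow> U holomorphic_on UNIV \<and> V holomorphic_on UNIV \<and>
    (\<forall>\<mu>. \<exists>u v. left_ray om l \<mu> {e n..1} u v \<and> u (e n) = 1 \<and> v (e n) = 0 \<and> u 1 = U \<mu> \<and> v 1 = V \<mu>)" for n U V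
  have "\<exists>U V. L n U V" for n
    unfolding L_def
    by (rule lin2_sol_holomorphic[OF e(2) continuous_on_const continuous_on_const right_ray_continuous(3,3,4,2)[OF e(1)],
        where ?u0.0 = 1 and ?v0.0 = 0]) blast
  then obtain LU LV where "\<And>n. L n (LU n) (LV n)" by metis
  then have L: "\<And>n. LU n holomorphic_on UNIV" "\<And>n. LV n holomorphic_on UNIV"
    "\<And>n \<mu>. \<exists>u v. left_ray om l \<mu> {e n..1} u v \<and> u (e n) = 1 \<and> v (e n) = 0 \<and> u 1 = LU n \<mu> \<and> v 1 = LV n \<mu>"
    unfolding L_def by blast+
  obtain T1 T2 where T: "T1 holomorphic_on UNIV" "T2 holomorphic_on UNIV"
    "\<And>\<mu>. \<exists>u v. arc_sol om l \<mu> u v \<and> u 0 = 1 \<and> v 0 = 0 \<and> u pi = T1 \<mu> \<and> v pi = T2 \<mu>"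
    by (rule lin2_sol_holomorphic[OF pi_ge_zero arc_continuous(1,2,3,3,4,4), where ?u0.0 = 1 and ?v0.0 = 0]) blast
  obtain T3 T4 where T': "T3 holomorphic_on UNIV" "T4 holomorphic_on UNIV"
    "\<And>\<mu>. \<exists>u v. arc_sol om l \<mu> u v \<and> u 0 = 0 \<and> v 0 = 1 \<and> u pi = T3 \<mu> \<and> v pi = T4 \<mu>"
    by (rule lin2_sol_holomorphic[OF pi_ge_zero arc_continuous(1,2,3,3,4,4), where ?u0.0 = 0 and ?v0.0 = 1]) blast
  define X where "X = (of_real ((-1) ^ l) :: complex)"
  have X1: "cmod X = 1" by (simp add: X_def norm_power)
  \<comment> \<open>The formula for the entry a in terms of the columns at \<open>1\<close>, with
    approximate columns. \<open>X\<close> is \<open>expfac\<close> at -1, and \<open>T1\<close> to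
    \<open>T4\<close> carry column 1 from -1 to 1 along the arc.\<close>
  define F where "F n \<mu> = - \<i> * (X * (T1 \<mu> * LU n \<mu> + T3 \<mu> * LV n \<mu>) * RU n \<mu> + X * (T2 \<mu> * LU n \<mu> + T4 \<mu> * LV n \<mu>) * RV n \<mu>)" for n \<mu>
  let ?P = "{\<mu>. Re \<mu> > 0}"
  have hol: "F n holomorphic_on ?P" for n
    unfolding F_def using R(1,2)[of n] L(1,2)[of n] T(1,2) T'(1,2)
    by (intro holomorphic_intros) (auto intro: holomorphic_on_subset)
  have bound: "\<exists>B. \<forall>f\<in>range F. \<forall>z\<in>K. cmod (f z) \<le> B" if K: "compact K" "K \<subseteq> ?P" for K
  proof (cases "K = {}")
    case False
    obtain z0 where z0: "z0 \<in> K" "\<And>z. z \<in> K \<Longrightarrow> Re z0 \<le> Re z"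
      using continuous_attains_inf[OF K(1) False continuous_on_Re[OF continuous_on_id]] by auto
    define m where "m = Re z0"
    \<comment> \<open>The left energy bound depends on the parameter only through a positive lower
      bound for its real part, hence is uniform on the compact set.\<close>
    have m: "m > 0" using z0 K by (auto simp: m_def)
    have bd: "\<exists>B. \<forall>z\<in>K. cmod (f z) \<le> B" if "f holomorphic_on UNIV" for f
    proof -
      have "bounded (f ` K)"
        by (intro compact_imp_bounded compact_continuous_image K holomorphic_on_imp_continuous_on
            holomorphic_on_subset[OF that]) simp
      then show ?thesis unfolding bounded_iff by auto
    qed
    obtain B1 B2 B3 B4 where B: "\<forall>z\<in>K. cmod (T1 z) \<le> B1" "\<forall>z\<in>K. cmod (T2 z) \<le> B2"
      "\<forall>z\<in>K. cmod (T3 z) \<le> B3" "\<forall>z\<in>K. cmod (T4 z) \<le> B4"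
      using bd[OF T(1)] bd[OF T(2)] bd[OF T'(1)] bd[OF T'(2)] by metis
    define E where "E = sqrt (exp ((real l)\<^sup>2 / (2 * m)))"
    have E0: "E \<ge> 0" by (simp add: E_def)
    have root: "cmod x \<le> sqrt b \<and> cmod y \<le> sqrt b" if "(cmod x)\<^sup>2 + (cmod y)\<^sup>2 \<le> b" for x y b
      using that zero_le_power2[of "cmod x"] zero_le_power2[of "cmod y"]
      by (intro conjI real_le_rsqrt; linarith)
    have "cmod (F n z) \<le> (B1 * E + B3 * E) * 1 + (B2 * E + B4 * E) * 1" if z: "z \<in> K" for n z
    proof -
      obtain u v where uv: "right_ray om l z {e n..1} u v" "u (e n) = 0" "v (e n) = 1" "u 1 = RU n z" "v 1 = RV n z"
        using R(3) by blast
      have "Re z \<ge> 0" using K z by force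
      from right_ray_energy[OF uv(1) e(1) e(2) order_refl this]
      have r: "cmod (RU n z) \<le> 1 \<and> cmod (RV n z) \<le> 1" using root[of "RU n z" "RV n z" 1] by (simp add: uv)
      obtain u' v' where uv': "left_ray om l z {e n..1} u' v'" "u' (e n) = 1" "v' (e n) = 0" "u' 1 = LU n z" "v' 1 = LV n z"
        using L(3) by blast
      have "m \<le> Re z" using z0 z by (simp add: m_def)
      from left_ray_energy[OF uv'(1) e(1) e(2) order_refl m this]
      have r': "cmod (LU n z) \<le> E \<and> cmod (LV n z) \<le> E" unfolding E_def using root[of "LU n z" "LV n z"] by (simp add: uv')
      have p: "cmod (X * (a * LU n z + b * LV n z) * c) \<le> (Ba * E + Bb * E) * 1"
        if "cmod a \<le> Ba" "cmod b \<le> Bb" "cmod c \<le> 1" for a b c Ba Bb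
      proof -
        have "cmod (a * LU n z + b * LV n z) \<le> cmod a * cmod (LU n z) + cmod b * cmod (LV n z)"
          by (metis norm_mult norm_triangle_ineq)
        also have "\<dots> \<le> Ba * E + Bb * E"
          using that r' E0 by (intro add_mono mult_mono) (auto intro: order_trans[OF norm_ge_zero])
        finally have "cmod (a * LU n z + b * LV n z) \<le> Ba * E + Bb * E" .
        then show ?thesis unfolding norm_mult X1 mult_1 using that
          by (intro mult_mono) (auto intro: order_trans[OF norm_ge_zero])
      qed
      have "cmod (F n z) = cmod (X * (T1 z * LU n z + T3 z * LV n z) * RU n z + X * (T2 z * LU n z + T4 z * LV n z) * RV n z)"
        unfolding F_def norm_mult norm_minus_cancel by simp
      also have "\<dots> \<le> cmod (X * (T1 z * LU n z + T3 z * LV n z) * RU n z) + cmod (X * (T2 z * LU n z + T4 z * LV n z) * RV n z)"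
        by (rule norm_triangle_ineq)
      also have "\<dots> \<le> (B1 * E + B3 * E) * 1 + (B2 * E + B4 * E) * 1"
        by (intro add_mono p) (use B z r in auto)
      finally show ?thesis .
    qed
    then show ?thesis by blast
  qed auto
  have oP: "open ?P" by (rule open_halfspace_Re_gt)
  obtain G r where G: "G holomorphic_on ?P" "strict_mono (r :: nat \<Rightarrow> nat)"
    "\<And>x. x \<in> ?P \<Longrightarrow> (\<lambda>n. F (r n) x) \<longlonglongrightarrow> G x"
  proof (rule Montel[OF oP, of "range F" F])
    show "f holomorphic_on ?P" if "f \<in> range F" for f using that hol by auto
    show "\<exists>B. \<forall>f\<in>range F. \<forall>z\<in>K. cmod (f z) \<le> B" if "compact K" "K \<subseteq> ?P" for K
      by (rule bound[OF that])
    fix g r assume "g holomorphic_on ?P" "strict_mono (r :: nat \<Rightarrow> nat)" "\<And>x. x \<in> ?P \<Longrightarrow> (\<lambda>n. F (r n) x) \<longlonglongrightarrow> g x"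
    then show thesis by (rule that)
  qed simp
  have "G (of_real mu) = - \<i> * (H mu 1 $ 1 $ 1 * H mu 1 $ 1 $ 2 + H mu 1 $ 2 $ 1 * H mu 1 $ 2 $ 2)" if mu: "mu > 0" for mu
  proof -
    interpret normalised om l mu "S mu" "H mu" by (rule nrm[OF mu])
    let ?h = "\<lambda>i j z. H mu z $ i $ j"
    have "(cmod (RU n mu - ?h 1 2 1))\<^sup>2 + (cmod (RV n mu - ?h 2 2 1))\<^sup>2
        \<le> (cmod (0 - ?h 1 2 (of_real (e n))))\<^sup>2 + (cmod (1 - ?h 2 2 (of_real (e n))))\<^sup>2" for n
    proof -
      obtain u v where uv: "right_ray om l mu {e n..1} u v" "u (e n) = 0" "v (e n) = 1" "u 1 = RU n mu" "v 1 = RV n mu"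
        using R(3) by blast
      have "right_ray om l mu {e n..1} (\<lambda>t. u t - ?h 1 2 (of_real t)) (\<lambda>t. v t - ?h 2 2 (of_real t))"
        using lin2_sol_diff[OF uv(1) col2_right[OF e(1)]] by simp
      from right_ray_energy[OF this e(1) e(2) order_refl] mu show ?thesis by (simp add: uv)
    qed
    moreover have "(\<lambda>n. (cmod (0 - ?h 1 2 (of_real (e n))))\<^sup>2 + (cmod (1 - ?h 2 2 (of_real (e n))))\<^sup>2) \<longlonglongrightarrow> 0"
    proof -
      have "(\<lambda>n. (cmod (0 - ?h 1 2 (of_real (e n))))\<^sup>2 + (cmod (1 - ?h 2 2 (of_real (e n))))\<^sup>2) \<longlonglongrightarrow> (cmod (0 - 0))\<^sup>2 + (cmod (1 - 1))\<^sup>2"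
        by (intro tendsto_intros filterlim_compose[OF lims(1) e_lim] filterlim_compose[OF lims(2) e_lim])
      then show ?thesis by simp
    qed
    ultimately have "(\<lambda>n. RU n mu - ?h 1 2 1) \<longlonglongrightarrow> 0" "(\<lambda>n. RV n mu - ?h 2 2 1) \<longlonglongrightarrow> 0"
      by (rule tendsto_zero_of_sum_squares_le)+
    then have Rl: "(\<lambda>n. RU n mu) \<longlonglongrightarrow> ?h 1 2 1" "(\<lambda>n. RV n mu) \<longlonglongrightarrow> ?h 2 2 1"
      by (simp_all only: LIM_zero_iff)
    define M where "M = exp ((real l)\<^sup>2 / (2 * mu))"
    have "(cmod (LU n mu - ?h 1 1 (- 1)))\<^sup>2 + (cmod (LV n mu - ?h 2 1 (- 1)))\<^sup>2
        \<le> ((cmod (1 - ?h 1 1 (- of_real (e n))))\<^sup>2 + (cmod (0 - ?h 2 1 (- of_real (e n))))\<^sup>2) * M" for n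
    proof -
      obtain u v where uv: "left_ray om l mu {e n..1} u v" "u (e n) = 1" "v (e n) = 0" "u 1 = LU n mu" "v 1 = LV n mu"
        using L(3) by blast
      have "left_ray om l mu {e n..1} (\<lambda>t. u t - ?h 1 1 (- of_real t)) (\<lambda>t. v t - ?h 2 1 (- of_real t))"
        using lin2_sol_diff[OF uv(1) col1_left[OF e(1)]] by simp
      from left_ray_energy[OF this e(1) e(2) order_refl mu] show ?thesis by (simp add: uv M_def)
    qed
    moreover have "(\<lambda>n. ((cmod (1 - ?h 1 1 (- of_real (e n))))\<^sup>2 + (cmod (0 - ?h 2 1 (- of_real (e n))))\<^sup>2) * M) \<longlonglongrightarrow> 0"
    proof -
      have "(\<lambda>n. ((cmod (1 - ?h 1 1 (- of_real (e n))))\<^sup>2 + (cmod (0 - ?h 2 1 (- of_real (e n))))\<^sup>2) * M) \<longlonglongrightarrow> ((cmod (1 - 1))\<^sup>2 + (cmod (0 - 0))\<^sup>2) * M"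
        by (intro tendsto_intros filterlim_compose[OF lims(3) e_lim] filterlim_compose[OF lims(4) e_lim])
      then show ?thesis by simp
    qed
    ultimately have "(\<lambda>n. LU n mu - ?h 1 1 (- 1)) \<longlonglongrightarrow> 0" "(\<lambda>n. LV n mu - ?h 2 1 (- 1)) \<longlonglongrightarrow> 0"
      by (rule tendsto_zero_of_sum_squares_le)+
    then have Ll: "(\<lambda>n. LU n mu) \<longlonglongrightarrow> ?h 1 1 (- 1)" "(\<lambda>n. LV n mu) \<longlonglongrightarrow> ?h 2 1 (- 1)"
      by (simp_all only: LIM_zero_iff)
    have Ar: "X * (T1 mu * ?h 1 1 (- 1) + T3 mu * ?h 2 1 (- 1)) = ?h 1 1 1 \<and> X * (T2 mu * ?h 1 1 (- 1) + T4 mu * ?h 2 1 (- 1)) = ?h 2 1 1"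
    proof -
      have "arc_sol om l (of_real mu) (\<lambda>t. expfac l mu (cis (pi - t)) * ?h 1 1 (cis (pi - t))) (\<lambda>t. expfac l mu (cis (pi - t)) * ?h 2 1 (cis (pi - t)))"
        by (rule arc_of_L_sol, rule L_sol_of_L_red[OF _ h_derivs(1)[OF upper_in_S]]) (auto simp: sin_ge_zero)
      note A = this
      obtain u v where uv: "arc_sol om l (of_real mu) u v" "u 0 = 1" "v 0 = 0" "u pi = T1 mu" "v pi = T2 mu" using T(3) by blast
      obtain u' v' where uv': "arc_sol om l (of_real mu) u' v'" "u' 0 = 0" "v' 0 = 1" "u' pi = T3 mu" "v' pi = T4 mu" using T'(3) by blast
      have em: "expfac l mu (- 1) = X" by (simp add: expfac_def X_def power_inverse[symmetric])
      have e1: "expfac l mu 1 = 1" by (simp add: expfac_def)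
      show ?thesis
        using lin2_sol_unique[OF A lin2_sol_combine[OF uv(1) uv'(1), of "X * ?h 1 1 (- 1)" "X * ?h 2 1 (- 1)"]
          arc_coefficients_continuous(1,2,2,3), of pi]
        by (simp add: uv uv' em e1 algebra_simps)
    qed
    have "(\<lambda>n. F n mu) \<longlonglongrightarrow> - \<i> * (X * (T1 mu * ?h 1 1 (- 1) + T3 mu * ?h 2 1 (- 1)) * ?h 1 2 1 + X * (T2 mu * ?h 1 1 (- 1) + T4 mu * ?h 2 1 (- 1)) * ?h 2 2 1)"
      unfolding F_def by (intro tendsto_intros Rl Ll)
    then have "(\<lambda>n. F n mu) \<longlonglongrightarrow> - \<i> * (?h 1 1 1 * ?h 1 2 1 + ?h 2 1 1 * ?h 2 2 1)" using Ar by simp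
    from LIMSEQ_subseq_LIMSEQ[OF this G(2)]
    have "(\<lambda>n. F (r n) mu) \<longlonglongrightarrow> - \<i> * (?h 1 1 1 * ?h 1 2 1 + ?h 2 1 1 * ?h 2 2 1)" by (simp add: o_def)
    moreover have "(\<lambda>n. F (r n) mu) \<longlonglongrightarrow> G (of_real mu)" using G(3) mu by simp
    ultimately show ?thesis using LIMSEQ_unique by blast
  qed
  with G(1) show ?thesis by (rule that)
qed


section \<open>A parameter with an entire solution\<close>


lemma conv_radius_infinity_mult:
  fixes F G :: "complex fps"
  assumes "fps_conv_radius F = \<infinity>" "fps_conv_radius G = \<infinity>"
  shows "fps_conv_radius (F * G) = \<infinity>" "fps_conv_radius (F + G) = \<infinity>"
  using fps_conv_radius_mult[of F G] fps_conv_radius_add[of F G] assms by auto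

lemma conv_radius_infinity_deriv:
  fixes F :: "complex fps"
  assumes "fps_conv_radius F = \<infinity>"
  shows "fps_conv_radius (fps_deriv F) = \<infinity>"
  using fps_conv_radius_deriv[of F] assms by simp

text \<open>The Taylor coefficients of \<open>U\<close> alternate in sign, so nothing cancels on the negative axis.\<close>

lemma exists_entire_solution:
  assumes om: "om > 0"
  obtains \<mu> U W where "\<mu> > 0" "\<And>z. z \<noteq> 0 \<Longrightarrow> L_sol om l \<mu> U W z"
    "isCont U 0" "isCont W 0" "U 0 = 0" "W 0 = (1::complex)"
    "\<And>s. cnj (U (of_real s)) = - U (of_real s)" "\<And>s. cnj (W (of_real s)) = W (of_real s)"
    "\<And>s. s > 0 \<Longrightarrow> cmod (U (- of_real s)) \<ge> cmod (kap om) / \<mu> * s"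
proof -
  define q where "q = (1 / (2 * om))\<^sup>2"
  \<comment> \<open>The system is (L) itself and not its reduced form, so \<open>l\<close> enters
    with a plus sign and the hypothesis of the minimal solution lemma holds.\<close>
  have c: "real k + real l + q / real k \<ge> real k" for k by (simp add: q_def)
  obtain \<mu> w where \<mu>: "\<mu> > 0" and w: "w 0 = 0" "w 1 = 1"
    "\<And>k. \<mu> * (w (Suc (Suc k)) + w k) = (real (Suc k) + real l + q / real (Suc k)) * w (Suc k)"
    "\<And>k. k \<ge> 1 \<Longrightarrow> w k > (0::real)" "\<And>R. summable (\<lambda>k. w k * R ^ k)"
  proof (rule exists_positive_minimal_solution[of "\<lambda>k. real k + real l + q / real k"])
    show "real k \<le> real k + real l + q / real k" for k by (rule c)
    fix \<mu> w assume "\<mu> > 0" "w 0 = 0" "w 1 = 1"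
      "\<And>k. \<mu> * (w (Suc (Suc k)) + w k) = (real (Suc k) + real l + q / real (Suc k)) * w (Suc k)"
      "\<And>k. k \<ge> 1 \<Longrightarrow> w k > (0::real)" "\<And>R. summable (\<lambda>k. w k * R ^ k)"
    then show thesis by (rule that)
  qed
  define \<kappa> where "\<kappa> = kap om"
  have \<kappa>0: "\<kappa> \<noteq> 0" using om by (simp add: \<kappa>_def kap_nonzero)
  have \<kappa>2: "\<kappa> * \<kappa> = - of_real q" by (simp add: \<kappa>_def kap_eq q_def power2_eq_square)
  have \<kappa>c: "cnj \<kappa> = - \<kappa>" by (simp add: \<kappa>_def kap_eq)
  \<comment> \<open>The alternating sign turns the recurrence for the Taylor coefficients into the
    positive one; the factor \<open>\<kappa> / \<mu>\<close> is forced by the coefficient of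
    \<open>z\<close> together with \<open>v 0 = 1\<close>.\<close>
  define u where "u k = \<kappa> * of_real (- ((-1) ^ k) * w k / \<mu>)" for k
  define v where "v k = (if k = 0 then 1 else \<kappa> * u k / of_nat k)" for k
  have w0: "w k \<ge> 0" for k using w(1) w(4)[of k] by (cases k) (auto simp: less_imp_le)
  have su: "summable (\<lambda>k. cmod (u k * z ^ k))" for z
  proof -
    have "(\<lambda>k. cmod (u k * z ^ k)) = (\<lambda>k. cmod \<kappa> / \<mu> * (w k * cmod z ^ k))"
      using \<mu> w0 by (simp add: u_def norm_mult norm_divide norm_power abs_mult fun_eq_iff)
    then show ?thesis using summable_mult[OF w(5), of "cmod \<kappa> / \<mu>" "cmod z"] by simp
  qed
  have sv: "summable (\<lambda>k. cmod (v k * z ^ k))" for z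
  proof (rule summable_comparison_test)
    show "\<exists>N. \<forall>k\<ge>N. norm (cmod (v k * z ^ k)) \<le> cmod \<kappa> * cmod (u k * z ^ k)"
    proof (intro exI allI impI)
      fix k :: nat assume k: "1 \<le> k"
      have "cmod (v k * z ^ k) = cmod \<kappa> * cmod (u k * z ^ k) / real k"
        using k by (simp add: v_def norm_mult norm_divide)
      also have "\<dots> \<le> cmod \<kappa> * cmod (u k * z ^ k) / 1"
        using k by (intro divide_left_mono) auto
      finally show "norm (cmod (v k * z ^ k)) \<le> cmod \<kappa> * cmod (u k * z ^ k)" by simp
    qed
    show "summable (\<lambda>k. cmod \<kappa> * cmod (u k * z ^ k))" by (rule summable_mult[OF su])
  qed
  define FU where "FU = Abs_fps u"
  define FW where "FW = Abs_fps v"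
  have rU: "fps_conv_radius FU = \<infinity>" and rW: "fps_conv_radius FW = \<infinity>"
    unfolding fps_conv_radius_def FU_def FW_def
    using summable_norm_cancel[OF su] summable_norm_cancel[OF sv]
    by (auto intro!: conv_radius_inftyI'')
  define U where "U = eval_fps FU"
  define W where "W = eval_fps FW"
  have dU: "(U has_field_derivative eval_fps (fps_deriv FU) z) (at z)" for z
    unfolding U_def by (rule has_field_derivative_eval_fps) (simp add: rU)
  have dW: "(W has_field_derivative eval_fps (fps_deriv FW) z) (at z)" for z
    unfolding W_def by (rule has_field_derivative_eval_fps) (simp add: rW)
  have e1: "fps_X * fps_deriv FW = fps_const \<kappa> * FU"
  proof (rule fps_ext)
    fix k show "fps_nth (fps_X * fps_deriv FW) k = fps_nth (fps_const \<kappa> * FU) k"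
    proof (cases k)
      case 0
      then show ?thesis by (simp add: FU_def u_def w(1))
    next
      case (Suc n)
      have "of_nat (Suc n) * v (Suc n) = \<kappa> * u (Suc n)" by (simp add: v_def del: of_nat_Suc)
      then show ?thesis using Suc by (simp add: FW_def FU_def del: of_nat_Suc)
    qed
  qed
  have rec: "of_real \<mu> * u (Suc (Suc k)) + of_real \<mu> * u k = - (of_nat (Suc k) + of_nat l) * u (Suc k) + \<kappa> * (\<kappa> * u (Suc k) / of_nat (Suc k))" for k
  proof -
    have "of_real \<mu> * u (Suc (Suc k)) + of_real \<mu> * u k = \<kappa> * of_real (- ((-1) ^ k) * (\<mu> * (w (Suc (Suc k)) + w k)) / \<mu>)"
    proof -
      have mu_u: "of_real \<mu> * u j = \<kappa> * of_real (- ((-1) ^ j) * w j)" for j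
        using \<mu> by (simp add: u_def)
      have eq: "- ((-1) ^ k) * (\<mu> * (w (Suc (Suc k)) + w k)) / \<mu> = - ((-1) ^ k) * (w (Suc (Suc k)) + w k)"
        using \<mu> by simp
      show ?thesis unfolding mu_u eq by (simp add: algebra_simps)
    qed
    also have "\<dots> = - (of_nat (Suc k) + of_nat l + of_real q / of_nat (Suc k)) * u (Suc k)"
      unfolding w(3) u_def by (simp add: algebra_simps del: of_nat_Suc)
    also have "\<dots> = - (of_nat (Suc k) + of_nat l) * u (Suc k) + (\<kappa> * \<kappa>) * u (Suc k) / of_nat (Suc k)"
      unfolding \<kappa>2 by (simp add: algebra_simps del: of_nat_Suc)
    finally show ?thesis by (simp add: mult.assoc)
  qed
  have e2: "fps_X ^ 2 * fps_deriv FU + (fps_const (of_nat l) * (fps_X * FU) + (fps_const (of_real \<mu>) * FU + fps_const (of_real \<mu>) * (fps_X ^ 2 * FU)))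
      = fps_const \<kappa> * (fps_X * FW)"
  proof (rule fps_ext)
    fix k
    consider "k = 0" | "k = 1" | j where "k = Suc (Suc j)" by (metis One_nat_def nat.exhaust)
    then show "fps_nth (fps_X ^ 2 * fps_deriv FU + (fps_const (of_nat l) * (fps_X * FU) + (fps_const (of_real \<mu>) * FU + fps_const (of_real \<mu>) * (fps_X ^ 2 * FU)))) k
        = fps_nth (fps_const \<kappa> * (fps_X * FW)) k"
    proof cases
      case 1 then show ?thesis by (simp add: FU_def u_def w(1) fps_X_power_mult_nth)
    next
      case 2 then show ?thesis using \<mu> w(1,2) by (simp add: FU_def FW_def u_def v_def fps_X_power_mult_nth)
    next
      case (3 j)
      have "of_nat (Suc j) * u (Suc j) + (of_nat l * u (Suc j) + (of_real \<mu> * u (Suc (Suc j)) + of_real \<mu> * u j)) = \<kappa> * v (Suc j)"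
        using rec[of j] by (simp add: v_def algebra_simps del: of_nat_Suc)
      then show ?thesis using 3 by (simp add: FU_def FW_def fps_X_power_mult_nth del: of_nat_Suc)
    qed
  qed
  note radii = rU rW conv_radius_infinity_mult conv_radius_infinity_deriv
  have o1: "z * eval_fps (fps_deriv FW) z = \<kappa> * U z" for z
    using arg_cong[OF e1, of "\<lambda>F. eval_fps F z"] by (simp add: eval_fps_mult radii U_def)
  have o2: "z ^ 2 * eval_fps (fps_deriv FU) z + (of_nat l * (z * U z) + (of_real \<mu> * U z + of_real \<mu> * (z ^ 2 * U z))) = \<kappa> * (z * W z)" for z
    using arg_cong[OF e2, of "\<lambda>F. eval_fps F z"]
    by (simp add: eval_fps_mult eval_fps_add radii U_def W_def)
  have sol: "L_sol om l \<mu> U W z" if z: "z \<noteq> 0" for z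
    unfolding L_sol_def \<kappa>_def[symmetric]
  proof
    have "z ^ 2 * eval_fps (fps_deriv FU) z = \<kappa> * (z * W z) - (of_nat l * (z * U z) + (of_real \<mu> * U z + of_real \<mu> * (z ^ 2 * U z)))"
      using o2[of z] by (simp add: eq_diff_eq)
    then have "eval_fps (fps_deriv FU) z = (\<kappa> * (z * W z) - (of_nat l * (z * U z) + (of_real \<mu> * U z + of_real \<mu> * (z ^ 2 * U z)))) / z ^ 2"
      using z by (simp add: eq_divide_eq mult.commute)
    also have "\<dots> = kdiag l \<mu> z * U z + \<kappa> / z * W z"
      using z by (simp add: kdiag_def field_simps power2_eq_square)
    finally show "(U has_field_derivative kdiag l \<mu> z * U z + \<kappa> / z * W z) (at z)" using dU[of z] by simp
    have "eval_fps (fps_deriv FW) z = \<kappa> / z * U z" using o1[of z] z by (simp add: field_simps)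
    then show "(W has_field_derivative \<kappa> / z * U z) (at z)" using dW[of z] by simp
  qed
  have cU: "isCont U 0" and cW: "isCont W 0" using dU dW DERIV_isCont by blast+
  have U0: "U 0 = 0" and W0: "W 0 = 1"
    by (simp_all add: U_def W_def FU_def FW_def u_def v_def w(1) eval_fps_at_0)
  have ucnj: "cnj (u k) = - u k" and vcnj: "cnj (v k) = v k" for k
    using \<kappa>c by (simp_all add: u_def v_def)
  have Ueq: "U z = (\<Sum>k. u k * z ^ k)" and Weq: "W z = (\<Sum>k. v k * z ^ k)" for z
    by (simp_all add: U_def W_def eval_fps_def FU_def FW_def)
  have Ucnj: "cnj (U (of_real s)) = - U (of_real s)" for s
  proof -
    have "cnj (U (of_real s)) = (\<Sum>k. cnj (u k * of_real s ^ k))"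
      unfolding Ueq by (rule bounded_linear.suminf[OF bounded_linear_cnj summable_norm_cancel[OF su]])
    also have "\<dots> = (\<Sum>k. - (u k * of_real s ^ k))" by (simp add: ucnj)
    also have "\<dots> = - U (of_real s)" unfolding Ueq by (rule suminf_minus[OF summable_norm_cancel[OF su]])
    finally show ?thesis .
  qed
  have Wcnj: "cnj (W (of_real s)) = W (of_real s)" for s
  proof -
    have "cnj (W (of_real s)) = (\<Sum>k. cnj (v k * of_real s ^ k))"
      unfolding Weq by (rule bounded_linear.suminf[OF bounded_linear_cnj summable_norm_cancel[OF sv]])
    also have "\<dots> = W (of_real s)" unfolding Weq by (simp add: vcnj)
    finally show ?thesis .
  qed
  \<comment> \<open>At \<open>- s\<close> all terms have the same phase, so the term with
    \<open>k = 1\<close> alone is a lower bound.\<close>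
  have lower: "cmod (U (- of_real s)) \<ge> cmod \<kappa> / \<mu> * s" if s: "s > 0" for s
  proof -
    have t: "u k * (- of_real s) ^ k = - \<kappa> / of_real \<mu> * of_real (w k * s ^ k)" for k
    proof -
      have "(- complex_of_real s) ^ k = of_real ((-1) ^ k * s ^ k)" by (simp add: power_minus[of "complex_of_real s"])
      then show ?thesis by (simp add: u_def)
    qed
    have "U (- of_real s) = (\<Sum>k. - \<kappa> / of_real \<mu> * of_real (w k * s ^ k))" unfolding Ueq t ..
    also have "\<dots> = - \<kappa> / of_real \<mu> * (\<Sum>k. of_real (w k * s ^ k))"
      using w(5)[of s] by (intro suminf_mult summable_of_real)
    also have "(\<Sum>k. of_real (w k * s ^ k)) = complex_of_real (\<Sum>k. w k * s ^ k)"
      by (rule suminf_of_real[OF w(5), symmetric])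
    finally have "cmod (U (- of_real s)) = cmod \<kappa> / \<mu> * \<bar>\<Sum>k. w k * s ^ k\<bar>"
      using \<mu> by (simp add: norm_mult norm_divide)
    moreover have "s \<le> (\<Sum>k. w k * s ^ k)"
    proof -
      have "(\<Sum>k\<in>{1}. w k * s ^ k) \<le> (\<Sum>k. w k * s ^ k)"
        using w0 s by (intro sum_le_suminf w(5)) auto
      then show ?thesis using w(2) by simp
    qed
    then have "cmod \<kappa> / \<mu> * s \<le> cmod \<kappa> / \<mu> * \<bar>\<Sum>k. w k * s ^ k\<bar>"
      using \<mu> by (intro mult_left_mono) auto
    ultimately show ?thesis by simp
  qed
  show ?thesis
    by (rule that[OF \<mu> sol cU cW U0 W0 Ucnj Wcnj lower[unfolded \<kappa>_def]])
qed

text \<open>The entire solution is column 2. If \<open>alpha = 0\<close>, column 1 at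
  \<open>1\<close> is a real combination of column 2 and the image of column 2 under the involution.
  Symmetry at -1 removes the first part; the rest grows at least like \<open>1 / s\<close> at
  \<open>- s\<close>, so the limit 0 of the lower entry removes it too, against determinant
  1.\<close>

lemma (in normalised) alpha_nonzero_of_entire_solution:
  assumes sol: "\<And>z. z \<noteq> 0 \<Longrightarrow> L_sol om l mu U W z"
    and cont: "isCont U 0" "isCont W 0" and at0: "U 0 = 0" "W 0 = 1"
    and Ucnj: "\<And>s. cnj (U (of_real s)) = - U (of_real s)" and Wcnj: "\<And>s. cnj (W (of_real s)) = W (of_real s)"
    and lower: "\<And>s. s > 0 \<Longrightarrow> cmod (U (- of_real s)) \<ge> C * s" and C: "C > 0"
  shows "alpha \<noteq> 0"
proof
  assume al: "alpha = 0"
  have "((\<lambda>s. complex_of_real s) \<longlongrightarrow> of_real 0) (at_right 0)" by (intro tendsto_intros)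
  then have tend: "(complex_of_real \<longlongrightarrow> 0) (at_right 0)" by simp
  have UW: "((\<lambda>s. U (of_real s)) \<longlongrightarrow> 0) (at_right 0)" "((\<lambda>s. W (of_real s)) \<longlongrightarrow> 1) (at_right 0)"
    using isCont_tendsto_compose[OF cont(1) tend] isCont_tendsto_compose[OF cont(2) tend] by (simp_all add: at0)
  have l1: "((\<lambda>s. h 1 2 (of_real s) - U (of_real s)) \<longlongrightarrow> 0) (at_right 0)"
    "((\<lambda>s. h 2 2 (of_real s) - W (of_real s)) \<longlongrightarrow> 0) (at_right 0)"
    using tendsto_diff[OF lims(1) UW(1)] tendsto_diff[OF lims(2) UW(2)] by simp_all
  have rs: "right_ray om l (of_real mu) {e..1} (\<lambda>s. h 1 2 (of_real s) - U (of_real s)) (\<lambda>s. h 2 2 (of_real s) - W (of_real s))"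
    if "e > 0" for e
  proof -
    have "right_ray om l (of_real mu) {e..1} (\<lambda>s. U (of_real s)) (\<lambda>s. W (of_real s))"
      by (rule right_ray_of_L_sol[OF that]) (use that in \<open>auto intro!: sol\<close>)
    from lin2_sol_diff[OF col2_right[OF that] this] show ?thesis by simp
  qed
  have "h 1 2 (of_real 1) - U (of_real 1) = 0" "h 2 2 (of_real 1) - W (of_real 1) = 0"
    using right_ray_null[OF rs _ l1, of 1] mu by simp_all
  then have at1: "U 1 = \<i> * of_real p" "W 1 = of_real t" using col2_at_1 by simp_all
  obtain \<tau> where \<tau>: "Im (h 1 1 1) = \<tau> * p" "Re (h 2 1 1) = \<tau> * t" by (rule obtains_tau)
  have nz: "p\<^sup>2 + t\<^sup>2 > 0" using det_parts(1) by (auto simp: sum_power2_gt_zero_iff)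
  \<comment> \<open>Vanishing of \<open>alpha\<close> makes
    \<open>(Re (h 1 1 1), Im (h 2 1 1))\<close> orthogonal to \<open>(p, t)\<close>, hence equal to
    \<open>\<sigma>\<close> times \<open>(t, - p)\<close>.\<close>
  define \<sigma> where "\<sigma> = (Re (h 1 1 1) * t - Im (h 2 1 1) * p) / (p\<^sup>2 + t\<^sup>2)"
  have ort: "Im (h 2 1 1) * t = - (Re (h 1 1 1) * p)" using al unfolding alpha_def by simp
  have "Re (h 1 1 1) * (p\<^sup>2 + t\<^sup>2) = (Re (h 1 1 1) * p) * p + Re (h 1 1 1) * t * t"
    by (simp add: power2_eq_square algebra_simps)
  also have "Re (h 1 1 1) * p = - (Im (h 2 1 1) * t)" using ort by simp
  finally have 1: "Re (h 1 1 1) * (p\<^sup>2 + t\<^sup>2) = (Re (h 1 1 1) * t - Im (h 2 1 1) * p) * t"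
    by (simp add: algebra_simps)
  have "Im (h 2 1 1) * (p\<^sup>2 + t\<^sup>2) = Im (h 2 1 1) * p * p + (Im (h 2 1 1) * t) * t"
    by (simp add: power2_eq_square algebra_simps)
  also have "\<dots> = - ((Re (h 1 1 1) * t - Im (h 2 1 1) * p) * p)"
    unfolding ort by (simp add: algebra_simps)
  finally have 2: "Im (h 2 1 1) * (p\<^sup>2 + t\<^sup>2) = - ((Re (h 1 1 1) * t - Im (h 2 1 1) * p) * p)" .
  have \<sigma>: "Re (h 1 1 1) = \<sigma> * t" "Im (h 2 1 1) = - (\<sigma> * p)"
    unfolding \<sigma>_def times_divide_eq_left minus_divide_left 1[symmetric] 2[symmetric] using nz by auto
  have h1: "h 1 1 1 = of_real \<sigma> * W 1 + of_real \<tau> * U 1" "h 2 1 1 = of_real \<sigma> * - U 1 + of_real \<tau> * W 1"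
    unfolding at1 using \<sigma> \<tau> by (simp_all add: complex_eq_iff)
  let ?E = "expfac l mu"
  have A1: "arc_sol om l (of_real mu) (\<lambda>s. ?E (cis (pi - s)) * h 1 1 (cis (pi - s))) (\<lambda>s. ?E (cis (pi - s)) * h 2 1 (cis (pi - s)))"
    by (rule arc_of_L_sol, rule L_sol_of_L_red[OF _ h_derivs(1)[OF upper_in_S]]) (auto simp: sin_ge_zero)
  have K: "L_red om l mu (\<lambda>z. W (1 / z)) (\<lambda>z. - U (1 / z)) z" if "z \<noteq> 0" for z
    using L_red_inverse[OF that sol] that by simp
  have A2: "arc_sol om l (of_real mu) (\<lambda>s. ?E (cis (pi - s)) * W (1 / cis (pi - s))) (\<lambda>s. ?E (cis (pi - s)) * - U (1 / cis (pi - s)))"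
    by (rule arc_of_L_sol, rule L_sol_of_L_red[OF _ K]) auto
  have A3: "arc_sol om l (of_real mu) (\<lambda>s. U (cis (pi - s))) (\<lambda>s. W (cis (pi - s)))"
    by (rule arc_of_L_sol, rule sol) auto
  have em: "?E (- 1) = of_real ((-1) ^ l)" "?E 1 = 1" by (simp_all add: expfac_def power_inverse[symmetric])
  have q: "?E (- 1) * h 1 1 (- 1) = of_real \<sigma> * (?E (- 1) * W (- 1)) + of_real \<tau> * U (- 1)"
    "?E (- 1) * h 2 1 (- 1) = of_real \<sigma> * (?E (- 1) * - U (- 1)) + of_real \<tau> * W (- 1)"
    using lin2_sol_unique_backward[OF A1 lin2_sol_combine[OF A2 A3, of "of_real \<sigma>" "of_real \<tau>"]
        arc_coefficients_continuous(1,2,2,3), of 0] h1 by (simp_all add: em)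
  have "U (- of_real 1) \<noteq> 0" using lower[of 1] C by auto
  then have Um: "U (- 1) \<noteq> 0" by simp
  have cU: "cnj (U (- of_real s)) = - U (- of_real s)" and cW: "cnj (W (- of_real s)) = W (- of_real s)" for s
    using Ucnj[of "- s"] Wcnj[of "- s"] by simp_all
  \<comment> \<open>At -1 the first components of column 1 and of the involution image are real,
    while that of column 2 is imaginary and nonzero; so \<open>\<tau> = 0\<close>.\<close>
  have "cnj (?E (- 1) * h 1 1 (- 1)) = ?E (- 1) * h 1 1 (- 1)"
    using col1_reality[of 1] by (simp add: em)
  then have "of_real \<tau> * U (- 1) = - (of_real \<tau> * U (- 1))"
    unfolding q using cU[of 1] cW[of 1] by (simp add: em)
  then have "of_real \<tau> * U (- 1) = 0" by (simp add: equation_minus_iff)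
  then have \<tau>0: "\<tau> = 0" using Um by simp
  have "?E (- 1) \<noteq> 0" by (simp add: em)
  \<comment> \<open>The zero summands match \<open>lin2_sol_combine\<close> with second factor 0,
    which serves below as multiplication by \<open>\<sigma>\<close>.\<close>
  then have hm: "h 1 1 (- 1) = of_real \<sigma> * W (- 1) + 0 * 0" "h 2 1 (- 1) = of_real \<sigma> * - U (- 1) + 0 * 0"
  proof -
    have "?E (- 1) * h 1 1 (- 1) = ?E (- 1) * (of_real \<sigma> * W (- 1))"
      "?E (- 1) * h 2 1 (- 1) = ?E (- 1) * (of_real \<sigma> * - U (- 1))"
      using q unfolding \<tau>0 by (simp_all add: mult.left_commute)
    then show "h 1 1 (- 1) = of_real \<sigma> * W (- 1) + 0 * 0" "h 2 1 (- 1) = of_real \<sigma> * - U (- 1) + 0 * 0"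
      by (simp_all only: mult_left_cancel[OF \<open>?E (- 1) \<noteq> 0\<close>] mult_zero_left add_0_right)
  qed
  have eq: "h 2 1 (- of_real s) = of_real \<sigma> * - U (1 / - of_real s)" if s: "0 < s" "s \<le> 1" for s
  proof -
    have K': "left_ray om l (of_real mu) {s..1} (\<lambda>r. W (1 / - of_real r)) (\<lambda>r. - U (1 / - of_real r))"
      by (rule left_ray_of_L_red[OF s(1) K]) (use s in auto)
    have c: "continuous_on {s..1} (\<lambda>_. 0 + of_real mu * 0 :: complex)"
      "continuous_on {s..1} (\<lambda>r. kap om / complex_of_real r)"
      "continuous_on {s..1} (\<lambda>r. complex_of_real (real l / r) + of_real mu * - of_real ((1 + r\<^sup>2) / r\<^sup>2))"
      using s by (auto intro!: continuous_intros)
    have "h 2 1 (- of_real s) = of_real \<sigma> * - U (1 / - of_real s) + 0 * - U (1 / - of_real s)"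
      using lin2_sol_unique_backward(2)[OF col1_left[OF s(1)] lin2_sol_combine[OF K' K', of "of_real \<sigma>" 0] c(1,2,2,3), of s] hm s
      by simp
    then show ?thesis by simp
  qed
  have "\<sigma> = 0"
  proof (rule ccontr)
    assume "\<sigma> \<noteq> 0"
    then have pos: "\<bar>\<sigma>\<bar> * C > 0" using C by simp
    have "((\<lambda>s. cmod (h 2 1 (- of_real s))) \<longlongrightarrow> cmod 0) (at_right 0)" by (intro tendsto_intros lims)
    then have "\<forall>\<^sub>F s in at_right 0. cmod (h 2 1 (- of_real s)) < \<bar>\<sigma>\<bar> * C"
      using pos by (auto dest: order_tendstoD(2))
    moreover have "\<forall>\<^sub>F s::real in at_right 0. s \<in> {0<..<1}" by (rule eventually_at_right_real) simp
    ultimately have "\<forall>\<^sub>F s in at_right 0. cmod (h 2 1 (- of_real s)) < \<bar>\<sigma>\<bar> * C \<and> s \<in> {0<..<1}"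
      by eventually_elim auto
    then obtain s where s: "cmod (h 2 1 (- of_real s)) < \<bar>\<sigma>\<bar> * C" "0 < s" "s < 1"
      using eventually_happens'[OF trivial_limit_at_right_real] by fastforce
    have "1 / - complex_of_real s = - of_real (1 / s)" by simp
    then have "cmod (h 2 1 (- of_real s)) = \<bar>\<sigma>\<bar> * cmod (U (- of_real (1 / s)))"
      using eq[of s] s by (simp add: norm_mult)
    also have "\<dots> \<ge> \<bar>\<sigma>\<bar> * (C * (1 / s))" using s by (intro mult_left_mono lower) auto
    finally have "\<bar>\<sigma>\<bar> * C * (1 / s) < \<bar>\<sigma>\<bar> * C * 1" using s(1) by (simp add: mult.assoc)
    then have "1 / s < 1" using pos by (simp only: mult_less_cancel_left_pos)
    then show False using s by (simp add: field_simps)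
  qed
  then show False using det_real h1 \<tau>0 by simp
qed

lemma exists_alpha_nonzero:
  assumes "om > 0"
  obtains \<mu> where "\<mu> > 0" "\<And>S H. normalised om l \<mu> S H \<Longrightarrow> normalised.alpha H \<noteq> 0"
proof -
  show ?thesis
  proof (rule exists_entire_solution[OF assms, of l])
    fix \<mu> U W assume *: "\<mu> > 0" "\<And>z. z \<noteq> 0 \<Longrightarrow> L_sol om l \<mu> U W z"
      "isCont U 0" "isCont W 0" "U 0 = 0" "W 0 = (1::complex)"
      "\<And>s. cnj (U (of_real s)) = - U (of_real s)" "\<And>s. cnj (W (of_real s)) = W (of_real s)"
      "\<And>s. s > 0 \<Longrightarrow> cmod (U (- of_real s)) \<ge> cmod (kap om) / \<mu> * s"
    have "cmod (kap om) / \<mu> > 0" using *(1) kap_nonzero[OF assms] by simp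
    then show thesis
      using that[OF *(1)] normalised.alpha_nonzero_of_entire_solution[OF _ *(2-9)] by blast
  qed
qed


section \<open>Imaginary off-diagonal entries\<close>

theorem mainTheorem15:
  fixes om :: real and l :: nat
    and S :: "real \<Rightarrow> complex set"
    and H :: "real \<Rightarrow> complex \<Rightarrow> complex^2^2"
    and Q :: "real \<Rightarrow> complex^2^2"
  assumes om_pos: "om > 0"
    and S_adm: "\<And>mu. mu > 0 \<Longrightarrow> admissible_Splus (S mu)"
    and H_norm: "\<And>mu. mu > 0 \<Longrightarrow> is_normaliser om l mu (S mu) (H mu)"
    and Q_trans: "\<And>mu z. mu > 0 \<Longrightarrow> z \<in> Sigma1 (S mu) \<Longrightarrow>
                     WplusMN l mu (H mu) z = What l mu (H mu) z ** Q mu"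
  shows "(\<forall>mu>0. Re (Q mu $ 1 $ 2) = 0)
       \<and> (\<forall>mu>0. constriction om (om * of_nat l) (2 * om * mu) \<longrightarrow> Re (- (Q mu $ 2 $ 1)) = 0)
       \<and> (l \<ge> 1 \<longrightarrow> discrete {mu. mu > 0 \<and> Re (- (Q mu $ 2 $ 1)) = 0})"
proof -
  have nrm: "normalised om l mu (S mu) (H mu)" if "mu > 0" for mu
    using om_pos that S_adm[OF that] H_norm[OF that] by (rule normalised.intro)
  have Q12: "Q mu $ 1 $ 2 = \<i> * ((H mu 1 $ 1 $ 2)\<^sup>2 + (H mu 1 $ 2 $ 2)\<^sup>2)"
    and Q21: "Q mu $ 2 $ 1 = - \<i> * ((H mu 1 $ 1 $ 1)\<^sup>2 + (H mu 1 $ 2 $ 1)\<^sup>2)" if "mu > 0" for mu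
    using normalised.Q_entries[OF nrm[OF that] Q_trans[OF that normalised.one_in_Sigma1[OF nrm[OF that]]]] by auto
  have c: "Re (- (Q mu $ 2 $ 1)) = - Im ((H mu 1 $ 1 $ 1)\<^sup>2 + (H mu 1 $ 2 $ 1)\<^sup>2)" if "mu > 0" for mu
    unfolding Q21[OF that] by simp
  have 1: "Re (Q mu $ 1 $ 2) = 0" if mu: "mu > 0" for mu
    unfolding Q12[OF mu] normalised.col2_at_1[OF nrm[OF mu]] by (simp add: power2_eq_square)
  have 2: "Re (- (Q mu $ 2 $ 1)) = 0" if mu: "mu > 0" and con: "constriction om (om * of_nat l) (2 * om * mu)" for mu
    unfolding c[OF mu] using normalised.constriction_imp_reality[OF nrm[OF mu] con] by (simp add: power2_eq_square)
  have "(1 / (2 * om))\<^sup>2 > 0" using om_pos by simp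
  from recurrence_characteristic_function[OF this, of l] obtain D where
    D: "D holomorphic_on UNIV" "\<exists>\<mu>. D \<mu> \<noteq> 0"
      "\<And>\<mu> y M R. \<mu> \<noteq> 0 \<Longrightarrow> y 0 = 0 \<Longrightarrow> y 1 \<noteq> 0 \<Longrightarrow>
       (\<And>k. \<mu> * (y (Suc (Suc k)) + y k) = of_real (real (Suc k) - real l + (1 / (2 * om))\<^sup>2 / real (Suc k)) * y (Suc k)) \<Longrightarrow>
       (\<And>k. cmod (y k) \<le> M * R ^ k) \<Longrightarrow> D \<mu> = 0"
    by blast
  obtain G where G: "G holomorphic_on {\<mu>. Re \<mu> > 0}"
    "\<And>mu. mu > 0 \<Longrightarrow> G (of_real mu) = - \<i> * (H mu 1 $ 1 $ 1 * H mu 1 $ 1 $ 2 + H mu 1 $ 2 $ 1 * H mu 1 $ 2 $ 2)"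
    using transition_entry_holomorphic[of om l S H] nrm by blast
  obtain mu0 where mu0: "mu0 > 0" "normalised.alpha (H mu0) \<noteq> 0"
    using exists_alpha_nonzero[OF om_pos, of l] nrm by metis
  let ?P = "{\<mu>. Re \<mu> > 0}"
  \<comment> \<open>On the real axis this is twice the real part of \<open>G\<close>, that is
    \<open>2 * alpha\<close>; conjugating both argument and value keeps the sum holomorphic.\<close>
  define A where "A \<mu> = G \<mu> + cnj (G (cnj \<mu>))" for \<mu>
  have oP: "open ?P" by (rule open_halfspace_Re_gt)
  have cP: "connected ?P" by (intro convex_connected convex_halfspace_Re_gt)
  have "cnj ` ?P = ?P"
    by (auto intro!: image_eqI[where x = "cnj _"])
  then have "cnj \<circ> G \<circ> cnj holomorphic_on ?P"
    using holomorphic_on_compose_cnj_cnj[of G ?P] G(1) oP by simp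
  then have A_hol: "A holomorphic_on ?P"
    unfolding A_def using G(1) by (intro holomorphic_intros) (simp_all add: o_def)
  have A_real: "A (of_real mu) = of_real (2 * normalised.alpha (H mu))" if mu: "mu > 0" for mu
  proof -
    interpret normalised om l mu "S mu" "H mu" by (rule nrm[OF mu])
    show ?thesis unfolding A_def complex_cnj_complex_of_real G(2)[OF mu] col2_at_1
      by (simp add: complex_eq_iff alpha_def)
  qed
  \<comment> \<open>Re c equals \<open>- 2 * \<tau> * alpha\<close>. Vanishing of \<open>D\<close>
    is only a necessary condition for \<open>\<tau> = 0\<close>, which suffices to cover the zero
    set.\<close>
  have zero: "A (of_real mu) = 0 \<or> D (of_real mu) = 0" if mu: "mu > 0" and r: "Re (- (Q mu $ 2 $ 1)) = 0" for mu
  proof -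
    interpret normalised om l mu "S mu" "H mu" by (rule nrm[OF mu])
    obtain \<tau> where \<tau>: "Im (H mu 1 $ 1 $ 1) = \<tau> * p" "Re (H mu 1 $ 2 $ 1) = \<tau> * t"
      "Im ((H mu 1 $ 1 $ 1)\<^sup>2 + (H mu 1 $ 2 $ 1)\<^sup>2) = 2 * \<tau> * alpha" by (rule obtains_tau)
    have "\<tau> * alpha = 0" using r unfolding c[OF mu] \<tau>(3) by simp
    then consider "alpha = 0" | "\<tau> = 0" by auto
    then show ?thesis
    proof cases
      case 1 then show ?thesis using A_real[OF mu] by simp
    next
      case 2
      then have "Im (H mu 1 $ 1 $ 1) = 0" "Re (H mu 1 $ 2 $ 1) = 0" using \<tau> by auto
      then obtain y M where "y 0 = 0" "y 1 \<noteq> 0"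
        "\<And>k. of_real mu * (y (Suc (Suc k)) + y k) = of_real (real (Suc k) - real l + (1 / (2 * om))\<^sup>2 / real (Suc k)) * y (Suc k)"
        "\<And>k. cmod (y k) \<le> M * 2 ^ k"
        by (rule real_imp_bounded_recurrence) blast
      then have "D (of_real mu) = 0" using D(3)[of "of_real mu" y M 2] mu by simp
      then show ?thesis ..
    qed
  qed
  \<comment> \<open>At a given zero of Re c perhaps only one of \<open>A\<close> and
    \<open>D\<close> vanishes, so a zero-free punctured neighbourhood is shown in both cases: by
    isolated zeros, or by continuity.\<close>
  have isol: "\<exists>e>0. \<forall>y. y \<noteq> x \<longrightarrow> \<bar>y - x\<bar> < e \<longrightarrow> f (of_real y) \<noteq> 0"
    if f: "f holomorphic_on T" "open T" "connected T" "of_real x \<in> T" "b \<in> T" "f b \<noteq> 0" for f T x b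
  proof (cases "f (of_real x) = 0")
    case True
    obtain e where e: "e > 0" "\<And>z. z \<in> ball (of_real x) e - {of_real x} \<Longrightarrow> f z \<noteq> 0"
      using isolated_zeros[OF f(1-4) True f(5,6)] by blast
    show ?thesis
    proof (intro exI conjI allI impI)
      fix y assume "y \<noteq> x" "\<bar>y - x\<bar> < e"
      then show "f (of_real y) \<noteq> 0" using e(2)[of "of_real y"]
        by (simp add: dist_norm flip: of_real_diff)
    qed (rule e(1))
  next
    case False
    have "isCont f (of_real x)"
      using f(1,2,4) by (metis holomorphic_on_imp_continuous_on continuous_on_eq_continuous_at)
    from continuous_at_avoid[OF this False] obtain e where e: "e > 0" "\<forall>y. dist (of_real x) y < e \<longrightarrow> f y \<noteq> 0" by blast
    show ?thesis
    proof (intro exI conjI allI impI)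
      fix y assume "y \<noteq> x" "\<bar>y - x\<bar> < e"
      then show "f (of_real y) \<noteq> 0" using e(2)[rule_format, of "of_real y"]
        by (simp add: dist_norm abs_minus_commute flip: of_real_diff)
    qed (rule e(1))
  qed
  have "discrete {mu. mu > 0 \<and> Re (- (Q mu $ 2 $ 1)) = 0}" (is "discrete ?Z")
  proof (rule discreteI)
    fix x assume x: "x \<in> ?Z"
    obtain e1 where e1: "e1 > 0" "\<And>y. y \<noteq> x \<Longrightarrow> \<bar>y - x\<bar> < e1 \<Longrightarrow> A (of_real y) \<noteq> 0"
      using isol[OF A_hol oP cP, of x "of_real mu0"] x mu0 A_real[OF mu0(1)] by auto
    obtain b where "D b \<noteq> 0" using D(2) by blast
    then obtain e2 where e2: "e2 > 0" "\<And>y. y \<noteq> x \<Longrightarrow> \<bar>y - x\<bar> < e2 \<Longrightarrow> D (of_real y) \<noteq> 0"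
      using isol[OF D(1) open_UNIV connected_UNIV, of x b] by auto
    have "ball x (min e1 e2) \<inter> ?Z = {x}"
    proof
      show "ball x (min e1 e2) \<inter> ?Z \<subseteq> {x}"
      proof
        fix y assume y: "y \<in> ball x (min e1 e2) \<inter> ?Z"
        then have "A (of_real y) = 0 \<or> D (of_real y) = 0" using zero[of y] by blast
        moreover have "\<bar>y - x\<bar> < e1" "\<bar>y - x\<bar> < e2" using y by (auto simp: dist_real_def)
        ultimately show "y \<in> {x}" using e1(2)[of y] e2(2)[of y] by blast
      qed
      show "{x} \<subseteq> ball x (min e1 e2) \<inter> ?Z" using x e1(1) e2(1) by auto
    qed
    then show "x isolated_in ?Z" unfolding isolated_in_def using x open_ball by blast
  qed
  then show ?thesis using 1 2 by blast
qed

end
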